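(* Suppose $\Phi$ is adapted to the natural filtration of $L$ with $\mathbb E[\sup_{s\in[-r,0]}|\Phi_s|^2]<\infty$ and $\mathbb E[L_1^4]<\infty$, let $X$ be the unique strong solution of the CDGARCH variance equation with initial condition $\Phi$, let $m(t):=\mathbb E[X_t]$ for $t\in[-r,\infty)$, and let $\phi(u)=\mathbb E[\Phi_u]$ on $[-r,0]$, assumed positive. Write $c_0:=c_\mu-\kappa_2c_\nu$ and $f:=f_\mu+\kappa_2f_\nu$. Then: (a) $m$ is finite-valued, continuously differentiable on $(0,\infty)$ and satisfies $\frac{d}{dt}m(t)=\eta-c_0m(t)+\int_{-r}^0m(t+u)f(u)\,du$ for $t>0$, with $m(u)=\phi(u)$ for $u\in[-r,0]$; (b) $m$ satisfies the renewal equation $m(t)=\int_0^t\zeta(t-u)m(u)\,du+h(t)$, $t>0$, with $m(0)=\phi(0)$, where $\zeta(t)=-c_0\mathbf 1_{(0,\infty)}(t)+\int_0^{t\wedge r}f(-u)\,du$ for $t\in[0,\infty)$ and $$h(t)=m(0)+\frac{\eta}{\zeta(r)}\int_0^t\zeta(u)\,du+\int_0^r(\zeta(t+u)-\zeta(u))\Big(m(-u)+\frac{\eta}{\zeta(r)}\Big)du.$$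
   Context: Let $p,q\ge0$, $r:=p\vee q>0$, $(\Omega,\mathcal F,\mathbb F=(\mathcal F_t)_{t\ge-r},\mathbb P)$ a filtered probability space with the usual conditions, and $(L_t)_{t\ge-r}$ a càdlàg adapted centered square-integrable Lévy process with $L_{-r}=0$, increments independent of the past and stationary, Lévy measure $\Pi_L$ and no Brownian component; $S=[L,L]$, $S_t=\sum_{-r<s\le t}(\Delta L_s)^2$, $\kappa_2=\int z^2\Pi_L(dz)$. Parameters: $\eta>0$, $c_\mu,c_\nu>0$, $f_\mu,f_\nu$ nonnegative continuous supported on $[-p,0]$, $[-q,0]$; $\mu(E)=\int_{E\cap[-p,0]}f_\mu-c_\mu\delta_0(E)$, $\nu(E)=\int_{E\cap[-q,0]}f_\nu+c_\nu\delta_0(E)$. Extend $\Phi_t=\Phi_0$ for $t>0$, $\theta_t=\Phi_t+\eta t\mathbf 1_{[0,\infty)}(t)$. CDGARCH variance equation: $X_t=\theta_t+\int_{-p}^0\int_u^{t+u}X_s\,ds\,\mu(du)+\int_{-q}^0\int_{u+}^{t+u}X_{s-}\,dS_s\,\nu(du)$, $t\ge0$, $X=\Phi$ on $[-r,0]$; its strong solution is the unique adapted càdlàg $X$ with $\mathbb E[\sup_{s\in[-r,t]}|X_s|^2]<\infty$ for all $t$ satisfying it. In (b), $m(-u)$ for $u\in[0,r]$ equals $\phi(-u)$.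
   Formalization: Part (b) is stated under the extra condition ζ(r) ≠ 0, since h(t) divides by ζ(r), which the stated parameters allow to vanish (when c_0 equals the integral of f over [-r,0]); part (a) is unrestricted. *)

theory Defs
  imports "HOL-Probability.Probability"
begin

definition cadlag_from :: "real \<Rightarrow> (real \<Rightarrow> real) \<Rightarrow> bool" where
  "cadlag_from a g \<longleftrightarrow>
     (\<forall>t\<ge>a. (g \<longlongrightarrow> g t) (at_right t)) \<and>
     (\<forall>t>a. \<exists>l. (g \<longlongrightarrow> l) (at_left t))"

definition left_lim :: "(real \<Rightarrow> real) \<Rightarrow> real \<Rightarrow> real" where
  "left_lim g s = Lim (at_left s) g"

definition jump :: "(real \<Rightarrow> real) \<Rightarrow> real \<Rightarrow> real" where
  "jump g s = g s - left_lim g s"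

text \<open>Pathwise Lebesgue--Stieltjes integral over (a,b] of X_{s-} with respect to
 S = [L,L], S_t = sum of squared jumps, i.e. sum over s in (a,b] of X_{s-} (\<Delta>L_s)^2.\<close>
definition dS_integral :: "(real \<Rightarrow> real) \<Rightarrow> (real \<Rightarrow> real) \<Rightarrow> real \<Rightarrow> real \<Rightarrow> real" where
  "dS_integral x l a b = (\<Sum>\<^sub>\<infinity>s\<in>{a<..b}. left_lim x s * (jump l s)^2)"

definition filtration_usual :: "'a measure \<Rightarrow> real \<Rightarrow> (real \<Rightarrow> 'a set set) \<Rightarrow> bool" where
  "filtration_usual M a F \<longleftrightarrow>
     (\<forall>t\<ge>a. sigma_algebra (space M) (F t) \<and> F t \<subseteq> sets M) \<and>
     (\<forall>s t. a \<le> s \<longrightarrow> s \<le> t \<longrightarrow> F s \<subseteq> F t) \<and>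
     (\<forall>t\<ge>a. F t = (\<Inter>u\<in>{t<..}. F u)) \<and>
     (\<forall>A. A \<subseteq> space M \<longrightarrow> (\<exists>N\<in>null_sets M. A \<subseteq> N) \<longrightarrow> A \<in> F a)"

definition adapted_on :: "'a measure \<Rightarrow> real set \<Rightarrow> (real \<Rightarrow> 'a set set) \<Rightarrow> (real \<Rightarrow> 'a \<Rightarrow> real) \<Rightarrow> bool" where
  "adapted_on M I F X \<longleftrightarrow>
     (\<forall>t\<in>I. \<forall>B\<in>sets borel. {\<omega>\<in>space M. X t \<omega> \<in> B} \<in> F t)"

definition natural_filtration :: "'a measure \<Rightarrow> real \<Rightarrow> (real \<Rightarrow> 'a \<Rightarrow> real) \<Rightarrow> real \<Rightarrow> 'a set set" where
  "natural_filtration M a L t =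
     sigma_sets (space M) (\<Union>u\<in>{a..t}. {{\<omega>\<in>space M. L u \<omega> \<in> B} | B. B \<in> sets borel})"

definition levy_measure :: "'a measure \<Rightarrow> real \<Rightarrow> (real \<Rightarrow> 'a \<Rightarrow> real) \<Rightarrow> real measure" where
  "levy_measure M a L = measure_of UNIV (sets borel)
     (\<lambda>B. \<integral>\<^sup>+\<omega>. (\<integral>\<^sup>+s. indicator (B - {0}) (jump (\<lambda>v. L v \<omega>) s) \<partial>count_space {a<..a+1}) \<partial>M)"

text \<open>No Brownian component: the Levy--Khintchine triplet of L_{a+1} (unit time increment)
 has Gaussian coefficient 0.\<close>
definition no_brownian_component :: "'a measure \<Rightarrow> real \<Rightarrow> (real \<Rightarrow> 'a \<Rightarrow> real) \<Rightarrow> bool" where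
  "no_brownian_component M a L \<longleftrightarrow>
     (\<exists>\<gamma>::real. \<forall>\<theta>::real. char (distr M borel (L (a + 1))) \<theta> =
        exp (\<i> * complex_of_real (\<gamma> * \<theta>) +
             (\<integral>z. (exp (\<i> * complex_of_real (\<theta> * z)) - 1
                     - \<i> * complex_of_real (\<theta> * z * indicator {-1..1} z)) \<partial>levy_measure M a L)))"

definition levy_process :: "'a measure \<Rightarrow> real \<Rightarrow> (real \<Rightarrow> 'a set set) \<Rightarrow> (real \<Rightarrow> 'a \<Rightarrow> real) \<Rightarrow> bool" where
  "levy_process M a F L \<longleftrightarrow>
     (\<forall>\<omega>\<in>space M. L a \<omega> = 0) \<and>
     (\<forall>\<omega>\<in>space M. cadlag_from a (\<lambda>t. L t \<omega>)) \<and>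
     adapted_on M {a..} F L \<and>
     (\<forall>s t. a \<le> s \<longrightarrow> s \<le> t \<longrightarrow> (\<forall>A\<in>F s. \<forall>B\<in>sets borel.
         measure M (A \<inter> {\<omega>\<in>space M. L t \<omega> - L s \<omega> \<in> B})
           = measure M A * measure M {\<omega>\<in>space M. L t \<omega> - L s \<omega> \<in> B})) \<and>
     (\<forall>s t. a \<le> s \<longrightarrow> s \<le> t \<longrightarrow>
         distr M borel (\<lambda>\<omega>. L t \<omega> - L s \<omega>) = distr M borel (L (a + (t - s)))) \<and>
     (\<forall>t\<ge>a. integrable M (\<lambda>\<omega>. (L t \<omega>)^2) \<and> integrable M (L t) \<and> (\<integral>\<omega>. L t \<omega> \<partial>M) = 0) \<and>
     no_brownian_component M a L"

definition ext_init :: "(real \<Rightarrow> 'a \<Rightarrow> real) \<Rightarrow> real \<Rightarrow> 'a \<Rightarrow> real" where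
  "ext_init \<Phi> t \<omega> = (if t > 0 then \<Phi> 0 \<omega> else \<Phi> t \<omega>)"

definition theta :: "real \<Rightarrow> (real \<Rightarrow> 'a \<Rightarrow> real) \<Rightarrow> real \<Rightarrow> 'a \<Rightarrow> real" where
  "theta \<eta> \<Phi> t \<omega> = ext_init \<Phi> t \<omega> + \<eta> * t * indicator {0..} t"

text \<open>Right-hand side of the variance equation at time t \<ge> 0, path \<omega>, with
 \<mu>(du) = f_\<mu>(u) 1_{[-p,0]}(u) du - c_\<mu> \<delta>_0(du), \<nu>(du) = f_\<nu>(u) 1_{[-q,0]}(u) du + c_\<nu> \<delta>_0(du).\<close>
definition cdgarch_rhs ::
  "real \<Rightarrow> real \<Rightarrow> real \<Rightarrow> real \<Rightarrow> real \<Rightarrow> (real \<Rightarrow> real) \<Rightarrow> (real \<Rightarrow> real)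
   \<Rightarrow> (real \<Rightarrow> 'a \<Rightarrow> real) \<Rightarrow> (real \<Rightarrow> 'a \<Rightarrow> real) \<Rightarrow> (real \<Rightarrow> 'a \<Rightarrow> real) \<Rightarrow> real \<Rightarrow> 'a \<Rightarrow> real" where
  "cdgarch_rhs p q \<eta> c\<mu> c\<nu> f\<mu> f\<nu> L \<Phi> X t \<omega> =
     theta \<eta> \<Phi> t \<omega>
     + (integral {-p..0} (\<lambda>u. integral {u..t+u} (\<lambda>s. X s \<omega>) * f\<mu> u)
        - c\<mu> * integral {0..t} (\<lambda>s. X s \<omega>))
     + (integral {-q..0} (\<lambda>u. dS_integral (\<lambda>s. X s \<omega>) (\<lambda>s. L s \<omega>) u (t+u) * f\<nu> u)
        + c\<nu> * dS_integral (\<lambda>s. X s \<omega>) (\<lambda>s. L s \<omega>) 0 t)"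

definition cdgarch_strong_solution ::
  "'a measure \<Rightarrow> (real \<Rightarrow> 'a set set) \<Rightarrow> real \<Rightarrow> real \<Rightarrow> real \<Rightarrow> real \<Rightarrow> real
   \<Rightarrow> (real \<Rightarrow> real) \<Rightarrow> (real \<Rightarrow> real) \<Rightarrow> (real \<Rightarrow> 'a \<Rightarrow> real) \<Rightarrow> (real \<Rightarrow> 'a \<Rightarrow> real)
   \<Rightarrow> (real \<Rightarrow> 'a \<Rightarrow> real) \<Rightarrow> bool" where
  "cdgarch_strong_solution M F p q \<eta> c\<mu> c\<nu> f\<mu> f\<nu> L \<Phi> X \<longleftrightarrow>
     adapted_on M {- max p q..} F X \<and>
     (\<forall>\<omega>\<in>space M. cadlag_from (- max p q) (\<lambda>t. X t \<omega>)) \<and>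
     (\<forall>t\<ge>0. (\<integral>\<^sup>+\<omega>. (SUP s\<in>{- max p q..t}. ennreal ((X s \<omega>)^2)) \<partial>M) < \<infinity>) \<and>
     (AE \<omega> in M. \<forall>u\<in>{- max p q..0}. X u \<omega> = \<Phi> u \<omega>) \<and>
     (\<forall>t\<ge>0. AE \<omega> in M. X t \<omega> = cdgarch_rhs p q \<eta> c\<mu> c\<nu> f\<mu> f\<nu> L \<Phi> X t \<omega>)"

definition zeta :: "real \<Rightarrow> (real \<Rightarrow> real) \<Rightarrow> real \<Rightarrow> real \<Rightarrow> real" where
  "zeta c0 f r t = - c0 * indicator {0<..} t + integral {0..min t r} (\<lambda>u. f (- u))"

definition renewal_h :: "real \<Rightarrow> real \<Rightarrow> (real \<Rightarrow> real) \<Rightarrow> real \<Rightarrow> (real \<Rightarrow> real) \<Rightarrow> real \<Rightarrow> real" where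
  "renewal_h \<eta> c0 f r m t =
     m 0 + \<eta> / zeta c0 f r r * integral {0..t} (zeta c0 f r)
     + integral {0..r} (\<lambda>u. (zeta c0 f r (t + u) - zeta c0 f r u) * (m (- u) + \<eta> / zeta c0 f r r))"

end

theory Submission
  imports Defs
begin

text \<open>Only the jumps of \<open>L\<close> enter the variance equation, so neither the Levy--Khintchine formula nor
  stochastic integration is needed. For continuous \<open>g \<ge> 0\<close> vanishing near \<open>0\<close>, the sum of \<open>g\<close> over the
  increments of \<open>L\<close> on a grid of \<open>(c, d]\<close> converges pathwise to the sum of \<open>g (\<Delta>L\<^sub>s)\<close>. Its Laplace transform
  restricted to an event of \<open>F c\<close> factorises, hence so does that of the limit; letting \<open>g\<close> increase to
  \<open>z\<^sup>2\<close> shows that the squared jumps in \<open>(c, d]\<close> have mean \<open>\<kappa>\<^sub>2 (d - c)\<close> conditionally on the past. Riemann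
  sums then give the compensation formula
  \<open>E \<Sum>\<^bsub>c<s\<le>d\<^esub> X\<^bsub>s-\<^esub> (\<Delta>L\<^sub>s)\<^sup>2 = \<kappa>\<^sub>2 \<integral>\<^bsub>(c, d]\<^esub> E X\<^sub>s ds\<close>
  for nonnegative adapted cadlag \<open>X\<close>. Taking expectations
  in the variance equation turns it into
  \<open>m t = m 0 + \<eta> t - c\<^sub>0 \<integral>\<^sub>0\<^sup>t m + \<integral>\<^sub>0\<^sup>t H\<close> with \<open>H t = \<integral> m (t + u) f u du\<close>. Since \<open>f\<close> has
  at most three discontinuities, \<open>H\<close> is continuous and the differential equation follows, while Fubini
  on \<open>\<integral>\<^sub>0\<^sup>t H\<close> gives the renewal equation.\<close>

section \<open>Cadlag paths and grids\<close>

text \<open>The test functions \<open>g\<close> vanish near \<open>0\<close> because grid sums would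
  otherwise also pick up the small oscillations of the path; with \<open>g\<close> zero near
  \<open>0\<close>, only finitely many moves of a cadlag path count and the limit is a finite sum.
  Laplace transforms are used because the grid sums come with no evident integrable majorant,
  whereas \<open>exp (- S)\<close> is at most \<open>1\<close>. That the squared jumps have finite
  mean comes from orthogonality of centered increments and Fatou. The Riemann sums take left
  endpoints for two reasons: the value there belongs to the past of the cell, so the mean
  factorises, and the endpoints approach from strictly below, which produces left limits. The sign
  of \<open>X\<close> is free, so \<open>X\<close> and \<open>- X\<close> are compensated
  separately. The delay terms integrate over uncountably many windows. All inner integrals are
  therefore written as increments of one right-continuous process, off a single null set, before
  Fubini is applied. At first \<open>m\<close> is only known to be measurable and locally bounded,
  so regularity has to come from translating the kernel \<open>f\<close>.\<close>

lemma cadlag_right_tendsto: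
  assumes "cadlag_from a x" "a \<le> t" shows "(x \<longlongrightarrow> x t) (at_right t)"
  using assms by (auto simp: cadlag_from_def)

lemma left_lim_eqI:
  "(x \<longlongrightarrow> l) (at_left s) \<Longrightarrow> left_lim x s = l" for s :: real
  unfolding left_lim_def by (rule tendsto_Lim) auto

lemma cadlag_left_tendsto:
  assumes "cadlag_from a x" "a < s" shows "(x \<longlongrightarrow> left_lim x s) (at_left s)"
  using assms left_lim_eqI unfolding cadlag_from_def by metis

lemma cadlag_mono: "cadlag_from a x \<Longrightarrow> a \<le> b \<Longrightarrow> cadlag_from b x"
  by (auto simp: cadlag_from_def)

text \<open>Bisection (\<open>Bolzano\<close>) reduces the claim to a neighbourhood of each point,
  where the two one-sided limits control the path and one exceptional point suffices. The condition
  concerns \<open>{s<..t}\<close> and not \<open>{s..t}\<close>: by right continuity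
  \<open>s\<close> may itself be a breakpoint, while a breakpoint at \<open>t\<close> may carry a
  jump.\<close>

lemma cadlag_fragmentation:
  fixes a b e :: real
  assumes x: "cadlag_from a x" and e: "0 < e"
  shows "\<exists>D. finite D \<and> (\<forall>s t. a \<le> s \<longrightarrow> s \<le> t \<longrightarrow> t \<le> b \<longrightarrow> {s<..t} \<inter> D = {} \<longrightarrow> \<bar>x t - x s\<bar> < e)"
proof (cases "a \<le> b")
  case False then show ?thesis by (intro exI[of _ "{}"]) auto
next
  case True
  define P where "P u v \<longleftrightarrow> (\<exists>D. finite D \<and> (\<forall>s t. a \<le> s \<longrightarrow> u \<le> s \<longrightarrow> s \<le> t \<longrightarrow> t \<le> v \<longrightarrow> {s<..t} \<inter> D = {} \<longrightarrow> \<bar>x t - x s\<bar> < e))" for u v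
  have "P a b" using True
  proof (induct rule: Bolzano)
    case (trans u v w)
    from trans(1) obtain D1 where D1: "finite D1" "\<And>s t. a \<le> s \<Longrightarrow> u \<le> s \<Longrightarrow> s \<le> t \<Longrightarrow> t \<le> v \<Longrightarrow> {s<..t} \<inter> D1 = {} \<Longrightarrow> \<bar>x t - x s\<bar> < e"
      unfolding P_def by blast
    from trans(2) obtain D2 where D2: "finite D2" "\<And>s t. a \<le> s \<Longrightarrow> v \<le> s \<Longrightarrow> s \<le> t \<Longrightarrow> t \<le> w \<Longrightarrow> {s<..t} \<inter> D2 = {} \<Longrightarrow> \<bar>x t - x s\<bar> < e"
      unfolding P_def by blast
    \<comment> \<open>Adding the gluing point \<open>v\<close> to the finite set forces
      \<open>s\<close> and \<open>t\<close> onto the same side of it.\<close>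
    show ?case unfolding P_def
    proof (intro exI[of _ "insert v (D1 \<union> D2)"] conjI allI impI)
      fix s t assume st: "a \<le> s" "u \<le> s" "s \<le> t" "t \<le> w" "{s<..t} \<inter> insert v (D1 \<union> D2) = {}"
      then have "v \<notin> {s<..t}" by auto
      then have "v \<le> s \<or> t < v" by auto
      then show "\<bar>x t - x s\<bar> < e" using st D1(2)[of s t] D2(2)[of s t] by (auto simp: Int_Un_distrib)
    qed (use D1 D2 in auto)
  next
    case (local c)
    have "\<forall>\<^sub>F y in at_right c. dist (x y) (x c) < e/2"
      by (rule tendstoD[OF cadlag_right_tendsto[OF x local(1)]]) (use e in simp)
    then obtain d1 where d1: "d1 > c" "\<And>y. c < y \<Longrightarrow> y < d1 \<Longrightarrow> \<bar>x y - x c\<bar> < e/2"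
      unfolding eventually_at_right_field dist_real_def by blast
    have "\<exists>d2 l. d2 < c \<and> (\<forall>y. a \<le> y \<longrightarrow> d2 < y \<longrightarrow> y < c \<longrightarrow> \<bar>x y - l\<bar> < e/2)"
    proof (cases "a < c")
      case True
      have "\<forall>\<^sub>F y in at_left c. dist (x y) (left_lim x c) < e/2"
        by (rule tendstoD[OF cadlag_left_tendsto[OF x True]]) (use e in simp)
      then show ?thesis unfolding eventually_at_left_field dist_real_def by blast
    next
      case False then show ?thesis by (intro exI[of _ "c-1"]) auto
    qed
    then obtain d2 l where d2: "d2 < c" "\<And>y. a \<le> y \<Longrightarrow> d2 < y \<Longrightarrow> y < c \<Longrightarrow> \<bar>x y - l\<bar> < e/2" by blast
    show ?case
    proof (intro exI[of _ "min (d1 - c) (c - d2)"] conjI allI impI)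
      show "0 < min (d1 - c) (c - d2)" using d1 d2 by auto
      fix u v assume uv: "u \<le> c \<and> c \<le> v \<and> v - u < min (d1 - c) (c - d2)"
      show "P u v" unfolding P_def
      \<comment> \<open>From \<open>c\<close> onwards the values are within \<open>e/2\<close> of
        \<open>x c\<close>, strictly before \<open>c\<close> within \<open>e/2\<close> of
        \<open>l\<close>; only pairs straddling \<open>c\<close> have to be excluded.\<close>
      proof (intro exI[of _ "{c}"] conjI allI impI)
        fix s t assume st: "a \<le> s" "u \<le> s" "s \<le> t" "t \<le> v" "{s<..t} \<inter> {c} = {}"
        then have "c \<le> s \<or> t < c" by auto
        then show "\<bar>x t - x s\<bar> < e"
        proof
          assume "c \<le> s"
          then have "\<bar>x t - x c\<bar> < e/2" "\<bar>x s - x c\<bar> < e/2"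
            using d1(2)[of t] d1(2)[of s] uv st e by (cases "t = c"; cases "s = c"; auto)+
          then show ?thesis by linarith
        next
          assume "t < c"
          then have "\<bar>x t - l\<bar> < e/2" "\<bar>x s - l\<bar> < e/2"
            using d2(2)[of t] d2(2)[of s] uv st e by auto
          then show ?thesis by linarith
        qed
      qed simp
    qed
  qed
  then show ?thesis unfolding P_def by metis
qed

text \<open>For \<open>y\<close> close below \<open>s\<close> the interval \<open>{y<..s}\<close>
  misses the finite set \<open>D\<close>, so the increment stays below \<open>e\<close>; passing to
  the left limit weakens the strict bound to \<open>\<le>\<close>.\<close>

lemma jump_le_if_fragmentation:
  assumes x: "cadlag_from a x" and D: "\<And>s t. a \<le> s \<Longrightarrow> s \<le> t \<Longrightarrow> t \<le> b \<Longrightarrow> {s<..t} \<inter> D = {} \<Longrightarrow> \<bar>x t - x s\<bar> < e"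
    and fin: "finite D" and s: "a < s" "s \<le> b" "s \<notin> D"
  shows "\<bar>jump x s\<bar> \<le> e"
proof -
  have "((\<lambda>y. \<bar>x s - x y\<bar>) \<longlongrightarrow> \<bar>x s - left_lim x s\<bar>) (at_left s)"
    by (intro tendsto_intros cadlag_left_tendsto[OF x s(1)])
  moreover have "\<forall>\<^sub>F y in at_left s. \<bar>x s - x y\<bar> \<le> e"
  proof -
    have "open (- (D - {s}))" using fin by (intro open_Compl finite_imp_closed) auto
    then obtain d where d: "0 < d" "ball s d \<subseteq> - (D - {s})"
      using open_contains_ball[of "- (D - {s})"] by auto
    have "\<bar>x s - x y\<bar> \<le> e" if "max a (s - d) < y" "y < s" for y
    proof -
      have "{y<..s} \<inter> D = {}"
      proof (rule ccontr)
        assume "{y<..s} \<inter> D \<noteq> {}"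
        then obtain z where "z \<in> D" "y < z" "z \<le> s" by auto
        moreover from this s have "z \<noteq> s" by auto
        moreover from calculation that have "z \<in> ball s d" by (auto simp: dist_real_def)
        ultimately show False using d(2) by auto
      qed
      then show ?thesis using D[of y s] that s by auto
    qed
    then show ?thesis unfolding eventually_at_left_field
      using s d by (intro exI[of _ "max a (s-d)"]) auto
  qed
  ultimately show ?thesis unfolding jump_def
    by (intro tendsto_upperbound) auto
qed

text \<open>A jump larger than \<open>1 / Suc n\<close> up to time \<open>n\<close> lies in a finite
  breakpoint set. Needed to see that left limit and value agree at Lebesgue almost every
  time.\<close>

lemma cadlag_countable_jumps:
  assumes x: "cadlag_from a x" shows "countable {s. a < s \<and> jump x s \<noteq> 0}"
proof -
  have "\<exists>D. finite D \<and> (\<forall>s t. a \<le> s \<longrightarrow> s \<le> t \<longrightarrow> t \<le> real n \<longrightarrow> {s<..t} \<inter> D = {} \<longrightarrow> \<bar>x t - x s\<bar> < 1 / Suc n)" for n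
    by (rule cadlag_fragmentation[OF x]) auto
  then obtain D where D: "\<And>n. finite (D n)" "\<And>n s t. a \<le> s \<Longrightarrow> s \<le> t \<Longrightarrow> t \<le> real n \<Longrightarrow> {s<..t} \<inter> D n = {} \<Longrightarrow> \<bar>x t - x s\<bar> < 1 / Suc n"
    by metis
  have "{s. a < s \<and> jump x s \<noteq> 0} \<subseteq> (\<Union>n. D n)"
  proof (intro subsetI, rule ccontr)
    fix s assume s: "s \<in> {s. a < s \<and> jump x s \<noteq> 0}" "s \<notin> (\<Union>n. D n)"
    obtain n1 where n1: "s \<le> real n1" using real_arch_simple by blast
    obtain n2 where n2: "1 / Suc n2 < \<bar>jump x s\<bar>" using s(1) nat_approx_posE[of "\<bar>jump x s\<bar>"] by auto
    define n where "n = max n1 n2"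
    have "\<bar>jump x s\<bar> \<le> 1 / Suc n"
      using s n1 by (intro jump_le_if_fragmentation[OF x D(2) D(1)]) (auto simp: n_def)
    also have "\<dots> \<le> 1 / Suc n2" by (simp add: n_def frac_le)
    finally show False using n2 by simp
  qed
  then show ?thesis by (rule countable_subset) (use D(1) in \<open>auto intro: countable_finite\<close>)
qed

text \<open>Each \<open>s\<close> is compared with the last breakpoint not after it,
  \<open>a\<close> counting as one; in between the path moves by less than \<open>1\<close>.\<close>

lemma cadlag_bounded:
  assumes x: "cadlag_from a x" shows "\<exists>K. \<forall>s\<in>{a..b}. \<bar>x s\<bar> \<le> K"
proof -
  obtain D where D: "finite D" "\<And>s t. a \<le> s \<Longrightarrow> s \<le> t \<Longrightarrow> t \<le> b \<Longrightarrow> {s<..t} \<inter> D = {} \<Longrightarrow> \<bar>x t - x s\<bar> < 1"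
    using cadlag_fragmentation[OF x, of 1 b] by (auto)
  have "\<bar>x s\<bar> \<le> 1 + (\<Sum>d\<in>insert a D. \<bar>x d\<bar>)" if s: "s \<in> {a..b}" for s
  proof -
    define E where "E = insert a D \<inter> {a..s}"
    have E: "finite E" "a \<in> E" using D(1) s by (auto simp: E_def)
    obtain y where y: "y \<in> E" "\<And>z. z \<in> E \<Longrightarrow> z \<le> y" using E Max_in[of E] Max_ge[of E] by blast
    have "{y<..s} \<inter> D = {}"
    proof (rule ccontr)
      assume "{y<..s} \<inter> D \<noteq> {}"
      then obtain z where z: "z \<in> D" "y < z" "z \<le> s" by auto
      then have "z \<in> E" using y(1) by (auto simp: E_def)
      then show False using y(2)[of z] z by simp
    qed
    then have "\<bar>x s - x y\<bar> < 1" using s y(1) by (intro D(2)) (auto simp: E_def)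
    moreover have "\<bar>x y\<bar> \<le> (\<Sum>d\<in>insert a D. \<bar>x d\<bar>)"
      using y(1) D(1) by (intro member_le_sum) (auto simp: E_def)
    ultimately show ?thesis by linarith
  qed
  then show ?thesis by blast
qed

text \<open>The index \<open>k\<close> of the cell \<open>{a + h * k<..a + h * (k + 1)}\<close> containing \<open>s > a\<close>.\<close>
definition cell :: "real \<Rightarrow> real \<Rightarrow> real \<Rightarrow> nat" where
  "cell a h s = nat (\<lceil>(s - a) / h\<rceil> - 1)"

lemma cell_bounds:
  assumes "0 < h" "a < s"
  shows "a + h * real (cell a h s) < s" "s \<le> a + h * (real (cell a h s) + 1)"
proof -
  define c where "c = \<lceil>(s - a) / h\<rceil>"
  have "0 < (s - a) / h" using assms by simp
  then have "1 \<le> c" unfolding c_def by linarith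
  then have k: "real (cell a h s) = of_int c - 1" by (simp add: cell_def c_def)
  have "(s - a) / h \<le> of_int c" "of_int c - 1 < (s - a) / h" unfolding c_def by linarith+
  then have "s - a \<le> h * of_int c" "h * (of_int c - 1) < s - a"
    using assms by (auto simp: field_simps)
  then show "a + h * real (cell a h s) < s" "s \<le> a + h * (real (cell a h s) + 1)"
    unfolding k by auto
qed

lemma cell_unique:
  assumes "0 < h" "a + h * real k < s" "s \<le> a + h * (real k + 1)"
  shows "cell a h s = k"
proof -
  have "real k < (s - a) / h" "(s - a) / h \<le> real k + 1" using assms by (auto simp: field_simps)
  then have "\<lceil>(s - a) / h\<rceil> = int k + 1" by (intro ceiling_unique) auto
  then show ?thesis by (simp add: cell_def)
qed

lemma cell_iff:
  assumes "0 < h" "a < s"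
  shows "a + h * real k < s \<and> s \<le> a + h * (real k + 1) \<longleftrightarrow> cell a h s = k"
  using cell_bounds[OF assms] cell_unique[OF assms(1), of a k s] by blast

lemma cell_less:
  assumes "0 < h" "a < s" "s \<le> a + h * real n" shows "cell a h s < n"
proof -
  have "h * real (cell a h s) < h * real n" using cell_bounds(1)[OF assms(1,2)] assms(3) by linarith
  then show ?thesis using assms(1) by simp
qed

text \<open>Cells are open on the left, so the left endpoint of the cell of \<open>s\<close> lies
  strictly below \<open>s\<close>, at distance at most \<open>h n\<close>. Hence values at left
  endpoints converge to left limits, even when \<open>s\<close> is a jump time.\<close>

lemma filterlim_cell_left:
  assumes h: "\<And>n. 0 < h n" "h \<longlonglongrightarrow> 0" and s: "a < s"
  shows "filterlim (\<lambda>n. a + h n * real (cell a (h n) s)) (at_left s) sequentially"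
proof -
  have "(\<lambda>n. a + h n * real (cell a (h n) s)) \<longlonglongrightarrow> s"
  proof (rule tendsto_sandwich)
    show "\<forall>\<^sub>F n in sequentially. s - h n \<le> a + h n * real (cell a (h n) s)"
    proof (intro always_eventually allI)
      fix n show "s - h n \<le> a + h n * real (cell a (h n) s)"
        using cell_bounds(2)[OF h(1)[of n] s] by (simp add: algebra_simps)
    qed
    show "\<forall>\<^sub>F n in sequentially. a + h n * real (cell a (h n) s) \<le> s"
      by (intro always_eventually allI less_imp_le cell_bounds h s)
    show "(\<lambda>n. s - h n) \<longlonglongrightarrow> s" using tendsto_diff[OF tendsto_const[of s] h(2)] by simp
  qed simp
  then show ?thesis unfolding filterlim_at
    using cell_bounds[OF h(1) s] by (auto intro!: always_eventually simp: less_imp_neq)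
qed

lemma cadlag_cell_left_tendsto:
  assumes x: "cadlag_from a x" and h: "\<And>n. 0 < h n" "h \<longlonglongrightarrow> 0" and b: "a \<le> b" and s: "b < s"
  shows "(\<lambda>n. x (b + h n * real (cell b (h n) s))) \<longlonglongrightarrow> left_lim x s"
  using filterlim_compose[OF cadlag_left_tendsto[OF x] filterlim_cell_left[OF h s]] b s by simp

text \<open>The sequence may hit \<open>s\<close> itself, as happens when \<open>s\<close> is a grid
  point; hence continuity within \<open>{s..}\<close> replaces the punctured limit.\<close>

lemma right_continuous_seq:
  fixes x :: "real \<Rightarrow> 'b::topological_space"
  assumes x: "(x \<longlongrightarrow> x s) (at_right s)" and u: "u \<longlonglongrightarrow> s" "\<And>n. s \<le> u n"
  shows "(\<lambda>n. x (u n)) \<longlonglongrightarrow> x s"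
proof -
  have "continuous (at s within {s..}) x"
    using x by (simp add: continuous_within at_within_Ici_at_right)
  then show ?thesis using u
    by (auto simp: continuous_within_sequentially comp_def)
qed


section \<open>Sums over the jumps of a path as limits of grid sums\<close>

text \<open>An extended nonnegative integral over counting measure rather than an infinite sum: it
  makes sense for every \<open>g\<close> and every path, and monotone convergence needs no
  summability. The interval is half-open so that adjacent intervals add up.\<close>

definition jump_sum :: "(real \<Rightarrow> ennreal) \<Rightarrow> (real \<Rightarrow> real) \<Rightarrow> real \<Rightarrow> real \<Rightarrow> ennreal" where
  "jump_sum g x c d = (\<integral>\<^sup>+s. g (jump x s) * indicator {c<..d} s \<partial>count_space UNIV)"

lemma mesh_tendsto_0: "(\<lambda>n. w / real (Suc n)) \<longlonglongrightarrow> 0" for w :: real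
  using tendsto_mult[OF tendsto_const[of w] LIMSEQ_inverse_real_of_nat] by (simp add: divide_inverse)

text \<open>Moves of size at least \<open>e\<close> need one of the finitely many breakpoints in
  \<open>D\<close>. On a fine grid these occupy separate cells, whose increments tend to the jumps,
  and all other cells contribute \<open>0\<close>.\<close>

lemma grid_sum_tendsto_jump_sum:
  fixes x g :: "real \<Rightarrow> real" and c d :: real
  defines "h \<equiv> \<lambda>n. (d - c) / real (Suc n)"
  assumes x: "cadlag_from c x" and cd: "c < d"
    and g: "continuous_on UNIV g" "\<And>z. 0 \<le> g z" "0 < e" "\<And>z. \<bar>z\<bar> \<le> e \<Longrightarrow> g z = 0"
  obtains C where "0 \<le> C"
    "(\<lambda>n. \<Sum>k<Suc n. g (x (c + h n * (real k + 1)) - x (c + h n * real k))) \<longlonglongrightarrow> C"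
    "jump_sum (\<lambda>z. ennreal (g z)) x c d = ennreal C"
proof -
  have h: "0 < h n" "h \<longlonglongrightarrow> 0" for n using cd mesh_tendsto_0 by (auto simp: h_def)
  obtain D0 where D0: "finite D0" "\<And>s t. c \<le> s \<Longrightarrow> s \<le> t \<Longrightarrow> t \<le> d \<Longrightarrow> {s<..t} \<inter> D0 = {} \<Longrightarrow> \<bar>x t - x s\<bar> < e"
    using cadlag_fragmentation[OF x g(3), of d] by auto
  define D where "D = D0 \<inter> {c<..d}"
  have D: "finite D" "D \<subseteq> {c<..d}"
    "\<And>s t. c \<le> s \<Longrightarrow> s \<le> t \<Longrightarrow> t \<le> d \<Longrightarrow> {s<..t} \<inter> D = {} \<Longrightarrow> \<bar>x t - x s\<bar> < e"
    using D0(1) by (auto simp: D_def intro!: D0(2))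
  have gcont: "isCont g z" for z using g(1) by (simp add: continuous_on_eq_continuous_at)
  let ?t = "\<lambda>n k. c + h n * real k"
  let ?i = "\<lambda>n k. x (c + h n * (real k + 1)) - x (c + h n * real k)"
  let ?C = "\<Sum>s\<in>D. g (jump x s)"
  \<comment> \<open>On the cell of \<open>s\<close> the right endpoint tends to \<open>s\<close>
    from the right and the left endpoint from strictly below, so the increment tends to the jump at
    \<open>s\<close>.\<close>
  have 1: "(\<lambda>n. \<Sum>s\<in>D. g (?i n (cell c (h n) s))) \<longlonglongrightarrow> ?C"
  proof (intro tendsto_sum isCont_tendsto_compose[OF gcont])
    fix s assume s: "s \<in> D"
    then have cs: "c < s" using D by auto
    have "(\<lambda>n. c + h n * (real (cell c (h n) s) + 1)) \<longlonglongrightarrow> s"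
    proof (rule tendsto_sandwich)
      show "\<forall>\<^sub>F n in sequentially. s \<le> c + h n * (real (cell c (h n) s) + 1)"
        by (intro always_eventually allI cell_bounds h cs)
      show "\<forall>\<^sub>F n in sequentially. c + h n * (real (cell c (h n) s) + 1) \<le> s + h n"
      proof (intro always_eventually allI)
        fix n show "c + h n * (real (cell c (h n) s) + 1) \<le> s + h n"
          using cell_bounds(1)[OF h(1)[of n] cs] by (simp add: algebra_simps)
      qed
      show "(\<lambda>n. s + h n) \<longlonglongrightarrow> s" using tendsto_add[OF tendsto_const[of s] h(2)] by simp
    qed simp
    from right_continuous_seq[OF cadlag_right_tendsto[OF x] this cell_bounds(2)[OF h(1) cs]] cs
    have "(\<lambda>n. x (c + h n * (real (cell c (h n) s) + 1))) \<longlonglongrightarrow> x s" by simp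
    moreover have "(\<lambda>n. x (c + h n * real (cell c (h n) s))) \<longlonglongrightarrow> left_lim x s"
      using cadlag_cell_left_tendsto[OF x h _ cs] by simp
    ultimately show "(\<lambda>n. ?i n (cell c (h n) s)) \<longlonglongrightarrow> jump x s"
      unfolding jump_def by (rule tendsto_diff)
  qed
  \<comment> \<open>Once the mesh is below the smallest gap in \<open>D\<close>, distinct points of
    \<open>D\<close> lie in distinct cells.\<close>
  have "\<forall>\<^sub>F n in sequentially. \<forall>s\<in>D. \<forall>s'\<in>D. s \<noteq> s' \<longrightarrow> h n < \<bar>s - s'\<bar>"
  proof (intro eventually_ball_finite D ballI)
    fix s s'
    show "\<forall>\<^sub>F n in sequentially. s \<noteq> s' \<longrightarrow> h n < \<bar>s - s'\<bar>"
      using order_tendstoD(2)[OF h(2), of "\<bar>s - s'\<bar>"] by (cases "s = s'") auto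
  qed
  then have "\<forall>\<^sub>F n in sequentially. (\<Sum>s\<in>D. g (?i n (cell c (h n) s))) = (\<Sum>k<Suc n. g (?i n k))"
  proof eventually_elim
    fix n assume sep: "\<forall>s\<in>D. \<forall>s'\<in>D. s \<noteq> s' \<longrightarrow> h n < \<bar>s - s'\<bar>"
    have inj: "inj_on (cell c (h n)) D"
    proof (rule inj_onI, rule ccontr)
      fix s s' assume s: "s \<in> D" "s' \<in> D" "cell c (h n) s = cell c (h n) s'" "s \<noteq> s'"
      then have "c < s" "c < s'" using D by auto
      from cell_bounds[OF h(1)[of n] this(1)] cell_bounds[OF h(1)[of n] this(2)]
      have "\<bar>s - s'\<bar> \<le> h n" unfolding s(3) by (simp add: algebra_simps)
      then show False using sep s by force
    qed
    have hn: "h n * (1 + real n) = d - c" by (simp add: h_def)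
    have "cell c (h n) ` D \<subseteq> {..<Suc n}"
      using D(2) cell_less[OF h(1)[of n], of c _ "Suc n"] hn by auto
    \<comment> \<open>A cell without points of \<open>D\<close> carries an increment smaller than
      \<open>e\<close>, which \<open>g\<close> ignores.\<close>
    moreover have "g (?i n k) = 0" if k: "k \<in> {..<Suc n} - cell c (h n) ` D" for k
    proof -
      have "{?t n k<..c + h n * (real k + 1)} \<inter> D = {}"
        using k cell_unique[OF h(1)[of n], of c k] by (auto simp: image_iff)
      moreover have "c + h n * (real k + 1) \<le> c + h n * (real n + 1)"
        using k h(1)[of n] by (auto intro!: mult_left_mono)
      ultimately have "\<bar>?i n k\<bar> < e"
        using h(1)[of n] hn by (intro D(3)) (auto simp: algebra_simps)
      then show ?thesis using g(4) by simp
    qed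
    ultimately have "(\<Sum>k<Suc n. g (?i n k)) = (\<Sum>k\<in>cell c (h n) ` D. g (?i n k))"
      by (intro sum.mono_neutral_right) auto
    then show "(\<Sum>s\<in>D. g (?i n (cell c (h n) s))) = (\<Sum>k<Suc n. g (?i n k))"
      by (simp add: sum.reindex[OF inj])
  qed
  then have 2: "(\<lambda>n. \<Sum>k<Suc n. g (?i n k)) \<longlonglongrightarrow> ?C"
    by (rule Lim_transform_eventually[OF 1])
  have "jump_sum (\<lambda>z. ennreal (g z)) x c d = (\<Sum>s\<in>D. ennreal (g (jump x s)) * indicator {c<..d} s)"
    unfolding jump_sum_def
  proof (rule nn_integral_count_space')
    fix s assume s: "s \<notin> D"
    show "ennreal (g (jump x s)) * indicator {c<..d} s = 0"
    proof (cases "s \<in> {c<..d}")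
      case True
      then have "\<bar>jump x s\<bar> \<le> e" using s by (intro jump_le_if_fragmentation[OF x D(3) D(1)]) auto
      then show ?thesis using g(4) by simp
    qed simp
  qed (use D in auto)
  also have "\<dots> = (\<Sum>s\<in>D. ennreal (g (jump x s)))"
    using D by (intro sum.cong) (auto simp: indicator_def)
  also have "\<dots> = ennreal ?C" by (rule sum_ennreal) (use g in auto)
  finally show ?thesis using 2 by (intro that[of ?C] sum_nonneg g)
qed

lemma jump_sum_cmult: "jump_sum (\<lambda>z. k * g z) x c d = k * jump_sum g x c d"
  unfolding jump_sum_def by (subst nn_integral_cmult[symmetric]) (auto simp: mult.assoc)

lemma jump_sum_add: "jump_sum (\<lambda>z. g z + g' z) x c d = jump_sum g x c d + jump_sum g' x c d"
  unfolding jump_sum_def by (subst nn_integral_add[symmetric]) (auto simp: distrib_right)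

lemma jump_sum_SUP:
  assumes "incseq U"
  shows "jump_sum (\<lambda>z. SUP i. U i z) x c d = (SUP i. jump_sum (U i) x c d)"
  unfolding jump_sum_def
  by (subst nn_integral_monotone_convergence_SUP[symmetric])
     (use assms in \<open>auto simp: SUP_mult_right_ennreal incseq_def le_fun_def intro!: mult_right_mono\<close>)

lemma jump_sum_split:
  assumes "c \<le> d" "d \<le> e"
  shows "jump_sum g x c e = jump_sum g x c d + jump_sum g x d e"
  unfolding jump_sum_def
  by (subst nn_integral_add[symmetric])
     (use assms in \<open>auto intro!: nn_integral_cong simp: indicator_def\<close>)

lemma jump_sum_empty: "d \<le> c \<Longrightarrow> jump_sum g x c d = 0"
  unfolding jump_sum_def by (auto simp: indicator_def)

section \<open>Independence and stationarity of the jump sums\<close>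

text \<open>A monotone class extension: the hypothesis says in effect that \<open>W\<close> has the
  constant conditional mean \<open>w\<close> given \<open>N\<close>, tested on events; the
  conclusion tests it on nonnegative \<open>N\<close>-measurable functions. It serves both with
  \<open>N\<close> generated by an increment and with \<open>N\<close> the past.\<close>

lemma nn_integral_mult_subalgebra:
  assumes N: "subalgebra M N" and W[measurable]: "W \<in> borel_measurable M"
    and A: "\<And>A. A \<in> sets N \<Longrightarrow> (\<integral>\<^sup>+\<omega>. indicator A \<omega> * W \<omega> \<partial>M) = w * emeasure M A"
    and \<xi>: "\<xi> \<in> borel_measurable N"
  shows "(\<integral>\<^sup>+\<omega>. \<xi> \<omega> * W \<omega> \<partial>M) = w * (\<integral>\<^sup>+\<omega>. \<xi> \<omega> \<partial>M)"
  using \<xi>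
proof induct
  case (cong f g)
  have "space N = space M" using N by (simp add: subalgebra_def)
  then have "(\<integral>\<^sup>+\<omega>. f \<omega> * W \<omega> \<partial>M) = (\<integral>\<^sup>+\<omega>. g \<omega> * W \<omega> \<partial>M)" "(\<integral>\<^sup>+\<omega>. f \<omega> \<partial>M) = (\<integral>\<^sup>+\<omega>. g \<omega> \<partial>M)"
    using cong(3) by (auto intro!: nn_integral_cong)
  with cong show ?case by simp
next
  case (set B)
  then have "B \<in> sets M" using N by (auto simp: subalgebra_def)
  with A[OF set] show ?case by simp
next
  case (mult u c)
  note [measurable] = measurable_from_subalg[OF N mult(2)]
  show ?case using mult(4) by (simp add: mult.assoc nn_integral_cmult mult.left_commute)
next
  case (add u v)
  note [measurable] = measurable_from_subalg[OF N add(1)] measurable_from_subalg[OF N add(4)]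
  show ?case using add(3,7) by (simp add: distrib_right nn_integral_add distrib_left)
next
  case (seq U)
  note [measurable] = measurable_from_subalg[OF N seq(1)]
  have "(\<integral>\<^sup>+\<omega>. (SUP i. U i) \<omega> * W \<omega> \<partial>M) = (SUP i. \<integral>\<^sup>+\<omega>. U i \<omega> * W \<omega> \<partial>M)"
    using seq(4) by (subst nn_integral_monotone_convergence_SUP[symmetric])
      (auto simp: SUP_mult_right_ennreal image_comp incseq_def le_fun_def intro!: mult_right_mono nn_integral_cong)
  also have "\<dots> = w * (SUP i. \<integral>\<^sup>+\<omega>. U i \<omega> \<partial>M)" by (simp add: seq(3) SUP_mult_left_ennreal)
  also have "(SUP i. \<integral>\<^sup>+\<omega>. U i \<omega> \<partial>M) = (\<integral>\<^sup>+\<omega>. (SUP i. U i) \<omega> \<partial>M)"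
    using seq(4) by (subst nn_integral_monotone_convergence_SUP[symmetric])
      (auto simp: image_comp intro!: nn_integral_cong)
  finally show ?case .
qed

text \<open>Difference quotients of the exponential at \<open>0\<close> recover \<open>w\<close>
  from its Laplace transform. Powers of two are taken because halving the exponent while doubling
  the prefactor gives an increasing sequence, as monotone convergence requires.\<close>

lemma pow2_one_minus_exp_tendsto:
  fixes w :: real assumes "0 \<le> w"
  shows "(\<lambda>n. 2^n * (1 - exp (- (1/2^n) * w))) \<longlonglongrightarrow> w"
    and "incseq (\<lambda>n. 2^n * (1 - exp (- (1/2^n) * w)))"
proof -
  have lim: "(\<lambda>n. 1/2^n * w) \<longlonglongrightarrow> 0"
    using tendsto_mult_left_zero[OF LIMSEQ_realpow_zero[of "1/2::real"], of w] by (simp add: power_one_over)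
  show "(\<lambda>n. 2^n * (1 - exp (- (1/2^n) * w))) \<longlonglongrightarrow> w"
  proof (rule tendsto_sandwich)
    show "\<forall>\<^sub>F n in sequentially. w / (1 + 1/2^n * w) \<le> 2^n * (1 - exp (- (1/2^n) * w))"
    proof (intro always_eventually allI)
      fix n :: nat
      define y where "y = 1/2^n * w"
      have y: "0 \<le> y" "w = 2^n * y" using assms by (auto simp: y_def)
      have "exp (- y) \<le> 1 / (1 + y)"
        using exp_ge_add_one_self[of y] y by (simp add: exp_minus inverse_eq_divide frac_le)
      then have "y / (1 + y) \<le> 1 - exp (- y)" using y by (simp add: field_simps)
      then have "2^n * (y / (1 + y)) \<le> 2^n * (1 - exp (- y))" by (intro mult_left_mono) auto
      moreover have "w / (1 + 1/2^n * w) = 2^n * (y / (1 + y))" "- (1/2^n) * w = - y"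
        by (simp_all add: y_def)
      ultimately show "w / (1 + 1/2^n * w) \<le> 2^n * (1 - exp (- (1/2^n) * w))" by (simp only:)
    qed
    show "\<forall>\<^sub>F n in sequentially. 2^n * (1 - exp (- (1/2^n) * w)) \<le> w"
    proof (intro always_eventually allI)
      fix n :: nat
      have "1 - exp (- (1/2^n) * w) \<le> 1/2^n * w" using exp_ge_add_one_self[of "- (1/2^n) * w"] by simp
      then have "2^n * (1 - exp (- (1/2^n) * w)) \<le> 2^n * (1/2^n * w)" by (rule mult_left_mono) simp
      then show "2^n * (1 - exp (- (1/2^n) * w)) \<le> w" by simp
    qed
    show "(\<lambda>n. w / (1 + 1/2^n * w)) \<longlonglongrightarrow> w"
      using tendsto_divide[OF tendsto_const[of w] tendsto_add[OF tendsto_const[of 1] lim]] by simp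
  qed simp
  show "incseq (\<lambda>n. 2^n * (1 - exp (- (1/2^n) * w)))"
  proof (rule incseq_SucI)
    fix n :: nat
    define E where "E = exp (- (1/2^Suc n) * w)"
    \<comment> \<open>With \<open>E\<close> the exponential at the next level, monotonicity is
      \<open>1 - E * E \<le> 2 * (1 - E)\<close>, that is,
      \<open>0 \<le> (1 - E)\<^sup>2\<close>.\<close>
    have "exp (- (1/2^n) * w) = E * E" unfolding E_def exp_add[symmetric] by (simp add: field_simps)
    moreover have "2 * (1 - E) - (1 - E * E) = (1 - E)\<^sup>2" by (simp add: power2_eq_square algebra_simps)
    then have "1 - E * E \<le> 2 * (1 - E)" using zero_le_power2[of "1 - E"] by linarith
    ultimately have "2^n * (1 - exp (- (1/2^n) * w)) \<le> 2^n * (2 * (1 - E))"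
      by (intro mult_left_mono) auto
    then show "2^n * (1 - exp (- (1/2^n) * w)) \<le> 2^Suc n * (1 - exp (- (1/2^Suc n) * w))"
      by (simp add: E_def mult.assoc)
  qed
qed

section \<open>The Levy process, its past, and the law of its jump sums\<close>

locale levy_setting = prob_space M for M :: "'a measure" +
  fixes a :: real and F :: "real \<Rightarrow> 'a set set" and L :: "real \<Rightarrow> 'a \<Rightarrow> real"
  assumes filt: "filtration_usual M a F" and levy: "levy_process M a F L"
begin

text \<open>The filtration consists of set systems; wrapping \<open>F t\<close> as a measure space
  lets measurability with respect to the past be stated as \<open>borel_measurable (Fm t)\<close>.
  Only its sets matter.\<close>

definition Fm :: "real \<Rightarrow> 'a measure" where "Fm t = sigma (space M) (F t)"

lemma F_sigma_algebra: "a \<le> t \<Longrightarrow> sigma_algebra (space M) (F t)"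
  and F_subset: "a \<le> t \<Longrightarrow> F t \<subseteq> sets M"
  and F_mono: "a \<le> s \<Longrightarrow> s \<le> t \<Longrightarrow> F s \<subseteq> F t"
  using conjunct1[OF filt[unfolded filtration_usual_def]]
    conjunct1[OF conjunct2[OF filt[unfolded filtration_usual_def]]] by simp_all

lemma space_Fm[simp]: "space (Fm t) = space M"
  by (simp add: Fm_def space_measure_of_conv)

lemma sets_Fm: "a \<le> t \<Longrightarrow> sets (Fm t) = F t"
  using F_sigma_algebra[of t] by (simp add: Fm_def sigma_algebra.sets_measure_of_eq)

lemma subalgebra_Fm: "a \<le> t \<Longrightarrow> subalgebra M (Fm t)"
  using F_subset by (auto simp: subalgebra_def sets_Fm)

lemma subalgebra_Fm_mono: "a \<le> s \<Longrightarrow> s \<le> t \<Longrightarrow> subalgebra (Fm t) (Fm s)"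
  using F_mono by (auto simp: subalgebra_def sets_Fm)

lemma adapted_measurable_Fm:
  assumes "adapted_on M {a..} F X" "a \<le> t" shows "X t \<in> borel_measurable (Fm t)"
  using assms by (auto simp: measurable_def sets_Fm adapted_on_def vimage_def Int_def conj_commute)

lemma adapted_measurable:
  assumes "adapted_on M {a..} F X" "a \<le> t" shows "X t \<in> borel_measurable M"
  by (rule measurable_from_subalg[OF subalgebra_Fm adapted_measurable_Fm]) (use assms in auto)

lemma L_adapted: "adapted_on M {a..} F L"
  and L_cadlag: "\<omega> \<in> space M \<Longrightarrow> cadlag_from a (\<lambda>t. L t \<omega>)"
  and L_start: "\<omega> \<in> space M \<Longrightarrow> L a \<omega> = 0"
  and L_square: "a \<le> t \<Longrightarrow> integrable M (\<lambda>\<omega>. (L t \<omega>)\<^sup>2)"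
  and L_integrable: "a \<le> t \<Longrightarrow> integrable M (L t)"
  and L_centered: "a \<le> t \<Longrightarrow> expectation (L t) = 0"
  and L_stationary: "a \<le> s \<Longrightarrow> s \<le> t \<Longrightarrow> distr M borel (\<lambda>\<omega>. L t \<omega> - L s \<omega>) = distr M borel (L (a + (t - s)))"
  and L_indep: "a \<le> s \<Longrightarrow> s \<le> t \<Longrightarrow> A \<in> F s \<Longrightarrow> B \<in> sets borel \<Longrightarrow>
      measure M (A \<inter> {\<omega>\<in>space M. L t \<omega> - L s \<omega> \<in> B})
        = measure M A * measure M {\<omega>\<in>space M. L t \<omega> - L s \<omega> \<in> B}"
  using levy by (auto simp: levy_process_def)

lemmas L_measurable_Fm = adapted_measurable_Fm[OF L_adapted]

lemma L_measurable[measurable (raw)]: "a \<le> t \<Longrightarrow> L t \<in> borel_measurable M"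
  by (rule adapted_measurable[OF L_adapted])

lemma nn_integral_increment:
  fixes \<psi> :: "real \<Rightarrow> ennreal"
  assumes st: "a \<le> s" "s \<le> t" and [measurable]: "\<psi> \<in> borel_measurable borel"
  shows "(\<integral>\<^sup>+\<omega>. \<psi> (L t \<omega> - L s \<omega>) \<partial>M) = (\<integral>\<^sup>+\<omega>. \<psi> (L (a + (t - s)) \<omega>) \<partial>M)"
proof -
  have [measurable]: "L t \<in> borel_measurable M" "L s \<in> borel_measurable M" "L (a + (t - s)) \<in> borel_measurable M"
    using st by (auto intro!: L_measurable)
  have "(\<integral>\<^sup>+\<omega>. \<psi> (L t \<omega> - L s \<omega>) \<partial>M) = (\<integral>\<^sup>+z. \<psi> z \<partial>distr M borel (\<lambda>\<omega>. L t \<omega> - L s \<omega>))"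
    by (simp add: nn_integral_distr)
  also have "\<dots> = (\<integral>\<^sup>+\<omega>. \<psi> (L (a + (t - s)) \<omega>) \<partial>M)"
    unfolding L_stationary[OF st] by (simp add: nn_integral_distr)
  finally show ?thesis .
qed

text \<open>Independence is given for events only. It is extended one factor at a time: for a fixed
  event \<open>A\<close> of the past over the sigma-algebra generated by the increment, then over
  the past itself.\<close>

lemma nn_integral_past_mult_increment:
  fixes \<psi> :: "real \<Rightarrow> ennreal"
  assumes st: "a \<le> s" "s \<le> t" and \<psi>[measurable]: "\<psi> \<in> borel_measurable borel"
    and \<xi>: "\<xi> \<in> borel_measurable (Fm s)"
  shows "(\<integral>\<^sup>+\<omega>. \<xi> \<omega> * \<psi> (L t \<omega> - L s \<omega>) \<partial>M) = (\<integral>\<^sup>+\<omega>. \<psi> (L (a + (t - s)) \<omega>) \<partial>M) * (\<integral>\<^sup>+\<omega>. \<xi> \<omega> \<partial>M)"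
proof -
  have [measurable]: "L t \<in> borel_measurable M" "L s \<in> borel_measurable M"
    using st by (auto intro!: L_measurable)
  have "(\<integral>\<^sup>+\<omega>. indicator A \<omega> * \<psi> (L t \<omega> - L s \<omega>) \<partial>M)
      = (\<integral>\<^sup>+\<omega>. \<psi> (L t \<omega> - L s \<omega>) \<partial>M) * emeasure M A" if "A \<in> F s" for A
  proof -
    have [measurable]: "A \<in> sets M" using that F_subset[OF st(1)] by auto
    define N where "N = vimage_algebra (space M) (\<lambda>\<omega>. L t \<omega> - L s \<omega>) borel"
    have sub: "subalgebra M N"
      unfolding subalgebra_def N_def by (auto simp: sets_vimage_algebra2 intro!: measurable_sets)
    have "(\<integral>\<^sup>+\<omega>. \<psi> (L t \<omega> - L s \<omega>) * indicator A \<omega> \<partial>M)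
      = emeasure M A * (\<integral>\<^sup>+\<omega>. \<psi> (L t \<omega> - L s \<omega>) \<partial>M)"
    proof (rule nn_integral_mult_subalgebra[OF sub])
      show "(\<lambda>\<omega>. \<psi> (L t \<omega> - L s \<omega>)) \<in> borel_measurable N"
        unfolding N_def by (intro measurable_compose[OF measurable_vimage_algebra1 \<psi>]) auto
      fix C assume "C \<in> sets N"
      then obtain B where B: "B \<in> sets borel" "C = {\<omega>\<in>space M. L t \<omega> - L s \<omega> \<in> B}"
        unfolding N_def by (auto simp: sets_vimage_algebra2)
      then have [measurable]: "C \<in> sets M" by simp
      have "(\<integral>\<^sup>+\<omega>. indicator C \<omega> * indicator A \<omega> \<partial>M) = (\<integral>\<^sup>+\<omega>. indicator (A \<inter> C) \<omega> \<partial>M)"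
        by (intro nn_integral_cong) (auto simp: indicator_def)
      also have "\<dots> = emeasure M (A \<inter> C)" by simp
      also have "\<dots> = emeasure M A * emeasure M C"
        using L_indep[OF st that B(1)] unfolding B(2) emeasure_eq_measure by (simp add: ennreal_mult)
      finally show "(\<integral>\<^sup>+\<omega>. indicator C \<omega> * indicator A \<omega> \<partial>M) = emeasure M A * emeasure M C" .
    qed simp
    then show ?thesis by (simp add: mult.commute)
  qed
  then have "(\<integral>\<^sup>+\<omega>. \<xi> \<omega> * \<psi> (L t \<omega> - L s \<omega>) \<partial>M) = (\<integral>\<^sup>+\<omega>. \<psi> (L t \<omega> - L s \<omega>) \<partial>M) * (\<integral>\<^sup>+\<omega>. \<xi> \<omega> \<partial>M)"
    by (intro nn_integral_mult_subalgebra[OF subalgebra_Fm[OF st(1)] _ _ \<xi>]) (auto simp: sets_Fm st)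
  then show ?thesis by (simp add: nn_integral_increment[OF st \<psi>])
qed

lemma increment_measurable_Fm:
  assumes "a \<le> s" "s \<le> t" "t \<le> u" shows "(\<lambda>\<omega>. L t \<omega> - L s \<omega>) \<in> borel_measurable (Fm u)"
proof -
  have "L v \<in> borel_measurable (Fm u)" if "a \<le> v" "v \<le> u" for v
    using measurable_from_subalg[OF subalgebra_Fm_mono L_measurable_Fm] that by auto
  from this[of s] this[of t] assms
  have "L t \<in> borel_measurable (Fm u)" "L s \<in> borel_measurable (Fm u)" by auto
  then show ?thesis by simp
qed

text \<open>The indicator and the first \<open>n\<close> factors belong to the past of the next
  increment, so one factor splits off at each induction step; by stationarity all factors have the
  same mean.\<close>

lemma nn_integral_prod_increments:
  fixes \<psi> :: "real \<Rightarrow> ennreal"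
  assumes c: "a \<le> c" "0 \<le> h" and \<psi>[measurable]: "\<psi> \<in> borel_measurable borel" and A: "A \<in> F c"
  shows "(\<integral>\<^sup>+\<omega>. indicator A \<omega> * (\<Prod>k<n. \<psi> (L (c + h * (real k + 1)) \<omega> - L (c + h * real k) \<omega>)) \<partial>M)
    = emeasure M A * (\<integral>\<^sup>+\<omega>. \<psi> (L (a + h) \<omega>) \<partial>M) ^ n"
proof (induct n)
  case 0
  have "A \<in> sets M" using A F_subset[OF c(1)] by auto
  then show ?case by simp
next
  case (Suc n)
  let ?t = "c + h * real n"
  have t: "a \<le> ?t" "c \<le> ?t" "?t \<le> c + h * (real n + 1)" using c by (auto simp: algebra_simps intro: add_increasing2)
  have "(\<lambda>\<omega>. L (c + h * (real k + 1)) \<omega> - L (c + h * real k) \<omega>) \<in> borel_measurable (Fm ?t)" if "k < n" for k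
  proof (rule increment_measurable_Fm)
    have "real k + 1 \<le> real n" using that by linarith
    then show "c + h * (real k + 1) \<le> c + h * real n" using c by (auto intro!: mult_left_mono)
  qed (use c in \<open>auto simp: algebra_simps intro: add_increasing2\<close>)
  moreover have "A \<in> sets (Fm ?t)" using A F_mono[OF c(1) t(2)] by (auto simp: sets_Fm t)
  ultimately have "(\<lambda>\<omega>. indicator A \<omega> * (\<Prod>k<n. \<psi> (L (c + h * (real k + 1)) \<omega> - L (c + h * real k) \<omega>)))
    \<in> borel_measurable (Fm ?t)"
    by (intro borel_measurable_times_ennreal borel_measurable_indicator borel_measurable_prod_ennreal measurable_compose[OF _ \<psi>]) auto
  from nn_integral_past_mult_increment[OF t(1) t(3) \<psi> this]
  have "(\<integral>\<^sup>+\<omega>. indicator A \<omega> * (\<Prod>k<n. \<psi> (L (c + h * (real k + 1)) \<omega> - L (c + h * real k) \<omega>)) * \<psi> (L (c + h * (real n + 1)) \<omega> - L ?t \<omega>) \<partial>M)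
    = (\<integral>\<^sup>+\<omega>. \<psi> (L (a + h) \<omega>) \<partial>M) * (emeasure M A * (\<integral>\<^sup>+\<omega>. \<psi> (L (a + h) \<omega>) \<partial>M) ^ n)"
    unfolding Suc by (simp add: algebra_simps)
  then show ?case by (simp only: prod.lessThan_Suc mult.assoc power_Suc mult.left_commute)
qed

lemma jump_sum_path_limit:
  fixes g :: "real \<Rightarrow> real"
  assumes c: "a \<le> c" "c < d"
    and g: "continuous_on UNIV g" "\<And>z. 0 \<le> g z" "0 < e" "\<And>z. \<bar>z\<bar> \<le> e \<Longrightarrow> g z = 0"
    and \<omega>: "\<omega> \<in> space M"
  defines "h \<equiv> \<lambda>n. (d - c) / real (Suc n)"
  shows "jump_sum (\<lambda>z. ennreal (g z)) (\<lambda>t. L t \<omega>) c d < \<infinity>"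
    "(\<lambda>n. \<Sum>k<Suc n. g (L (c + h n * (real k + 1)) \<omega> - L (c + h n * real k) \<omega>)) \<longlonglongrightarrow>
      enn2real (jump_sum (\<lambda>z. ennreal (g z)) (\<lambda>t. L t \<omega>) c d)"
proof -
  obtain C where C: "0 \<le> C"
    "(\<lambda>n. \<Sum>k<Suc n. g (L (c + h n * (real k + 1)) \<omega> - L (c + h n * real k) \<omega>)) \<longlonglongrightarrow> C"
    "jump_sum (\<lambda>z. ennreal (g z)) (\<lambda>t. L t \<omega>) c d = ennreal C"
    using grid_sum_tendsto_jump_sum[OF cadlag_mono[OF L_cadlag[OF \<omega>] c(1)] c(2) g]
    unfolding h_def by (metis (no_types, lifting))
  then show "jump_sum (\<lambda>z. ennreal (g z)) (\<lambda>t. L t \<omega>) c d < \<infinity>"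
    "(\<lambda>n. \<Sum>k<Suc n. g (L (c + h n * (real k + 1)) \<omega> - L (c + h n * real k) \<omega>)) \<longlonglongrightarrow>
      enn2real (jump_sum (\<lambda>z. ennreal (g z)) (\<lambda>t. L t \<omega>) c d)"
    by auto
qed

lemma grid_increment_measurable:
  assumes "a \<le> c" "0 \<le> h"
  shows "(\<lambda>\<omega>. L (c + h * (real k + 1)) \<omega> - L (c + h * real k) \<omega>) \<in> borel_measurable M"
  using assms by (intro borel_measurable_diff L_measurable) (auto intro: add_increasing2)

lemma jump_sum_measurable_continuous:
  fixes g :: "real \<Rightarrow> real"
  assumes c: "a \<le> c" "c < d"
    and g: "continuous_on UNIV g" "\<And>z. 0 \<le> g z" "0 < e" "\<And>z. \<bar>z\<bar> \<le> e \<Longrightarrow> g z = 0"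
  shows "(\<lambda>\<omega>. jump_sum (\<lambda>z. ennreal (g z)) (\<lambda>t. L t \<omega>) c d) \<in> borel_measurable M"
proof -
  have [measurable]: "g \<in> borel_measurable borel" using g(1) by (rule borel_measurable_continuous_onI)
  have "(\<lambda>\<omega>. enn2real (jump_sum (\<lambda>z. ennreal (g z)) (\<lambda>t. L t \<omega>) c d)) \<in> borel_measurable M"
  proof (rule borel_measurable_LIMSEQ_metric)
    fix n :: nat
    show "(\<lambda>\<omega>. \<Sum>k<Suc n. g (L (c + (d - c) / real (Suc n) * (real k + 1)) \<omega> - L (c + (d - c) / real (Suc n) * real k) \<omega>)) \<in> borel_measurable M"
      using c by (intro borel_measurable_sum measurable_compose[OF grid_increment_measurable]) auto
  qed (rule jump_sum_path_limit(2)[OF c g])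
  then have "(\<lambda>\<omega>. ennreal (enn2real (jump_sum (\<lambda>z. ennreal (g z)) (\<lambda>t. L t \<omega>) c d))) \<in> borel_measurable M"
    by simp
  then show ?thesis
    by (rule measurable_cong[THEN iffD1, rotated]) (use jump_sum_path_limit(1)[OF c g] in simp)
qed

text \<open>The Laplace transform of a grid sum of \<open>g\<close> over the increments factorises into a power,
  so its limit depends on the interval only through its length.\<close>
lemma nn_integral_exp_jump_sum:
  fixes g :: "real \<Rightarrow> real"
  assumes c: "a \<le> c" "c < d"
    and g: "continuous_on UNIV g" "\<And>z. 0 \<le> g z" "0 < e" "\<And>z. \<bar>z\<bar> \<le> e \<Longrightarrow> g z = 0"
    and A: "A \<in> F c"
  defines "W \<equiv> \<lambda>c d \<omega>. enn2real (jump_sum (\<lambda>z. ennreal (g z)) (\<lambda>t. L t \<omega>) c d)"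
  shows "(\<integral>\<^sup>+\<omega>. indicator A \<omega> * ennreal (exp (- W c d \<omega>)) \<partial>M)
    = emeasure M A * (\<integral>\<^sup>+\<omega>. ennreal (exp (- W a (a + (d - c)) \<omega>)) \<partial>M)"
proof -
  have [measurable]: "g \<in> borel_measurable borel" using g(1) by (rule borel_measurable_continuous_onI)
  define h where "h n = (d - c) / real (Suc n)" for n
  define \<rho> where "\<rho> n = (\<integral>\<^sup>+\<omega>. ennreal (exp (- g (L (a + h n) \<omega>))) \<partial>M)" for n
  have h: "0 \<le> h n" for n using c by (simp add: h_def)
  \<comment> \<open>Stated for every event and every interval of the given length:
    \<open>\<rho> n\<close> depends on the length alone, so the instance at \<open>A\<close> and
    \<open>c\<close> and the instance at the whole space and \<open>a\<close> share one sequence,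
    whose limit is identified in two ways.\<close>
  have lim: "(\<lambda>n. emeasure M B * \<rho> n ^ Suc n) \<longlonglongrightarrow> (\<integral>\<^sup>+\<omega>. indicator B \<omega> * ennreal (exp (- W c' d' \<omega>)) \<partial>M)"
    if B: "B \<in> F c'" and c': "a \<le> c'" and d': "d' - c' = d - c" for B c' d'
  proof -
    have [measurable]: "B \<in> sets M" using B F_subset[OF c'] by auto
    have c'd': "c' < d'" using c d' by simp
    have [measurable]: "W c' d' \<in> borel_measurable M"
      unfolding W_def by (intro measurable_compose[OF jump_sum_measurable_continuous[OF c' c'd' g]]) auto
    have [measurable]: "(\<lambda>\<omega>. L (c' + h n * (real k + 1)) \<omega> - L (c' + h n * real k) \<omega>) \<in> borel_measurable M" for n k
      using grid_increment_measurable[OF c' h] .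
    let ?S = "\<lambda>n \<omega>. \<Sum>k<Suc n. g (L (c' + h n * (real k + 1)) \<omega> - L (c' + h n * real k) \<omega>)"
    have S0: "0 \<le> ?S n \<omega>" for n \<omega> by (intro sum_nonneg g)
    have "(\<integral>\<^sup>+\<omega>. indicator B \<omega> * ennreal (exp (- ?S n \<omega>)) \<partial>M) = emeasure M B * \<rho> n ^ Suc n" for n
    proof -
      have "ennreal (exp (- ?S n \<omega>)) = (\<Prod>k<Suc n. ennreal (exp (- g (L (c' + h n * (real k + 1)) \<omega> - L (c' + h n * real k) \<omega>))))" for \<omega>
        unfolding sum_negf[symmetric] exp_sum[OF finite_lessThan] by (rule prod_ennreal[symmetric]) simp
      then show ?thesis
        using nn_integral_prod_increments[OF c' h[of n], of "\<lambda>z. ennreal (exp (- g z))" B "Suc n"] B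
        by (simp only: \<rho>_def) simp
    qed
    moreover have "(\<lambda>n. \<integral>\<^sup>+\<omega>. indicator B \<omega> * ennreal (exp (- ?S n \<omega>)) \<partial>M) \<longlonglongrightarrow> (\<integral>\<^sup>+\<omega>. indicator B \<omega> * ennreal (exp (- W c' d' \<omega>)) \<partial>M)"
    proof (rule nn_integral_dominated_convergence[where w="\<lambda>_. 1"])
      show "AE \<omega> in M. indicator B \<omega> * ennreal (exp (- ?S n \<omega>)) \<le> 1" for n
        using S0[of n] by (intro AE_I2) (auto simp: indicator_def simp del: sum.lessThan_Suc)
      show "AE \<omega> in M. (\<lambda>n. indicator B \<omega> * ennreal (exp (- ?S n \<omega>))) \<longlonglongrightarrow> indicator B \<omega> * ennreal (exp (- W c' d' \<omega>))"
      proof (intro AE_I2)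
        fix \<omega> assume "\<omega> \<in> space M"
        from jump_sum_path_limit(2)[OF c' c'd' g this]
        have "(\<lambda>n. ?S n \<omega>) \<longlonglongrightarrow> W c' d' \<omega>" by (simp add: W_def h_def d')
        then have "(\<lambda>n. ennreal (exp (- ?S n \<omega>))) \<longlonglongrightarrow> ennreal (exp (- W c' d' \<omega>))"
          by (intro tendsto_ennrealI tendsto_exp tendsto_minus)
        then show "(\<lambda>n. indicator B \<omega> * ennreal (exp (- ?S n \<omega>))) \<longlonglongrightarrow> indicator B \<omega> * ennreal (exp (- W c' d' \<omega>))"
          by (auto simp: indicator_def)
      qed
    qed (auto simp: emeasure_space_1)
    ultimately show ?thesis by simp
  qed
  have sp: "space M \<in> F a" using F_sigma_algebra[of a] sigma_algebra.sigma_sets_eq[of "space M" "F a"] sigma_sets_top by blast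
  have "(\<lambda>n. \<rho> n ^ Suc n) \<longlonglongrightarrow> (\<integral>\<^sup>+\<omega>. indicator (space M) \<omega> * ennreal (exp (- W a (a + (d - c)) \<omega>)) \<partial>M)"
    using lim[OF sp, of "a + (d - c)"] by (simp add: emeasure_space_1)
  also have "(\<integral>\<^sup>+\<omega>. indicator (space M) \<omega> * ennreal (exp (- W a (a + (d - c)) \<omega>)) \<partial>M) = (\<integral>\<^sup>+\<omega>. ennreal (exp (- W a (a + (d - c)) \<omega>)) \<partial>M)"
    by (intro nn_integral_cong) simp
  finally have "(\<lambda>n. emeasure M A * \<rho> n ^ Suc n) \<longlonglongrightarrow> emeasure M A * (\<integral>\<^sup>+\<omega>. ennreal (exp (- W a (a + (d - c)) \<omega>)) \<partial>M)"
    by (intro ennreal_tendsto_cmult) (auto simp: emeasure_eq_measure)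
  with lim[OF A c(1) refl] show ?thesis by (rule LIMSEQ_unique)
qed

text \<open>The Laplace identity is applied to \<open>l * g\<close> with \<open>l = 1/2^n\<close>,
  turned into one for \<open>1 - exp\<close>, and multiplied by \<open>2^n\<close>; monotone
  convergence in \<open>n\<close> yields the means without knowing beforehand that they are
  finite.\<close>

lemma nn_integral_past_jump_sum_continuous:
  fixes g :: "real \<Rightarrow> real"
  assumes c: "a \<le> c" "c < d"
    and g: "continuous_on UNIV g" "\<And>z. 0 \<le> g z" "0 < e" "\<And>z. \<bar>z\<bar> \<le> e \<Longrightarrow> g z = 0"
    and A: "A \<in> F c"
  defines "J \<equiv> \<lambda>c d \<omega>. jump_sum (\<lambda>z. ennreal (g z)) (\<lambda>t. L t \<omega>) c d"
  shows "(\<integral>\<^sup>+\<omega>. indicator A \<omega> * J c d \<omega> \<partial>M) = emeasure M A * (\<integral>\<^sup>+\<omega>. J a (a + (d - c)) \<omega> \<partial>M)"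
proof -
  have [measurable]: "A \<in> sets M" using A F_subset[OF c(1)] by auto
  let ?d = "a + (d - c)"
  have ad: "a < ?d" using c by simp
  have J[measurable]: "J c d \<in> borel_measurable M" "J a ?d \<in> borel_measurable M"
    unfolding J_def using jump_sum_measurable_continuous[OF c g] jump_sum_measurable_continuous[OF order_refl ad g] by auto
  define W where "W c d \<omega> = enn2real (J c d \<omega>)" for c d \<omega>
  have [measurable]: "W c d \<in> borel_measurable M" "W a ?d \<in> borel_measurable M" unfolding W_def by auto
  have W0: "0 \<le> W c d \<omega>" for c d \<omega> by (simp add: W_def)
  let ?r = "\<lambda>n w. ennreal (2^n * (1 - exp (- (1/2^n) * w)))"
  have 1: "(\<integral>\<^sup>+\<omega>. indicator A \<omega> * ?r n (W c d \<omega>) \<partial>M) = emeasure M A * (\<integral>\<^sup>+\<omega>. ?r n (W a ?d \<omega>) \<partial>M)" for n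
  proof -
    define l :: real where "l = 1/2^n"
    have l: "0 \<le> l" "l \<le> 1" by (auto simp: l_def)
    have sc: "enn2real (jump_sum (\<lambda>z. ennreal (l * g z)) x u v) = l * enn2real (jump_sum (\<lambda>z. ennreal (g z)) x u v)" for x u v
      using l g(2) by (simp add: ennreal_mult jump_sum_cmult enn2real_mult)
    let ?x = "\<integral>\<^sup>+\<omega>. ennreal (exp (- (l * W a ?d \<omega>))) \<partial>M"
    let ?y = "\<integral>\<^sup>+\<omega>. indicator A \<omega> * ennreal (1 - exp (- (l * W c d \<omega>))) \<partial>M"
    let ?y' = "\<integral>\<^sup>+\<omega>. ennreal (1 - exp (- (l * W a ?d \<omega>))) \<partial>M"
    have x: "(\<integral>\<^sup>+\<omega>. indicator A \<omega> * ennreal (exp (- (l * W c d \<omega>))) \<partial>M) = emeasure M A * ?x"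
      using nn_integral_exp_jump_sum[OF c, of "\<lambda>z. l * g z" e A] l g A
      by (simp add: sc W_def J_def continuous_on_mult_left)
    have W1: "exp (- (l * W u v \<omega>)) \<le> 1" for u v \<omega> using W0 l by simp
    have one: "ennreal (exp (- (l * W u v \<omega>))) + ennreal (1 - exp (- (l * W u v \<omega>))) = 1" for u v \<omega>
      using W1[of u v \<omega>] by (subst ennreal_plus[symmetric]) auto
    have "emeasure M A * ?x + ?y = emeasure M A"
      unfolding x[symmetric]
      by (subst nn_integral_add[symmetric]) (auto simp: distrib_left[symmetric] one)
    also have "\<dots> = emeasure M A * (?x + ?y')"
      by (subst nn_integral_add[symmetric]) (auto simp: one emeasure_space_1)
    finally have "emeasure M A * ?x + ?y = emeasure M A * ?x + emeasure M A * ?y'" by (simp add: distrib_left)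
    \<comment> \<open>Cancelling in \<open>ennreal\<close> requires a finite summand; the transform
      is at most \<open>1\<close>.\<close>
    moreover have "emeasure M A * ?x \<noteq> \<infinity>"
    proof -
      have "?x \<le> (\<integral>\<^sup>+\<omega>. 1 \<partial>M)" using W1 by (intro nn_integral_mono) (auto simp: ennreal_le_1)
      also have "\<dots> = 1" by (simp add: emeasure_space_1)
      finally have "?x < \<infinity>" by (rule le_less_trans) simp
      then show ?thesis by (auto simp: ennreal_mult_eq_top_iff)
    qed
    ultimately have yy: "?y = emeasure M A * ?y'" using ennreal_add_left_cancel by blast
    have r: "?r n w = ennreal (2^n) * ennreal (1 - exp (- (l * w)))" if "0 \<le> w" for w
      using that l by (subst ennreal_mult[symmetric]) (auto simp: l_def)
    have "(\<integral>\<^sup>+\<omega>. indicator A \<omega> * ?r n (W c d \<omega>) \<partial>M) = ennreal (2^n) * ?y"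
      unfolding r[OF W0] by (subst nn_integral_cmult[symmetric]) (auto simp: mult_ac)
    also have "\<dots> = emeasure M A * (ennreal (2^n) * ?y')" by (simp add: yy mult_ac)
    also have "ennreal (2^n) * ?y' = (\<integral>\<^sup>+\<omega>. ?r n (W a ?d \<omega>) \<partial>M)"
      unfolding r[OF W0] by (subst nn_integral_cmult[symmetric]) auto
    finally show ?thesis .
  qed
  have inc: "incseq (\<lambda>n. ?r n w)" if "0 \<le> w" for w
    using pow2_one_minus_exp_tendsto(2)[OF that] by (auto simp: incseq_def intro!: ennreal_leI)
  have sup: "(SUP n. ?r n w) = ennreal w" if "0 \<le> w" for w
    using LIMSEQ_unique[OF LIMSEQ_SUP[OF inc[OF that]] tendsto_ennrealI[OF pow2_one_minus_exp_tendsto(1)[OF that]]] .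
  have WJ: "ennreal (W c d \<omega>) = J c d \<omega>" "ennreal (W a ?d \<omega>) = J a ?d \<omega>" if "\<omega> \<in> space M" for \<omega>
    using jump_sum_path_limit(1)[OF c g that] jump_sum_path_limit(1)[OF order_refl ad g that]
    by (auto simp: W_def J_def)
  have "(\<integral>\<^sup>+\<omega>. indicator A \<omega> * J c d \<omega> \<partial>M) = (\<integral>\<^sup>+\<omega>. (SUP n. indicator A \<omega> * ?r n (W c d \<omega>)) \<partial>M)"
    by (intro nn_integral_cong) (simp only: SUP_mult_left_ennreal[symmetric] sup[OF W0] WJ)
  also have "\<dots> = (SUP n. \<integral>\<^sup>+\<omega>. indicator A \<omega> * ?r n (W c d \<omega>) \<partial>M)"
    using inc[OF W0] by (intro nn_integral_monotone_convergence_SUP) (auto simp: incseq_def le_fun_def intro!: mult_left_mono)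
  also have "\<dots> = emeasure M A * (SUP n. \<integral>\<^sup>+\<omega>. ?r n (W a ?d \<omega>) \<partial>M)"
    by (simp only: 1 SUP_mult_left_ennreal)
  also have "(SUP n. \<integral>\<^sup>+\<omega>. ?r n (W a ?d \<omega>) \<partial>M) = (\<integral>\<^sup>+\<omega>. (SUP n. ?r n (W a ?d \<omega>)) \<partial>M)"
    using inc[OF W0] by (intro nn_integral_monotone_convergence_SUP[symmetric]) (auto simp: incseq_def le_fun_def)
  also have "\<dots> = (\<integral>\<^sup>+\<omega>. J a ?d \<omega> \<partial>M)"
    by (intro nn_integral_cong) (simp only: sup[OF W0] WJ)
  finally show ?thesis .
qed

end

section \<open>Squared jumps and their mean per unit time\<close>

text \<open>Lowering the square by a constant and cutting at \<open>0\<close> gives a continuous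
  test function that vanishes near \<open>0\<close> and increases to the square with
  \<open>k\<close>.\<close>

definition trunc_sq :: "nat \<Rightarrow> real \<Rightarrow> real" where
  "trunc_sq k z = max 0 (z\<^sup>2 - 1 / real (Suc k))"

lemma trunc_sq_nonneg: "0 \<le> trunc_sq k z"
  and trunc_sq_le: "trunc_sq k z \<le> z\<^sup>2"
  by (auto simp: trunc_sq_def)

text \<open>The radius is at most \<open>1\<close>, where
  \<open>z\<^sup>2 \<le> \<bar>z\<bar>\<close>; this avoids a square root in the radius.\<close>

lemma trunc_sq_vanish: "\<bar>z\<bar> \<le> 1 / real (Suc k) \<Longrightarrow> trunc_sq k z = 0"
proof -
  assume z: "\<bar>z\<bar> \<le> 1 / real (Suc k)"
  also have "\<dots> \<le> 1" by simp
  finally have "\<bar>z\<bar> * \<bar>z\<bar> \<le> \<bar>z\<bar> * 1" by (intro mult_left_mono) auto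
  then have "z\<^sup>2 \<le> \<bar>z\<bar>" by (simp add: power2_eq_square)
  with z show ?thesis by (simp add: trunc_sq_def)
qed

lemma trunc_sq_cont: "continuous_on UNIV (trunc_sq k)"
  unfolding trunc_sq_def by (intro continuous_intros)

lemma trunc_sq_measurable[measurable]: "trunc_sq k \<in> borel_measurable borel"
  by (rule borel_measurable_continuous_onI[OF trunc_sq_cont])

lemma incseq_trunc_sq: "incseq (\<lambda>k z. ennreal (trunc_sq k z))"
  unfolding trunc_sq_def
  by (auto simp: incseq_def le_fun_def frac_le intro!: ennreal_leI max.mono diff_left_mono)

lemma SUP_trunc_sq: "(SUP k. ennreal (trunc_sq k z)) = ennreal (z\<^sup>2)"
proof -
  have "(\<lambda>k. trunc_sq k z) \<longlonglongrightarrow> max 0 (z\<^sup>2 - 0)"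
    unfolding trunc_sq_def by (intro tendsto_intros mesh_tendsto_0)
  then have "(\<lambda>k. ennreal (trunc_sq k z)) \<longlonglongrightarrow> ennreal (z\<^sup>2)"
    by (intro tendsto_ennrealI) (simp add: max_def)
  moreover have "incseq (\<lambda>k. ennreal (trunc_sq k z))"
    using incseq_trunc_sq by (auto simp: incseq_def le_fun_def)
  ultimately show ?thesis
    using LIMSEQ_SUP LIMSEQ_unique by blast
qed

text \<open>Cauchy's functional equation, with monotonicity (from nonnegativity) in place of
  continuity: \<open>t\<close> is squeezed between neighbouring multiples of
  \<open>1 / Suc n\<close>.\<close>

lemma additive_nonneg_linear:
  fixes w :: "real \<Rightarrow> real"
  assumes add: "\<And>s t. 0 \<le> s \<Longrightarrow> 0 \<le> t \<Longrightarrow> w (s + t) = w s + w t"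
    and nonneg: "\<And>t. 0 \<le> t \<Longrightarrow> 0 \<le> w t" and t: "0 \<le> t"
  shows "w t = t * w 1"
proof -
  have mult: "w (real n * s) = real n * w s" if s: "0 \<le> s" for n s
  proof (induct n)
    case 0 show ?case using add[of 0 0] by simp
  next
    case (Suc n)
    have "w (real n * s + s) = w (real n * s) + w s" using s by (intro add) auto
    with Suc show ?case by (simp add: algebra_simps)
  qed
  have mono: "w x \<le> w y" if "0 \<le> x" "x \<le> y" for x y
    using add[of x "y - x"] nonneg[of "y - x"] that by simp
  have "\<bar>w t - t * w 1\<bar> \<le> w 1 / real (Suc n)" for n
  proof -
    define k where "k = nat \<lfloor>real (Suc n) * t\<rfloor>"
    have "0 \<le> real (Suc n) * t" using t by simp
    then have k: "real k \<le> real (Suc n) * t" "real (Suc n) * t \<le> real (Suc k)"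
      unfolding k_def by linarith+
    have e: "w (real (Suc n) * t) = real (Suc n) * w t" using mult[of t "Suc n"] t by blast
    have "real k * w 1 \<le> w (real (Suc n) * t)" using mono[OF _ k(1)] mult[of 1 k] by simp
    moreover have "w (real (Suc n) * t) \<le> real (Suc k) * w 1"
      using mono[OF _ k(2)] mult[of 1 "Suc k"] t by simp
    moreover have "real k * w 1 \<le> real (Suc n) * t * w 1" "real (Suc n) * t * w 1 \<le> real (Suc k) * w 1"
      using k nonneg[of 1] by (intro mult_right_mono; simp)+
    ultimately have "\<bar>real (Suc n) * w t - real (Suc n) * t * w 1\<bar> \<le> w 1"
      unfolding e by (simp add: algebra_simps)
    moreover have "real (Suc n) * w t - real (Suc n) * t * w 1 = real (Suc n) * (w t - t * w 1)"
      by (simp add: algebra_simps)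
    ultimately have "real (Suc n) * \<bar>w t - t * w 1\<bar> \<le> w 1" by (simp add: abs_mult)
    then show ?thesis by (simp add: field_simps)
  qed
  then have "\<bar>w t - t * w 1\<bar> \<le> 0"
    by (intro LIMSEQ_le_const[OF mesh_tendsto_0[of "w 1"]]) auto
  then show ?thesis by simp
qed

context levy_setting begin

text \<open>The increment of \<open>S = [L, L]\<close> over \<open>(c, d]\<close>, kept
  extended-valued because its finiteness, even almost surely, is established only later.\<close>

definition QV :: "real \<Rightarrow> real \<Rightarrow> 'a \<Rightarrow> ennreal" where
  "QV c d \<omega> = jump_sum (\<lambda>z. ennreal (z\<^sup>2)) (\<lambda>t. L t \<omega>) c d"

lemma QV_SUP: "QV c d \<omega> = (SUP k. jump_sum (\<lambda>z. ennreal (trunc_sq k z)) (\<lambda>t. L t \<omega>) c d)"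
  unfolding QV_def SUP_trunc_sq[symmetric] by (rule jump_sum_SUP[OF incseq_trunc_sq])

lemma incseq_jump_sum_trunc_sq: "incseq (\<lambda>k. jump_sum (\<lambda>z. ennreal (trunc_sq k z)) x c d)"
  unfolding jump_sum_def using incseq_trunc_sq
  by (auto simp: incseq_def le_fun_def intro!: nn_integral_mono mult_right_mono)

lemma trunc_sq_jump_sum_measurable:
  assumes "a \<le> c"
  shows "(\<lambda>\<omega>. jump_sum (\<lambda>z. ennreal (trunc_sq k z)) (\<lambda>t. L t \<omega>) c d) \<in> borel_measurable M"
proof (cases "c < d")
  case True
  then show ?thesis using assms
    by (intro jump_sum_measurable_continuous[OF _ _ trunc_sq_cont, where e="1 / real (Suc k)"] trunc_sq_vanish trunc_sq_nonneg) auto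
qed (simp add: jump_sum_empty)

lemma QV_measurable: "a \<le> c \<Longrightarrow> QV c d \<in> borel_measurable M"
  unfolding QV_SUP[abs_def] by (intro borel_measurable_SUP trunc_sq_jump_sum_measurable) auto

text \<open>Monotone convergence along \<open>trunc_sq\<close> removes the restriction to test
  functions that vanish near \<open>0\<close>.\<close>

lemma nn_integral_past_QV:
  assumes c: "a \<le> c" "c < d" and A: "A \<in> F c"
  shows "(\<integral>\<^sup>+\<omega>. indicator A \<omega> * QV c d \<omega> \<partial>M) = (\<integral>\<^sup>+\<omega>. QV a (a + (d - c)) \<omega> \<partial>M) * emeasure M A"
proof -
  have [measurable]: "A \<in> sets M" using A F_subset[OF c(1)] by auto
  note [measurable] = trunc_sq_jump_sum_measurable[OF c(1)] trunc_sq_jump_sum_measurable[OF order_refl]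
  let ?J = "\<lambda>k c d \<omega>. jump_sum (\<lambda>z. ennreal (trunc_sq k z)) (\<lambda>t. L t \<omega>) c d"
  have "(\<integral>\<^sup>+\<omega>. indicator A \<omega> * QV c d \<omega> \<partial>M) = (SUP k. \<integral>\<^sup>+\<omega>. indicator A \<omega> * ?J k c d \<omega> \<partial>M)"
    unfolding QV_SUP SUP_mult_left_ennreal using incseq_jump_sum_trunc_sq
    by (intro nn_integral_monotone_convergence_SUP) (auto simp: incseq_def le_fun_def intro!: mult_left_mono)
  also have "\<dots> = (SUP k. emeasure M A * (\<integral>\<^sup>+\<omega>. ?J k a (a + (d - c)) \<omega> \<partial>M))"
    by (intro SUP_cong refl nn_integral_past_jump_sum_continuous[OF c trunc_sq_cont, where e="1 / real (Suc k)" for k] trunc_sq_vanish trunc_sq_nonneg A) auto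
  also have "\<dots> = emeasure M A * (SUP k. \<integral>\<^sup>+\<omega>. ?J k a (a + (d - c)) \<omega> \<partial>M)"
    by (rule SUP_mult_left_ennreal[symmetric])
  also have "(SUP k. \<integral>\<^sup>+\<omega>. ?J k a (a + (d - c)) \<omega> \<partial>M) = (\<integral>\<^sup>+\<omega>. QV a (a + (d - c)) \<omega> \<partial>M)"
    unfolding QV_SUP using incseq_jump_sum_trunc_sq
    by (intro nn_integral_monotone_convergence_SUP[symmetric]) (auto simp: incseq_def le_fun_def)
  finally show ?thesis by (simp add: mult.commute)
qed

lemma space_in_F: "a \<le> t \<Longrightarrow> space M \<in> F t"
  using sets.top[of "Fm t"] by (simp add: sets_Fm)

lemma nn_integral_QV_add:
  assumes "0 \<le> s" "0 \<le> t"
  shows "(\<integral>\<^sup>+\<omega>. QV a (a + (s + t)) \<omega> \<partial>M) = (\<integral>\<^sup>+\<omega>. QV a (a + s) \<omega> \<partial>M) + (\<integral>\<^sup>+\<omega>. QV a (a + t) \<omega> \<partial>M)"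
proof (cases "t = 0")
  case True then show ?thesis by (simp add: QV_def jump_sum_empty)
next
  case False
  then have t: "a + s < a + (s + t)" "a \<le> a + s" using assms by auto
  note [measurable] = QV_measurable[OF order_refl] QV_measurable[OF t(2)]
  have "(\<integral>\<^sup>+\<omega>. QV a (a + (s + t)) \<omega> \<partial>M) = (\<integral>\<^sup>+\<omega>. QV a (a + s) \<omega> + QV (a + s) (a + (s + t)) \<omega> \<partial>M)"
    unfolding QV_def using assms by (intro nn_integral_cong jump_sum_split) auto
  also have "\<dots> = (\<integral>\<^sup>+\<omega>. QV a (a + s) \<omega> \<partial>M) + (\<integral>\<^sup>+\<omega>. QV (a + s) (a + (s + t)) \<omega> \<partial>M)"
    by (rule nn_integral_add) auto
  also have "(\<integral>\<^sup>+\<omega>. QV (a + s) (a + (s + t)) \<omega> \<partial>M) = (\<integral>\<^sup>+\<omega>. indicator (space M) \<omega> * QV (a + s) (a + (s + t)) \<omega> \<partial>M)"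
    by (intro nn_integral_cong) simp
  also have "\<dots> = (\<integral>\<^sup>+\<omega>. QV a (a + t) \<omega> \<partial>M)"
    using nn_integral_past_QV[OF t(2,1) space_in_F[OF t(2)]] by (simp add: emeasure_space_1)
  finally show ?thesis .
qed

text \<open>The product rule on preimages, which form a generating system stable under
  intersections; it makes the cross term in \<open>L_square_grid\<close> vanish.\<close>

lemma indep_var_increment:
  assumes st: "a \<le> s" "s \<le> t"
  shows "indep_var borel (L s) borel (\<lambda>\<omega>. L t \<omega> - L s \<omega>)"
  unfolding indep_var_eq
proof (intro conjI indep_set_sigma_sets)
  show m[measurable]: "L s \<in> borel_measurable M" using st by simp
  have [measurable]: "L t \<in> borel_measurable M" using st by simp
  show m2[measurable]: "(\<lambda>\<omega>. L t \<omega> - L s \<omega>) \<in> borel_measurable M" by measurable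
  have stable: "Int_stable {X -` A \<inter> space M |A. A \<in> sets borel}" for X :: "'a \<Rightarrow> real"
  proof (safe intro!: Int_stableI)
    fix A B :: "real set" assume "A \<in> sets borel" "B \<in> sets borel"
    then show "\<exists>C. (X -` A \<inter> space M) \<inter> (X -` B \<inter> space M) = (X -` C \<inter> space M) \<and> C \<in> sets borel"
      by (intro exI[of _ "A \<inter> B"]) auto
  qed
  then show "Int_stable {L s -` A \<inter> space M |A. A \<in> sets borel}"
    "Int_stable {(\<lambda>\<omega>. L t \<omega> - L s \<omega>) -` A \<inter> space M |A. A \<in> sets borel}" by blast+
  show "indep_set {L s -` A \<inter> space M |A. A \<in> sets borel} {(\<lambda>\<omega>. L t \<omega> - L s \<omega>) -` A \<inter> space M |A. A \<in> sets borel}"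
  proof (safe intro!: indep_setI)
    fix A B :: "real set" assume AB: "A \<in> sets borel" "B \<in> sets borel"
    show "L s -` A \<inter> space M \<in> events" "(\<lambda>\<omega>. L t \<omega> - L s \<omega>) -` A \<inter> space M \<in> events"
      using AB by (auto intro!: measurable_sets)
    have "L s -` A \<inter> space M \<in> F s"
      using measurable_sets[OF L_measurable_Fm[OF st(1)] AB(1)] st by (simp add: sets_Fm)
    from L_indep[OF st this AB(2)]
    show "prob (L s -` A \<inter> space M \<inter> ((\<lambda>\<omega>. L t \<omega> - L s \<omega>) -` B \<inter> space M)) =
      prob (L s -` A \<inter> space M) * prob ((\<lambda>\<omega>. L t \<omega> - L s \<omega>) -` B \<inter> space M)"
      by (simp add: vimage_def Int_def conj_commute)
  qed
qed

text \<open>Centered independent increments are orthogonal, so second moments add. This bounds the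
  mean of sums of squared increments uniformly in the mesh.\<close>

lemma L_square_grid:
  assumes "0 \<le> h" shows "expectation (\<lambda>\<omega>. (L (a + real n * h) \<omega>)\<^sup>2) = real n * expectation (\<lambda>\<omega>. (L (a + h) \<omega>)\<^sup>2)"
proof (induct n)
  case 0
  have "expectation (\<lambda>\<omega>. (L a \<omega>)\<^sup>2) = expectation (\<lambda>\<omega>. 0)" by (intro Bochner_Integration.integral_cong) (auto simp: L_start)
  then show ?case by simp
next
  case (Suc n)
  obtain s t where s: "s = a + real n * h" and t: "t = a + real (Suc n) * h" by blast
  have st: "a \<le> s" "s \<le> t" "a \<le> t" "a \<le> a + h" using assms by (auto simp: s t algebra_simps)
  have ts: "a + (t - s) = a + h" by (simp add: s t algebra_simps)
  have [measurable]: "L s \<in> borel_measurable M" "L t \<in> borel_measurable M" "L (a + h) \<in> borel_measurable M" using st by (auto intro!: L_measurable)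
  let ?I = "\<lambda>\<omega>. L t \<omega> - L s \<omega>"
  have I: "integrable M ?I" "expectation ?I = 0"
    using st by (auto simp: L_integrable L_centered)
  note ind = indep_var_increment[OF st(1,2)]
  have cross: "integrable M (\<lambda>\<omega>. L s \<omega> * ?I \<omega>)" "expectation (\<lambda>\<omega>. L s \<omega> * ?I \<omega>) = 0"
    using indep_var_integrable[OF ind L_integrable[OF st(1)] I(1)]
      indep_var_lebesgue_integral[OF ind L_integrable[OF st(1)] I(1)] I(2) by auto
  have "integrable (distr M borel ?I) (\<lambda>z. z\<^sup>2)"
    unfolding L_stationary[OF st(1,2)] ts using L_square[OF st(4)] by (simp add: integrable_distr_eq)
  then have sq: "integrable M (\<lambda>\<omega>. (?I \<omega>)\<^sup>2)" by (simp add: integrable_distr_eq)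
  have "expectation (\<lambda>\<omega>. (?I \<omega>)\<^sup>2) = (\<integral>z. z\<^sup>2 \<partial>distr M borel ?I)" by (simp add: integral_distr)
  also have "\<dots> = expectation (\<lambda>\<omega>. (L (a + h) \<omega>)\<^sup>2)"
    unfolding L_stationary[OF st(1,2)] ts by (simp add: integral_distr)
  finally have sqe: "expectation (\<lambda>\<omega>. (?I \<omega>)\<^sup>2) = expectation (\<lambda>\<omega>. (L (a + h) \<omega>)\<^sup>2)" .
  have "expectation (\<lambda>\<omega>. (L t \<omega>)\<^sup>2) = expectation (\<lambda>\<omega>. (L s \<omega>)\<^sup>2 + 2 * (L s \<omega> * ?I \<omega>) + (?I \<omega>)\<^sup>2)"
    by (intro Bochner_Integration.integral_cong) (auto simp: power2_eq_square algebra_simps)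
  also have "\<dots> = expectation (\<lambda>\<omega>. (L s \<omega>)\<^sup>2) + 2 * expectation (\<lambda>\<omega>. L s \<omega> * ?I \<omega>) + expectation (\<lambda>\<omega>. (?I \<omega>)\<^sup>2)"
    using cross(1) sq L_square[OF st(1)] by simp
  finally have "expectation (\<lambda>\<omega>. (L t \<omega>)\<^sup>2) = real (Suc n) * expectation (\<lambda>\<omega>. (L (a + h) \<omega>)\<^sup>2)"
    using Suc unfolding s[symmetric] cross sqe by (simp add: distrib_right)
  then show ?case unfolding t .
qed

text \<open>For each truncation the grid sums have mean at most \<open>K\<close>, the second moment
  of \<open>L (a + 1)\<close>, whatever the mesh. Fatou carries the bound to the jump sum, and the
  supremum over truncations to \<open>QV\<close>.\<close>

lemma nn_integral_QV_unit_finite: "(\<integral>\<^sup>+\<omega>. QV a (a + 1) \<omega> \<partial>M) < \<infinity>"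
proof -
  let ?J = "\<lambda>k \<omega>. jump_sum (\<lambda>z. ennreal (trunc_sq k z)) (\<lambda>t. L t \<omega>) a (a + 1)"
  define K where "K = expectation (\<lambda>\<omega>. (L (a + 1) \<omega>)\<^sup>2)"
  have "(\<integral>\<^sup>+\<omega>. ?J k \<omega> \<partial>M) \<le> ennreal K" for k
  proof -
    define h where "h n = 1 / real (Suc n)" for n
    let ?I = "\<lambda>n i \<omega>. L (a + h n * (real i + 1)) \<omega> - L (a + h n * real i) \<omega>"
    let ?S = "\<lambda>n \<omega>. \<Sum>i<Suc n. trunc_sq k (?I n i \<omega>)"
    have h: "0 \<le> h n" for n by (simp add: h_def)
    have [measurable]: "?I n i \<in> borel_measurable M" for n i
      by (rule grid_increment_measurable[OF order_refl h])
    have bound: "(\<integral>\<^sup>+\<omega>. ennreal (?S n \<omega>) \<partial>M) \<le> ennreal K" for n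
    proof -
      have "(\<integral>\<^sup>+\<omega>. ennreal (?S n \<omega>) \<partial>M) \<le> (\<integral>\<^sup>+\<omega>. (\<Sum>i<Suc n. ennreal ((?I n i \<omega>)\<^sup>2)) \<partial>M)"
        by (subst sum_ennreal) (auto intro!: nn_integral_mono ennreal_leI sum_mono trunc_sq_le simp del: sum.lessThan_Suc)
      also have "\<dots> = (\<Sum>i<Suc n. \<integral>\<^sup>+\<omega>. ennreal ((?I n i \<omega>)\<^sup>2) \<partial>M)"
        by (rule nn_integral_sum) measurable
      also have "\<dots> = (\<Sum>i<Suc n. \<integral>\<^sup>+\<omega>. ennreal ((L (a + h n) \<omega>)\<^sup>2) \<partial>M)"
      proof (rule sum.cong[OF refl])
        fix i
        have e: "a + (a + h n * (real i + 1) - (a + h n * real i)) = a + h n" by (simp add: algebra_simps)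
        show "(\<integral>\<^sup>+\<omega>. ennreal ((?I n i \<omega>)\<^sup>2) \<partial>M) = (\<integral>\<^sup>+\<omega>. ennreal ((L (a + h n) \<omega>)\<^sup>2) \<partial>M)"
          using nn_integral_increment[of "a + h n * real i" "a + h n * (real i + 1)" "\<lambda>z. ennreal (z\<^sup>2)"] h[of n]
          unfolding e by (simp add: algebra_simps)
      qed
      also have "\<dots> = of_nat (Suc n) * ennreal (expectation (\<lambda>\<omega>. (L (a + h n) \<omega>)\<^sup>2))"
        using nn_integral_eq_integral[OF L_square[of "a + h n"]] h[of n] by simp
      also have "\<dots> = ennreal (real (Suc n) * expectation (\<lambda>\<omega>. (L (a + h n) \<omega>)\<^sup>2))"
        by (simp only: ennreal_of_nat_eq_real_of_nat) (rule ennreal_mult[symmetric], auto)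
      also have "real (Suc n) * expectation (\<lambda>\<omega>. (L (a + h n) \<omega>)\<^sup>2) = K"
        unfolding L_square_grid[OF h, symmetric] K_def by (simp add: h_def)
      finally show ?thesis .
    qed
    have lim: "(\<lambda>n. ennreal (?S n \<omega>)) \<longlonglongrightarrow> ?J k \<omega>" if "\<omega> \<in> space M" for \<omega>
    proof -
      have 1: "a < a + 1" by simp
      have 2: "0 < 1 / real (Suc k)" by simp
      note l = jump_sum_path_limit[OF order_refl 1 trunc_sq_cont[of k] trunc_sq_nonneg 2 trunc_sq_vanish that]
      have "(\<lambda>n. ?S n \<omega>) \<longlonglongrightarrow> enn2real (?J k \<omega>)" using l(2) by (simp add: h_def)
      from tendsto_ennrealI[OF this] show ?thesis using l(1) by simp
    qed
    have "(\<integral>\<^sup>+\<omega>. ?J k \<omega> \<partial>M) = (\<integral>\<^sup>+\<omega>. liminf (\<lambda>n. ennreal (?S n \<omega>)) \<partial>M)"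
      by (intro nn_integral_cong lim_imp_Liminf[symmetric] sequentially_bot lim)
    also have "\<dots> \<le> liminf (\<lambda>n. \<integral>\<^sup>+\<omega>. ennreal (?S n \<omega>) \<partial>M)"
      by (rule nn_integral_liminf) measurable
    also have "\<dots> \<le> ennreal K"
      using bound by (intro Liminf_le) auto
    finally show ?thesis .
  qed
  moreover have "(\<integral>\<^sup>+\<omega>. QV a (a + 1) \<omega> \<partial>M) = (SUP k. \<integral>\<^sup>+\<omega>. ?J k \<omega> \<partial>M)"
    unfolding QV_SUP using incseq_jump_sum_trunc_sq
    by (intro nn_integral_monotone_convergence_SUP trunc_sq_jump_sum_measurable) (auto simp: incseq_def le_fun_def)
  ultimately have "(\<integral>\<^sup>+\<omega>. QV a (a + 1) \<omega> \<partial>M) \<le> ennreal K" by (simp add: SUP_le_iff)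
  then show ?thesis by (rule le_less_trans) simp
qed

text \<open>The constant \<open>\<kappa>2\<close> of the model, defined through \<open>QV\<close>
  and identified with the second moment of the Levy measure in \<open>jump_rate_eq\<close>.\<close>

definition jump_rate :: real where "jump_rate = enn2real (\<integral>\<^sup>+\<omega>. QV a (a + 1) \<omega> \<partial>M)"

lemma jump_rate_nonneg: "0 \<le> jump_rate" by (simp add: jump_rate_def)

text \<open>The mean is additive in \<open>t\<close>. The functional equation is solved in the
  reals, so finiteness is spread first from \<open>1\<close> to the integers and then to every
  \<open>t\<close> below an integer.\<close>

lemma nn_integral_QV:
  assumes t: "0 \<le> t" shows "(\<integral>\<^sup>+\<omega>. QV a (a + t) \<omega> \<partial>M) = ennreal (jump_rate * t)"
proof -
  define w where "w t = (\<integral>\<^sup>+\<omega>. QV a (a + t) \<omega> \<partial>M)" for t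
  have add: "w (s + t) = w s + w t" if "0 \<le> s" "0 \<le> t" for s t
    unfolding w_def using nn_integral_QV_add that by blast
  have fin: "w (real n) < \<infinity>" for n
  proof (induct n)
    case 0 show ?case by (simp add: w_def QV_def jump_sum_empty)
  next
    case (Suc n)
    then show ?case using add[of "real n" 1] nn_integral_QV_unit_finite by (simp add: w_def add.commute)
  qed
  have fin: "w t < \<infinity>" if "0 \<le> t" for t
  proof -
    obtain n where n: "t \<le> real n" using real_arch_simple by blast
    have "w t \<le> w t + w (real n - t)" by simp
    also have "\<dots> = w (real n)" using add[of t "real n - t"] that n by simp
    finally show ?thesis using fin[of n] by (rule le_less_trans)
  qed
  have "enn2real (w t) = t * enn2real (w 1)"
  proof (rule additive_nonneg_linear[of "\<lambda>t. enn2real (w t)"])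
    fix s t :: real assume "0 \<le> s" "0 \<le> t"
    then show "enn2real (w (s + t)) = enn2real (w s) + enn2real (w t)"
      using fin[of s] fin[of t] by (simp add: add enn2real_plus)
  qed (use t in auto)
  then show ?thesis using fin[OF t] unfolding jump_rate_def w_def[symmetric]
    by (metis ennreal_enn2real infinity_ennreal_def mult.commute)
qed

lemma nn_integral_past_mult_QV:
  assumes c: "a \<le> c" "c \<le> d" and \<xi>: "\<xi> \<in> borel_measurable (Fm c)"
  shows "(\<integral>\<^sup>+\<omega>. \<xi> \<omega> * QV c d \<omega> \<partial>M) = ennreal (jump_rate * (d - c)) * (\<integral>\<^sup>+\<omega>. \<xi> \<omega> \<partial>M)"
proof (cases "c < d")
  case True
  show ?thesis
    by (intro nn_integral_mult_subalgebra[OF subalgebra_Fm[OF c(1)] QV_measurable[OF c(1)] _ \<xi>])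
      (use nn_integral_past_QV[OF c(1) True] nn_integral_QV[of "d - c"] c in \<open>simp add: sets_Fm\<close>)
qed (use c in \<open>simp add: QV_def jump_sum_empty\<close>)

end

section \<open>The Levy measure\<close>

lemma jump_sum_mono:
  assumes "\<And>z. g z \<le> g' z" shows "jump_sum g x c d \<le> jump_sum g' x c d"
  unfolding jump_sum_def by (intro nn_integral_mono mult_right_mono assms) auto

lemma jump_sum_suminf: "jump_sum (\<lambda>z. \<Sum>i. g i z) x c d = (\<Sum>i. jump_sum (g i) x c d)"
  unfolding jump_sum_def ennreal_suminf_multc[symmetric] by (rule nn_integral_suminf) auto

lemma jump_sum_zero[simp]: "jump_sum (\<lambda>z. 0) x c d = 0"
  by (simp add: jump_sum_def)

lemma jump_sum_indicator_empty[simp]: "jump_sum (indicator {}) x c d = 0"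
  by (simp add: jump_sum_def)

lemma incseq_min_infdist: "incseq (\<lambda>n z. ennreal (min 1 (real n * infdist z S)))"
proof (rule incseq_SucI, rule le_funI)
  fix n and z :: 'a
  have "real n * infdist z S \<le> real (Suc n) * infdist z S" by (intro mult_right_mono) (auto simp: infdist_nonneg)
  then show "ennreal (min 1 (real n * infdist z S)) \<le> ennreal (min 1 (real (Suc n) * infdist z S))"
    by (intro ennreal_leI min.mono) auto
qed

text \<open>Multiples of the distance to the complement, capped at \<open>1\<close>, increase to the
  indicator. The whole line is excluded because \<open>infdist\<close> to the empty set is
  \<open>0\<close>.\<close>

lemma indicator_open_SUP:
  fixes U :: "real set"
  assumes U: "open U" "U \<noteq> UNIV"
  shows "indicator U z = (SUP n. ennreal (min 1 (real n * infdist z (- U))))"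
proof (cases "z \<in> U")
  case True
  have "0 < infdist z (- U)"
    using U True infdist_pos_not_in_closed[of "- U" z] by auto
  then obtain n where n: "1 < real n * infdist z (- U)" using reals_Archimedean3 by blast
  have "1 = ennreal (min 1 (real n * infdist z (- U)))" using n by simp
  also have "\<dots> \<le> (SUP n. ennreal (min 1 (real n * infdist z (- U))))" by (rule SUP_upper) simp
  finally have "1 \<le> (SUP n. ennreal (min 1 (real n * infdist z (- U))))" .
  moreover have "(SUP n. ennreal (min 1 (real n * infdist z (- U)))) \<le> 1"
    by (intro SUP_least) (simp add: ennreal_le_1)
  ultimately have "1 = (SUP n. ennreal (min 1 (real n * infdist z (- U))))" by (rule antisym)
  with True show ?thesis by (simp only: indicator_simps)
qed simp

context levy_setting begin

text \<open>Jumps bounded away from \<open>0\<close>: a path has finitely many of them in a bounded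
  interval, so their counts can be subtracted in \<open>ennreal\<close>.\<close>

abbreviation far :: "nat \<Rightarrow> real set" where "far k \<equiv> {z. 1 / real (Suc k) < \<bar>z\<bar>}"

lemma jump_sum_far_finite:
  assumes c: "a \<le> c" "c < d" and \<omega>: "\<omega> \<in> space M"
  shows "jump_sum (indicator (B \<inter> far k)) (\<lambda>t. L t \<omega>) c d < \<infinity>"
proof -
  \<comment> \<open>The slope makes \<open>g\<close> at least \<open>1\<close> on
    \<open>far k\<close> and \<open>0\<close> within half that radius, hence an admissible
    continuous majorant.\<close>
  define g where "g z = max 0 (2 * real (Suc k) * \<bar>z\<bar> - 1)" for z :: real
  have "jump_sum (indicator (B \<inter> far k)) (\<lambda>t. L t \<omega>) c d \<le> jump_sum (\<lambda>z. ennreal (g z)) (\<lambda>t. L t \<omega>) c d"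
  proof (rule jump_sum_mono)
    fix z
    show "indicator (B \<inter> far k) z \<le> ennreal (g z)"
    proof (cases "z \<in> B \<inter> far k")
      case True
      then have "1 < real (Suc k) * \<bar>z\<bar>" by (simp add: field_simps)
      then have "1 \<le> g z" unfolding g_def by linarith
      then show ?thesis using True ennreal_leI[of 1 "g z"] by simp
    qed simp
  qed
  also have "\<dots> < \<infinity>"
  proof (rule jump_sum_path_limit(1)[OF c _ _ _ _ \<omega>])
    show "continuous_on UNIV g" unfolding g_def by (intro continuous_intros)
    show "0 < 1 / (2 * real (Suc k))" by simp
    show "g z = 0" if "\<bar>z\<bar> \<le> 1 / (2 * real (Suc k))" for z
      using that by (simp add: g_def field_simps)
  qed (simp add: g_def)
  finally show ?thesis .
qed

text \<open>A Dynkin argument from open sets, whose indicators on \<open>far k\<close> are suprema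
  of continuous functions vanishing near \<open>0\<close>. The restriction to \<open>far k\<close>
  makes the complement step possible, since it subtracts finite counts.\<close>

lemma jump_sum_far_measurable:
  assumes c: "a \<le> c" "c < d" and B: "B \<in> sets borel"
  shows "(\<lambda>\<omega>. jump_sum (indicator (B \<inter> far k)) (\<lambda>t. L t \<omega>) c d) \<in> borel_measurable M"
proof -
  let ?m = "\<lambda>B. (\<lambda>\<omega>. jump_sum (indicator (B \<inter> far k)) (\<lambda>t. L t \<omega>) c d) \<in> borel_measurable M"
  have op: "?m U" if U: "open U" for U
  proof -
    have "open (far k)" by (intro open_Collect_less continuous_intros)
    then have o: "open (U \<inter> far k)" using U by auto
    have "0 \<notin> U \<inter> far k" by simp
    then have ne: "U \<inter> far k \<noteq> UNIV" by blast
    let ?g = "\<lambda>n z. min 1 (real n * infdist z (- (U \<inter> far k)))"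
    have "jump_sum (indicator (U \<inter> far k)) x c d = (SUP n. jump_sum (\<lambda>z. ennreal (?g n z)) x c d)" for x
      unfolding indicator_open_SUP[OF o ne, abs_def] by (rule jump_sum_SUP[OF incseq_min_infdist])
    moreover have "(\<lambda>\<omega>. jump_sum (\<lambda>z. ennreal (?g n z)) (\<lambda>t. L t \<omega>) c d) \<in> borel_measurable M" for n
    proof (rule jump_sum_measurable_continuous[OF c])
      show "continuous_on UNIV (?g n)" by (intro continuous_intros)
      show "0 \<le> ?g n z" for z by (simp add: infdist_nonneg)
      show "0 < 1 / real (Suc k)" by simp
      show "?g n z = 0" if "\<bar>z\<bar> \<le> 1 / real (Suc k)" for z
      proof -
        have "z \<in> - (U \<inter> far k)" using that by auto
        then show ?thesis by simp
      qed
    qed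
    ultimately show ?thesis by simp
  qed
  have "Int_stable {S :: real set. open S}" by (auto simp: Int_stable_def)
  moreover have "{S. open S} \<subseteq> Pow (UNIV :: real set)" by simp
  moreover have "B \<in> sigma_sets UNIV {S. open S}" using B by (simp add: borel_def)
  ultimately show ?thesis
  proof (induct rule: sigma_sets_induct_disjoint)
    case (basic A) then show ?case using op by auto
  next
    case empty then show ?case by simp
  next
    case (compl A)
    have "?m UNIV" by (rule op) simp
    with compl(2) have "(\<lambda>\<omega>. jump_sum (indicator (UNIV \<inter> far k)) (\<lambda>t. L t \<omega>) c d
        - jump_sum (indicator (A \<inter> far k)) (\<lambda>t. L t \<omega>) c d) \<in> borel_measurable M" by simp
    moreover have "jump_sum (indicator (UNIV \<inter> far k)) (\<lambda>t. L t \<omega>) c d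
        - jump_sum (indicator (A \<inter> far k)) (\<lambda>t. L t \<omega>) c d = jump_sum (indicator ((UNIV - A) \<inter> far k)) (\<lambda>t. L t \<omega>) c d"
      if "\<omega> \<in> space M" for \<omega>
    proof -
      have "(indicator (UNIV \<inter> far k) :: real \<Rightarrow> ennreal) = (\<lambda>z. indicator ((UNIV - A) \<inter> far k) z + indicator (A \<inter> far k) z)"
        by (auto simp: indicator_def)
      then have "jump_sum (indicator (UNIV \<inter> far k)) (\<lambda>t. L t \<omega>) c d
        = jump_sum (indicator ((UNIV - A) \<inter> far k)) (\<lambda>t. L t \<omega>) c d + jump_sum (indicator (A \<inter> far k)) (\<lambda>t. L t \<omega>) c d"
        using jump_sum_add[of "indicator ((UNIV - A) \<inter> far k)" "indicator (A \<inter> far k)"] by simp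
      then show ?thesis using jump_sum_far_finite[OF c that, of A k] by (simp add: ennreal_add_diff_cancel_right)
    qed
    ultimately show ?case by (subst measurable_cong[OF sym]) auto
  next
    case (union A)
    have "disjoint_family (\<lambda>i. A i \<inter> far k)" using union(1) by (auto simp: disjoint_family_on_def)
    then have "indicator ((\<Union>i. A i) \<inter> far k) = (\<lambda>z. \<Sum>i. indicator (A i \<inter> far k) z :: ennreal)"
      using suminf_indicator[of "\<lambda>i. A i \<inter> far k"] by (auto simp: fun_eq_iff)
    then have "jump_sum (indicator ((\<Union>i. A i) \<inter> far k)) x c d = (\<Sum>i. jump_sum (indicator (A i \<inter> far k)) x c d)" for x
      by (simp add: jump_sum_suminf)
    with union(3) show ?case by simp
  qed
qed

lemma jump_count_measurable:
  assumes c: "a \<le> c" "c < d" and B: "B \<in> sets borel"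
  shows "(\<lambda>\<omega>. jump_sum (indicator (B - {0})) (\<lambda>t. L t \<omega>) c d) \<in> borel_measurable M"
proof -
  have inc: "incseq (\<lambda>k. indicator (B \<inter> far k) :: real \<Rightarrow> ennreal)"
  proof (rule incseq_SucI, rule le_funI)
    fix k z
    have "1 / real (Suc (Suc k)) \<le> 1 / real (Suc k)" by (simp add: frac_le)
    then show "indicator (B \<inter> far k) z \<le> (indicator (B \<inter> far (Suc k)) z :: ennreal)"
      by (auto simp: indicator_def)
  qed
  have "(indicator (B - {0}) :: real \<Rightarrow> ennreal) = (\<lambda>z. SUP k. indicator (B \<inter> far k) z)"
  proof
    fix z :: real
    show "(indicator (B - {0}) z :: ennreal) = (SUP k. indicator (B \<inter> far k) z)"
    proof (cases "z \<in> B - {0}")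
      case True
      then obtain k where "z \<in> far k" using nat_approx_posE[of "\<bar>z\<bar>"] by auto
      then have "(1::ennreal) \<le> indicator (B \<inter> far k) z" using True by simp
      also have "\<dots> \<le> (SUP k. indicator (B \<inter> far k) z)" by (rule SUP_upper) simp
      finally have "(1::ennreal) \<le> (SUP k. indicator (B \<inter> far k) z)" .
      moreover have "(SUP k. indicator (B \<inter> far k) z) \<le> (1::ennreal)" by (intro SUP_least) (simp add: indicator_def)
      ultimately have "(1::ennreal) = (SUP k. indicator (B \<inter> far k) z)" by (rule antisym)
      with True show ?thesis by (simp only: indicator_simps)
    next
      case False
      then have "z \<notin> B \<inter> far k" for k by auto
      then show ?thesis using False by simp
    qed
  qed
  then have e: "jump_sum (indicator (B - {0})) x c d = (SUP k. jump_sum (indicator (B \<inter> far k)) x c d)" for x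
    using jump_sum_SUP[OF inc] by simp
  show ?thesis unfolding e by (intro borel_measurable_SUP jump_sum_far_measurable[OF c B]) auto
qed

lemma levy_measure_alt:
  "levy_measure M a L = measure_of UNIV (sets borel) (\<lambda>B. \<integral>\<^sup>+\<omega>. jump_sum (indicator (B - {0})) (\<lambda>t. L t \<omega>) a (a + 1) \<partial>M)"
  unfolding levy_measure_def jump_sum_def by (simp add: nn_integral_count_space_indicator)

lemma sets_levy_measure[simp, measurable_cong]: "sets (levy_measure M a L) = sets borel"
  and space_levy_measure[simp]: "space (levy_measure M a L) = UNIV"
  unfolding levy_measure_def using sets.sets_measure_of_eq[of borel] by (simp_all add: space_measure_of_conv)

text \<open>\<open>measure_of\<close> falls back to the zero measure unless its set function is a
  measure, so countable additivity has to be checked; exchanging sum and expectation there needs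
  measurable jump counts.\<close>

lemma emeasure_levy_measure:
  assumes B: "B \<in> sets borel"
  shows "emeasure (levy_measure M a L) B = (\<integral>\<^sup>+\<omega>. jump_sum (indicator (B - {0})) (\<lambda>t. L t \<omega>) a (a + 1) \<partial>M)"
proof (rule emeasure_measure_of[OF levy_measure_alt])
  show "positive (sets (levy_measure M a L)) (\<lambda>B. \<integral>\<^sup>+\<omega>. jump_sum (indicator (B - {0})) (\<lambda>t. L t \<omega>) a (a + 1) \<partial>M)"
    by (simp add: positive_def)
  show "countably_additive (sets (levy_measure M a L)) (\<lambda>B. \<integral>\<^sup>+\<omega>. jump_sum (indicator (B - {0})) (\<lambda>t. L t \<omega>) a (a + 1) \<partial>M)"
  proof (rule countably_additiveI)
    fix A :: "nat \<Rightarrow> real set"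
    assume A: "range A \<subseteq> sets (levy_measure M a L)" "disjoint_family A"
    have "disjoint_family (\<lambda>i. A i - {0})" using A(2) by (auto simp: disjoint_family_on_def)
    then have "indicator ((\<Union>i. A i) - {0}) = (\<lambda>z. \<Sum>i. indicator (A i - {0}) z :: ennreal)"
      using suminf_indicator[of "\<lambda>i. A i - {0}"] by (auto simp: fun_eq_iff)
    then have e: "jump_sum (indicator ((\<Union>i. A i) - {0})) x c d = (\<Sum>i. jump_sum (indicator (A i - {0})) x c d)" for x c d
      by (simp add: jump_sum_suminf)
    have "A i \<in> sets borel" for i using A(1) by auto
    then show "(\<Sum>i. \<integral>\<^sup>+\<omega>. jump_sum (indicator (A i - {0})) (\<lambda>t. L t \<omega>) a (a + 1) \<partial>M)
      = (\<integral>\<^sup>+\<omega>. jump_sum (indicator ((\<Union>i. A i) - {0})) (\<lambda>t. L t \<omega>) a (a + 1) \<partial>M)"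
      unfolding e by (intro nn_integral_suminf[symmetric] jump_count_measurable) auto
  qed
qed (use B in auto)

text \<open>Measurability and the identity go through one induction, since the additive and limit
  steps of the identity use the measurability of the pieces. The factor
  \<open>indicator (UNIV - {0})\<close> discards the times without a jump.\<close>

lemma nn_integral_levy_measure:
  assumes u: "u \<in> borel_measurable borel"
  shows "(\<lambda>\<omega>. jump_sum (\<lambda>z. u z * indicator (UNIV - {0}) z) (\<lambda>t. L t \<omega>) a (a + 1)) \<in> borel_measurable M \<and>
    (\<integral>\<^sup>+\<omega>. jump_sum (\<lambda>z. u z * indicator (UNIV - {0}) z) (\<lambda>t. L t \<omega>) a (a + 1) \<partial>M) = (\<integral>\<^sup>+z. u z \<partial>levy_measure M a L)"
  using u
proof induct
  case (cong f g)
  then have "f = g" by auto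
  with cong show ?case by simp
next
  case (set B)
  have "(\<lambda>z. indicator B z * indicator (UNIV - {0}) z) = (indicator (B - {0}) :: real \<Rightarrow> ennreal)"
    by (auto simp: indicator_def)
  with set show ?case using jump_count_measurable[of a "a+1" B] by (simp add: emeasure_levy_measure)
next
  case (mult u c)
  note [measurable] = mult(2) mult(4)[THEN conjunct1]
  show ?case using mult(4)[THEN conjunct2]
    by (simp add: mult.assoc jump_sum_cmult nn_integral_cmult)
next
  case (add u v)
  note [measurable] = add(1,4) add(3)[THEN conjunct1] add(7)[THEN conjunct1]
  show ?case using add(3)[THEN conjunct2] add(7)[THEN conjunct2]
    by (simp add: distrib_right jump_sum_add nn_integral_add)
next
  case (seq U)
  have inc: "incseq (\<lambda>i z. U i z * indicator (UNIV - {0}) z)"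
    using seq(4) by (auto simp: incseq_def le_fun_def intro!: mult_right_mono)
  have e: "jump_sum (\<lambda>z. (SUP i. U i) z * indicator (UNIV - {0}) z) x c d = (SUP i. jump_sum (\<lambda>z. U i z * indicator (UNIV - {0}) z) x c d)" for x c d
    using jump_sum_SUP[OF inc] by (simp add: SUP_mult_right_ennreal image_comp)
  have "incseq (\<lambda>i \<omega>. jump_sum (\<lambda>z. U i z * indicator (UNIV - {0}) z) (\<lambda>t. L t \<omega>) a (a + 1))"
    using inc by (auto simp: incseq_def le_fun_def intro!: jump_sum_mono)
  moreover have "(\<integral>\<^sup>+z. (SUP i. U i) z \<partial>levy_measure M a L) = (SUP i. \<integral>\<^sup>+z. U i z \<partial>levy_measure M a L)"
    using seq(1,4) by (subst nn_integral_monotone_convergence_SUP[symmetric]) (auto simp: image_comp intro!: nn_integral_cong)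
  moreover note [measurable] = seq(3)[THEN conjunct1]
  ultimately show ?case using seq(3)[THEN conjunct2] unfolding e
    by (simp add: nn_integral_monotone_convergence_SUP)
qed

lemma jump_rate_eq: "jump_rate = (\<integral>z. z\<^sup>2 \<partial>levy_measure M a L)"
proof -
  have "(\<lambda>z. ennreal (z\<^sup>2) * indicator (UNIV - {0}) z) = (\<lambda>z. ennreal (z\<^sup>2))"
    by (auto simp: indicator_def fun_eq_iff)
  then have "(\<integral>\<^sup>+\<omega>. QV a (a + 1) \<omega> \<partial>M) = (\<integral>\<^sup>+z. ennreal (z\<^sup>2) \<partial>levy_measure M a L)"
    using nn_integral_levy_measure[of "\<lambda>z. ennreal (z\<^sup>2)"] by (simp add: QV_def)
  then show ?thesis unfolding jump_rate_def by (subst integral_eq_nn_integral) auto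
qed

end

section \<open>The compensation formula\<close>

text \<open>The measure is general: counting measure gives a decomposition of jump sums, Lebesgue
  measure a Riemann sum over left endpoints.\<close>

lemma nn_integral_cell_split:
  fixes f :: "real \<Rightarrow> ennreal"
  assumes h: "0 < h" and f[measurable]: "f \<in> borel_measurable \<mu>"
    and I[measurable]: "\<And>k. {c + h * real k<..c + h * (real k + 1)} \<in> sets \<mu>"
  shows "(\<integral>\<^sup>+s. \<phi> (cell c h s) * f s * indicator {c<..c + h * real n} s \<partial>\<mu>)
    = (\<Sum>k<n. \<phi> k * (\<integral>\<^sup>+s. f s * indicator {c + h * real k<..c + h * (real k + 1)} s \<partial>\<mu>))"
proof -
  have "\<phi> (cell c h s) * f s * indicator {c<..c + h * real n} s
    = (\<Sum>k<n. \<phi> k * (f s * indicator {c + h * real k<..c + h * (real k + 1)} s))" for s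
  proof (cases "s \<in> {c<..c + h * real n}")
    case True
    then have s: "c < s" "cell c h s < n" using cell_less[OF h] by auto
    have "indicator {c + h * real k<..c + h * (real k + 1)} s = (if k = cell c h s then 1 else 0 :: ennreal)" for k
      using cell_iff[OF h s(1), of k] by (auto simp: indicator_def)
    then have "(\<Sum>k<n. \<phi> k * (f s * indicator {c + h * real k<..c + h * (real k + 1)} s))
      = (\<Sum>k<n. if k = cell c h s then \<phi> k * f s else 0)"
      by (intro sum.cong) auto
    then show ?thesis using True s by simp
  next
    case False
    have "s \<notin> {c + h * real k<..c + h * (real k + 1)}" if "k < n" for k
    proof
      assume *: "s \<in> {c + h * real k<..c + h * (real k + 1)}"
      have "h * (real k + 1) \<le> h * real n" "0 \<le> h * real k" using h that by auto
      with * False show False by auto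
    qed
    then have "(\<Sum>k<n. \<phi> k * (f s * indicator {c + h * real k<..c + h * (real k + 1)} s)) = 0"
      by (intro sum.neutral) auto
    then show ?thesis using False by simp
  qed
  then show ?thesis by (simp add: nn_integral_sum nn_integral_cmult)
qed

text \<open>Dominated convergence over the jump times, the weights \<open>f\<close> having finite
  total mass: values at left endpoints tend to left limits and stay bounded, since a cadlag path is
  bounded on \<open>[c, d]\<close>.\<close>

lemma left_sum_tendsto:
  fixes y :: "real \<Rightarrow> real" and f :: "real \<Rightarrow> ennreal"
  assumes y: "cadlag_from c y" and cd: "c < d"
    and fin: "(\<integral>\<^sup>+s. f s * indicator {c<..d} s \<partial>count_space UNIV) < \<infinity>"
  defines "h \<equiv> \<lambda>n. (d - c) / real (Suc n)"
  shows "(\<lambda>n. \<Sum>i<Suc n. ennreal (y (c + h n * real i)) *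
      (\<integral>\<^sup>+s. f s * indicator {c + h n * real i<..c + h n * (real i + 1)} s \<partial>count_space UNIV))
    \<longlonglongrightarrow> (\<integral>\<^sup>+s. ennreal (left_lim y s) * f s * indicator {c<..d} s \<partial>count_space UNIV)"
proof -
  have h: "0 < h n" "h \<longlonglongrightarrow> 0" for n using cd mesh_tendsto_0 by (auto simp: h_def)
  have hd: "c + h n * real (Suc n) = d" for n by (simp add: h_def)
  obtain K where K: "\<forall>s\<in>{c..d}. \<bar>y s\<bar> \<le> K" using cadlag_bounded[OF y] by blast
  have "(\<lambda>n. \<integral>\<^sup>+s. ennreal (y (c + h n * real (cell c (h n) s))) * f s * indicator {c<..d} s \<partial>count_space UNIV)
    \<longlonglongrightarrow> (\<integral>\<^sup>+s. ennreal (left_lim y s) * f s * indicator {c<..d} s \<partial>count_space UNIV)"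
  proof (rule nn_integral_dominated_convergence[where w="\<lambda>s. ennreal K * (f s * indicator {c<..d} s)"])
    show "AE s in count_space UNIV. ennreal (y (c + h n * real (cell c (h n) s))) * f s * indicator {c<..d} s
      \<le> ennreal K * (f s * indicator {c<..d} s)" for n
    proof (rule AE_I2)
      fix s :: real
      show "ennreal (y (c + h n * real (cell c (h n) s))) * f s * indicator {c<..d} s \<le> ennreal K * (f s * indicator {c<..d} s)"
      proof (cases "s \<in> {c<..d}")
        case True
        then have "c + h n * real (cell c (h n) s) \<in> {c..d}"
          using cell_bounds(1)[OF h(1)[of n], of c s] h(1)[of n] by auto
        then have "y (c + h n * real (cell c (h n) s)) \<le> K" using bspec[OF K] by (fastforce dest: abs_le_D1)
        then show ?thesis using True by (auto intro!: mult_right_mono ennreal_leI)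
      qed simp
    qed
    show "(\<integral>\<^sup>+s. ennreal K * (f s * indicator {c<..d} s) \<partial>count_space UNIV) < \<infinity>"
      using fin by (simp add: nn_integral_cmult ennreal_mult_less_top)
    show "AE s in count_space UNIV. (\<lambda>n. ennreal (y (c + h n * real (cell c (h n) s))) * f s * indicator {c<..d} s)
      \<longlonglongrightarrow> ennreal (left_lim y s) * f s * indicator {c<..d} s"
    proof (rule AE_I2)
      fix s :: real
      show "(\<lambda>n. ennreal (y (c + h n * real (cell c (h n) s))) * f s * indicator {c<..d} s)
        \<longlonglongrightarrow> ennreal (left_lim y s) * f s * indicator {c<..d} s"
      proof (cases "s \<in> {c<..d}")
        case True
        \<comment> \<open>Each single weight is bounded by the total mass, hence finite; multiplying
          a limit in \<open>ennreal\<close> by it is then safe.\<close>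
        have "f s * 1 \<le> (\<integral>\<^sup>+s. f s * indicator {c<..d} s \<partial>count_space UNIV)"
          using nn_integral_ge_point[of s UNIV "\<lambda>s. f s * indicator {c<..d} s"] True by simp
        then have "f s < top" using fin by (simp add: le_less_trans)
        moreover have "(\<lambda>n. ennreal (y (c + h n * real (cell c (h n) s)))) \<longlonglongrightarrow> ennreal (left_lim y s)"
          using cadlag_cell_left_tendsto[OF y h order_refl, of s] True by (intro tendsto_ennrealI) auto
        ultimately have "(\<lambda>n. f s * ennreal (y (c + h n * real (cell c (h n) s)))) \<longlonglongrightarrow> f s * ennreal (left_lim y s)"
          by (intro ennreal_tendsto_cmult)
        then show ?thesis using True by (simp add: mult.commute)
      qed simp
    qed
  qed auto
  moreover have "(\<integral>\<^sup>+s. ennreal (y (c + h n * real (cell c (h n) s))) * f s * indicator {c<..d} s \<partial>count_space UNIV)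
    = (\<Sum>i<Suc n. ennreal (y (c + h n * real i)) *
      (\<integral>\<^sup>+s. f s * indicator {c + h n * real i<..c + h n * (real i + 1)} s \<partial>count_space UNIV))" for n
    using nn_integral_cell_split[OF h(1), of f "count_space UNIV" c n "\<lambda>i. ennreal (y (c + h n * real i))" "Suc n"]
    unfolding hd by simp
  ultimately show ?thesis by simp
qed

lemma cadlag_compose:
  assumes x: "cadlag_from a x" and g: "continuous_on UNIV g"
  shows "cadlag_from a (\<lambda>t. g (x t))"
  and "a < s \<Longrightarrow> left_lim (\<lambda>t. g (x t)) s = g (left_lim x s)"
proof -
  have g: "isCont g z" for z using g by (simp add: continuous_on_eq_continuous_at)
  show "cadlag_from a (\<lambda>t. g (x t))"
    using x isCont_tendsto_compose[OF g] unfolding cadlag_from_def by blast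
  show "left_lim (\<lambda>t. g (x t)) s = g (left_lim x s)" if "a < s"
    by (intro left_lim_eqI isCont_tendsto_compose[OF g] cadlag_left_tendsto[OF x that])
qed

text \<open>The process is read at the next grid point strictly after \<open>t\<close>: for fixed
  \<open>n\<close> only countably many times occur, and right continuity gives the limit.
  Composition with \<open>max c\<close> extends it to the whole axis without assumptions before
  \<open>c\<close>.\<close>

lemma right_continuous_joint_measurable:
  fixes Z :: "real \<Rightarrow> 'a \<Rightarrow> real"
  assumes Z: "\<And>t. c \<le> t \<Longrightarrow> Z t \<in> borel_measurable M"
    and r: "\<And>\<omega> t. \<omega> \<in> space M \<Longrightarrow> c \<le> t \<Longrightarrow> ((\<lambda>u. Z u \<omega>) \<longlongrightarrow> Z t \<omega>) (at_right t)"
  shows "(\<lambda>(t, \<omega>). Z (max c t) \<omega>) \<in> borel_measurable (borel \<Otimes>\<^sub>M M)"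
proof -
  define gr where "gr n t = (of_int (\<lfloor>t * real (Suc n)\<rfloor> + 1)) / real (Suc n)" for n t
  have gr: "t < gr n t" "gr n t \<le> t + 1 / real (Suc n)" for n t
  proof -
    have "t * real (Suc n) < of_int (\<lfloor>t * real (Suc n)\<rfloor> + 1)" "of_int (\<lfloor>t * real (Suc n)\<rfloor> + 1) \<le> t * real (Suc n) + 1"
      by linarith+
    then have 1: "t < gr n t" "gr n t \<le> (t * real (Suc n) + 1) / real (Suc n)"
      unfolding gr_def by (simp add: pos_less_divide_eq del: of_nat_Suc of_int_add, intro divide_right_mono) auto
    then show "t < gr n t" "gr n t \<le> t + 1 / real (Suc n)" by (simp_all add: add_divide_distrib del: of_nat_Suc)
  qed
  have lim: "(\<lambda>n. gr n t) \<longlonglongrightarrow> t" for t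
  proof (rule tendsto_sandwich)
    show "\<forall>\<^sub>F n in sequentially. t \<le> gr n t" by (intro always_eventually allI less_imp_le gr)
    show "\<forall>\<^sub>F n in sequentially. gr n t \<le> t + 1 / real (Suc n)" by (intro always_eventually allI gr)
    show "(\<lambda>n. t + 1 / real (Suc n)) \<longlonglongrightarrow> t" using tendsto_add[OF tendsto_const[of t] mesh_tendsto_0[of 1]] by simp
  qed simp
  show ?thesis
  proof (rule borel_measurable_LIMSEQ_metric)
    fix n
    have "(\<lambda>p. Z (max c ((of_int (\<lfloor>fst p * real (Suc n)\<rfloor> + 1)) / real (Suc n))) (snd p)) \<in> borel_measurable (borel \<Otimes>\<^sub>M M)"
    proof (rule measurable_compose_countable[where f="\<lambda>i p. Z (max c ((of_int (i + 1)) / real (Suc n))) (snd p)" and g="\<lambda>p. \<lfloor>fst p * real (Suc n)\<rfloor>"])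
      fix i :: int
      show "(\<lambda>p. Z (max c ((of_int (i + 1)) / real (Suc n))) (snd p)) \<in> borel_measurable (borel \<Otimes>\<^sub>M M)"
        by (rule measurable_compose[OF measurable_snd Z]) simp
    qed measurable
    then show "(\<lambda>(t, \<omega>). Z (max c (gr n t)) \<omega>) \<in> borel_measurable (borel \<Otimes>\<^sub>M M)"
      by (simp add: gr_def case_prod_beta')
  next
    fix p :: "real \<times> 'a" assume "p \<in> space (borel \<Otimes>\<^sub>M M)"
    then obtain t \<omega> where p: "p = (t, \<omega>)" "\<omega> \<in> space M" by (auto simp: space_pair_measure)
    have "(\<lambda>n. max c (gr n t)) \<longlonglongrightarrow> max c t" by (intro tendsto_max tendsto_const lim)
    moreover have "max c t \<le> max c (gr n t)" for n using gr(1)[of t n] by (intro max.mono) auto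
    ultimately have "(\<lambda>n. Z (max c (gr n t)) \<omega>) \<longlonglongrightarrow> Z (max c t) \<omega>"
      by (intro right_continuous_seq[of "\<lambda>u. Z u \<omega>"] r p) auto
    then show "(\<lambda>n. (case p of (t, \<omega>) \<Rightarrow> Z (max c (gr n t)) \<omega>)) \<longlonglongrightarrow> (case p of (t, \<omega>) \<Rightarrow> Z (max c t) \<omega>)"
      by (simp add: p)
  qed
qed

lemma right_continuous_borel:
  fixes y :: "real \<Rightarrow> real"
  assumes y: "\<And>t. c \<le> t \<Longrightarrow> (y \<longlongrightarrow> y t) (at_right t)"
  shows "(\<lambda>t. y (max c t)) \<in> borel_measurable borel"
proof -
  have 1: "(\<lambda>(t, \<omega>). y (max c t)) \<in> borel_measurable (borel \<Otimes>\<^sub>M (count_space {()}))"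
    by (rule right_continuous_joint_measurable[of c "\<lambda>t _. y t"]) (use y in auto)
  have 2: "(\<lambda>t::real. (t, ())) \<in> borel \<rightarrow>\<^sub>M borel \<Otimes>\<^sub>M count_space {()}" by simp
  show ?thesis using measurable_compose[OF 2 1] by simp
qed

text \<open>Dominated convergence along sequences from either side. It makes the mean of a bounded
  process a cadlag function, so that left-endpoint Riemann sums of the mean can be treated like
  those of a path.\<close>

lemma (in finite_measure) cadlag_integral:
  fixes Y :: "real \<Rightarrow> 'a \<Rightarrow> real"
  assumes Y[measurable]: "\<And>t. a \<le> t \<Longrightarrow> Y t \<in> borel_measurable M"
    and c: "\<And>\<omega>. \<omega> \<in> space M \<Longrightarrow> cadlag_from a (\<lambda>t. Y t \<omega>)"
    and K: "\<And>t \<omega>. a \<le> t \<Longrightarrow> \<omega> \<in> space M \<Longrightarrow> \<bar>Y t \<omega>\<bar> \<le> K"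
  shows "cadlag_from a (\<lambda>t. \<integral>\<omega>. Y t \<omega> \<partial>M)"
  unfolding cadlag_from_def
proof (intro conjI allI impI)
  have dct: "(\<lambda>n. \<integral>\<omega>. Y (S n) \<omega> \<partial>M) \<longlonglongrightarrow> (\<integral>\<omega>. l \<omega> \<partial>M)"
    if S: "\<And>n. a \<le> S n" and l: "\<And>\<omega>. \<omega> \<in> space M \<Longrightarrow> (\<lambda>n. Y (S n) \<omega>) \<longlonglongrightarrow> l \<omega>" for S l
  proof (rule integral_dominated_convergence[where w="\<lambda>_. K"])
    show "l \<in> borel_measurable M"
      by (rule borel_measurable_LIMSEQ_metric[OF Y[OF S] l])
  qed (use S l K in \<open>auto intro!: AE_I2\<close>)
  fix t assume t: "a \<le> t"
  show "((\<lambda>t. \<integral>\<omega>. Y t \<omega> \<partial>M) \<longlongrightarrow> (\<integral>\<omega>. Y t \<omega> \<partial>M)) (at_right t)"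
  proof (rule tendsto_at_right_sequentially[of _ "t + 1"])
    fix S assume S: "\<And>n. t < S n" "S \<longlonglongrightarrow> t"
    have "a \<le> S n" for n using t S(1)[of n] by linarith
    moreover have "(\<lambda>n. Y (S n) \<omega>) \<longlonglongrightarrow> Y t \<omega>" if "\<omega> \<in> space M" for \<omega>
      using right_continuous_seq[OF cadlag_right_tendsto[OF c[OF that] t] S(2)] S(1) by (simp add: less_imp_le)
    ultimately show "(\<lambda>n. \<integral>\<omega>. Y (S n) \<omega> \<partial>M) \<longlonglongrightarrow> (\<integral>\<omega>. Y t \<omega> \<partial>M)" by (rule dct)
  qed simp
next
  fix t assume t: "a < t"
  have dct: "(\<lambda>n. \<integral>\<omega>. Y (S n) \<omega> \<partial>M) \<longlonglongrightarrow> (\<integral>\<omega>. left_lim (\<lambda>t. Y t \<omega>) t \<partial>M)"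
    if S: "\<And>n. a < S n" "\<And>n. S n < t" "S \<longlonglongrightarrow> t" for S
  proof -
    have l: "(\<lambda>n. Y (S n) \<omega>) \<longlonglongrightarrow> left_lim (\<lambda>t. Y t \<omega>) t" if "\<omega> \<in> space M" for \<omega>
    proof -
      have "filterlim S (at_left t) sequentially"
        using S by (auto simp: filterlim_at less_imp_neq intro!: always_eventually)
      from filterlim_compose[OF cadlag_left_tendsto[OF c[OF that] t] this] show ?thesis .
    qed
    have Sa: "a \<le> S n" for n using S(1)[of n] by simp
    show ?thesis
    proof (rule integral_dominated_convergence[where w="\<lambda>_. K"])
      show "(\<lambda>\<omega>. left_lim (\<lambda>t. Y t \<omega>) t) \<in> borel_measurable M"
        by (rule borel_measurable_LIMSEQ_metric[OF Y[OF Sa] l])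
    qed (use Sa l K in \<open>auto intro!: AE_I2\<close>)
  qed
  show "\<exists>l. ((\<lambda>t. \<integral>\<omega>. Y t \<omega> \<partial>M) \<longlongrightarrow> l) (at_left t)"
    by (intro exI tendsto_at_left_sequentially[of a]) (use t dct in auto)
qed

context levy_setting begin

text \<open>As \<open>ennreal\<close> clips at \<open>0\<close>, only the positive part of the left limits contributes.\<close>
definition left_jump_sum :: "(real \<Rightarrow> 'a \<Rightarrow> real) \<Rightarrow> real \<Rightarrow> real \<Rightarrow> 'a \<Rightarrow> ennreal" where
  "left_jump_sum Y c d \<omega> = (\<integral>\<^sup>+s. ennreal (left_lim (\<lambda>t. Y t \<omega>) s) * ennreal ((jump (\<lambda>t. L t \<omega>) s)\<^sup>2) * indicator {c<..d} s \<partial>count_space UNIV)"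

lemma grid_point_ge: "a \<le> c \<Longrightarrow> 0 \<le> h \<Longrightarrow> a \<le> c + h * real i"
  by (simp add: add_increasing2)

text \<open>The squares are truncated first: with \<open>trunc_sq\<close> every path has a finite
  jump sum and the Riemann sums converge everywhere, whereas finiteness for the full squares is
  known only almost surely.\<close>

lemma left_jump_sum_measurable:
  assumes c: "a \<le> c" "c < d"
    and Y: "\<And>t. a \<le> t \<Longrightarrow> Y t \<in> borel_measurable M"
    and cad: "\<And>\<omega>. \<omega> \<in> space M \<Longrightarrow> cadlag_from a (\<lambda>t. Y t \<omega>)"
  shows "left_jump_sum Y c d \<in> borel_measurable M"
proof -
  let ?l = "\<lambda>k \<omega>. \<integral>\<^sup>+s. ennreal (left_lim (\<lambda>t. Y t \<omega>) s) * ennreal (trunc_sq k (jump (\<lambda>t. L t \<omega>) s)) * indicator {c<..d} s \<partial>count_space UNIV"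
  let ?J = "\<lambda>k c d \<omega>. jump_sum (\<lambda>z. ennreal (trunc_sq k z)) (\<lambda>t. L t \<omega>) c d"
  have inc: "ennreal (trunc_sq k z) \<le> ennreal (trunc_sq k' z)" if "k \<le> k'" for k k' z
    using incseq_trunc_sq that by (auto simp: incseq_def le_fun_def)
  have "left_jump_sum Y c d \<omega> = (SUP k. ?l k \<omega>)" for \<omega>
    unfolding left_jump_sum_def SUP_trunc_sq[symmetric] SUP_mult_left_ennreal SUP_mult_right_ennreal
    by (rule nn_integral_monotone_convergence_SUP)
       (auto simp: incseq_def le_fun_def intro!: mult_right_mono mult_left_mono inc)
  moreover have "?l k \<in> borel_measurable M" for k
  proof -
    define h where "h n = (d - c) / real (Suc n)" for n
    have h: "0 \<le> h n" for n using c by (simp add: h_def)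
    let ?S = "\<lambda>n \<omega>. \<Sum>i<Suc n. ennreal (Y (c + h n * real i) \<omega>) * ?J k (c + h n * real i) (c + h n * (real i + 1)) \<omega>"
    have lim: "(\<lambda>n. ?S n \<omega>) \<longlonglongrightarrow> ?l k \<omega>" if "\<omega> \<in> space M" for \<omega>
    proof -
      have "?J k c d \<omega> < \<infinity>"
        by (rule jump_sum_path_limit(1)[OF c trunc_sq_cont trunc_sq_nonneg _ trunc_sq_vanish that]) auto
      then show ?thesis
        using left_sum_tendsto[OF cadlag_mono[OF cad[OF that] c(1)] c(2), of "\<lambda>s. ennreal (trunc_sq k (jump (\<lambda>t. L t \<omega>) s))"]
        unfolding jump_sum_def h_def by simp
    qed
    have [measurable]: "Y (c + h n * real i) \<in> borel_measurable M" "?J k (c + h n * real i) (c + h n * (real i + 1)) \<in> borel_measurable M" for n i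
      using grid_point_ge[OF c(1) h[of n], of i] by (auto intro!: Y trunc_sq_jump_sum_measurable)
    have "?S n \<in> borel_measurable M" for n by measurable
    then show ?thesis by (rule borel_measurable_LIMSEQ_order[rotated]) (rule lim)
  qed
  ultimately show ?thesis by (simp add: borel_measurable_SUP cong: measurable_cong)
qed

text \<open>The value at a left endpoint belongs to the past of its cell, so
  \<open>nn_integral_past_mult_QV\<close> gives the mean of its product with \<open>QV\<close> of
  the cell. Boundedness makes \<open>K * QV c d\<close> a majorant for the sums over jumps; the
  deterministic sums converge separately.\<close>

lemma compensation_bounded:
  assumes c: "a \<le> c" "c < d"
    and ad: "adapted_on M {a..} F Y"
    and cad: "\<And>\<omega>. \<omega> \<in> space M \<Longrightarrow> cadlag_from a (\<lambda>t. Y t \<omega>)"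
    and K: "\<And>t \<omega>. a \<le> t \<Longrightarrow> \<omega> \<in> space M \<Longrightarrow> 0 \<le> Y t \<omega> \<and> Y t \<omega> \<le> K"
  shows "(\<integral>\<^sup>+\<omega>. left_jump_sum Y c d \<omega> \<partial>M) = ennreal jump_rate * (\<integral>\<^sup>+t. (\<integral>\<^sup>+\<omega>. ennreal (Y t \<omega>) \<partial>M) * indicator {c<..d} t \<partial>lborel)"
proof -
  have Y[measurable]: "Y t \<in> borel_measurable M" if "a \<le> t" for t using adapted_measurable[OF ad that] .
  have left_jump_sum[measurable]: "left_jump_sum Y c d \<in> borel_measurable M" by (rule left_jump_sum_measurable[OF c Y cad])
  have QV[measurable]: "QV u v \<in> borel_measurable M" if "a \<le> u" for u v using QV_measurable[OF that] .
  define y where "y t = expectation (Y t)" for t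
  have y: "(\<integral>\<^sup>+\<omega>. ennreal (Y t \<omega>) \<partial>M) = ennreal (y t)" if "a \<le> t" for t
  proof -
    have "integrable M (Y t)"
      using K[OF that] by (intro integrable_const_bound[where B=K] AE_I2 Y that) auto
    then show ?thesis using K[OF that] unfolding y_def by (intro nn_integral_eq_integral AE_I2) auto
  qed
  have ycad: "cadlag_from a y"
    unfolding y_def by (rule cadlag_integral[OF Y cad, of K]) (use K in auto)
  obtain K' where K': "\<forall>s\<in>{a..d}. \<bar>y s\<bar> \<le> K'" using cadlag_bounded[OF ycad] by blast
  define h where "h n = (d - c) / real (Suc n)" for n
  have h: "0 < h n" "h \<longlonglongrightarrow> 0" for n using c mesh_tendsto_0 by (auto simp: h_def[abs_def])
  have h0: "0 \<le> h n" for n using h(1)[of n] by simp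
  have hd: "c + h n * real (Suc n) = d" for n by (simp add: h_def)
  note ge = grid_point_ge[OF c(1) h0]
  let ?S = "\<lambda>n \<omega>. \<Sum>i<Suc n. ennreal (Y (c + h n * real i) \<omega>) * QV (c + h n * real i) (c + h n * (real i + 1)) \<omega>"
  have Sm[measurable]: "?S n \<in> borel_measurable M" for n
    by (intro borel_measurable_sum borel_measurable_times_ennreal measurable_compose[OF Y measurable_ennreal] QV ge)
  have QVfin: "(\<integral>\<^sup>+\<omega>. QV c d \<omega> \<partial>M) < \<infinity>"
    using nn_integral_past_mult_QV[OF c(1) less_imp_le[OF c(2)], of "\<lambda>_. 1"] by (simp add: emeasure_space_1)
  have QVAE: "AE \<omega> in M. QV c d \<omega> \<noteq> \<infinity>"
    using QVfin by (intro nn_integral_PInf_AE QV c) auto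
  have Slim: "(\<lambda>n. \<integral>\<^sup>+\<omega>. ?S n \<omega> \<partial>M) \<longlonglongrightarrow> (\<integral>\<^sup>+\<omega>. left_jump_sum Y c d \<omega> \<partial>M)"
  proof (rule nn_integral_dominated_convergence[where w="\<lambda>\<omega>. ennreal K * QV c d \<omega>"])
    show "(\<lambda>\<omega>. ennreal K * QV c d \<omega>) \<in> borel_measurable M" using QV[OF c(1)] by simp
    show "(\<integral>\<^sup>+\<omega>. ennreal K * QV c d \<omega> \<partial>M) < \<infinity>"
      using QVfin QV[OF c(1)] by (simp add: nn_integral_cmult ennreal_mult_less_top)
    show "AE \<omega> in M. ?S n \<omega> \<le> ennreal K * QV c d \<omega>" for n
    proof (rule AE_I2)
      fix \<omega> assume \<omega>: "\<omega> \<in> space M"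
      have "?S n \<omega> \<le> (\<Sum>i<Suc n. ennreal K * QV (c + h n * real i) (c + h n * (real i + 1)) \<omega>)"
        using K[OF ge \<omega>] by (intro sum_mono mult_right_mono ennreal_leI) auto
      also have "\<dots> = ennreal K * QV c d \<omega>"
        using nn_integral_cell_split[OF h(1)[of n], of "\<lambda>s. ennreal ((jump (\<lambda>t. L t \<omega>) s)\<^sup>2)" "count_space UNIV" c "\<lambda>_. ennreal K" "Suc n"]
        unfolding hd QV_def jump_sum_def by (simp add: mult.assoc nn_integral_cmult del: sum.lessThan_Suc)
      finally show "?S n \<omega> \<le> ennreal K * QV c d \<omega>" .
    qed
    show "AE \<omega> in M. (\<lambda>n. ?S n \<omega>) \<longlonglongrightarrow> left_jump_sum Y c d \<omega>"
      using QVAE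
    proof (rule AE_mp, intro AE_I2 impI)
      fix \<omega> assume \<omega>: "\<omega> \<in> space M" "QV c d \<omega> \<noteq> \<infinity>"
      then show "(\<lambda>n. ?S n \<omega>) \<longlonglongrightarrow> left_jump_sum Y c d \<omega>"
        using left_sum_tendsto[OF cadlag_mono[OF cad[OF \<omega>(1)] c(1)] c(2), of "\<lambda>s. ennreal ((jump (\<lambda>t. L t \<omega>) s)\<^sup>2)"]
        unfolding left_jump_sum_def QV_def jump_sum_def h_def by (simp add: less_top)
    qed
  qed (rule Sm, rule left_jump_sum)
  have S: "(\<integral>\<^sup>+\<omega>. ?S n \<omega> \<partial>M) = ennreal jump_rate * (\<integral>\<^sup>+t. ennreal (y (c + h n * real (cell c (h n) t))) * indicator {c<..d} t \<partial>lborel)" for n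
  proof -
    have "(\<integral>\<^sup>+\<omega>. ?S n \<omega> \<partial>M) = (\<Sum>i<Suc n. \<integral>\<^sup>+\<omega>. ennreal (Y (c + h n * real i) \<omega>) * QV (c + h n * real i) (c + h n * (real i + 1)) \<omega> \<partial>M)"
      by (intro nn_integral_sum borel_measurable_times_ennreal measurable_compose[OF Y measurable_ennreal] QV ge)
    also have "\<dots> = (\<Sum>i<Suc n. ennreal jump_rate * (ennreal (y (c + h n * real i)) * ennreal (h n)))"
    proof (rule sum.cong[OF refl])
      fix i
      have "c + h n * real i \<le> c + h n * (real i + 1)" "c + h n * (real i + 1) - (c + h n * real i) = h n" using h0[of n] by (auto simp: algebra_simps)
      then show "(\<integral>\<^sup>+\<omega>. ennreal (Y (c + h n * real i) \<omega>) * QV (c + h n * real i) (c + h n * (real i + 1)) \<omega> \<partial>M)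
        = ennreal jump_rate * (ennreal (y (c + h n * real i)) * ennreal (h n))"
        using nn_integral_past_mult_QV[OF ge, of n i "c + h n * (real i + 1)" "\<lambda>\<omega>. ennreal (Y (c + h n * real i) \<omega>)"]
          measurable_compose[OF adapted_measurable_Fm[OF ad ge] measurable_ennreal, of n i] y[OF ge, of n i]
        by (simp add: ennreal_mult' jump_rate_nonneg mult_ac)
    qed
    also have "\<dots> = ennreal jump_rate * (\<Sum>i<Suc n. ennreal (y (c + h n * real i)) * ennreal (h n))"
      by (rule sum_distrib_left[symmetric])
    also have "(\<Sum>i<Suc n. ennreal (y (c + h n * real i)) * ennreal (h n))
      = (\<integral>\<^sup>+t. ennreal (y (c + h n * real (cell c (h n) t))) * 1 * indicator {c<..d} t \<partial>lborel)"
    proof -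
      have "(\<integral>\<^sup>+t. 1 * indicator {c + h n * real i<..c + h n * (real i + 1)} t \<partial>lborel) = ennreal (h n)" for i
        using h0[of n] by (simp add: algebra_simps)
      then show ?thesis
        using nn_integral_cell_split[OF h(1)[of n], of "\<lambda>_. 1" lborel c "\<lambda>i. ennreal (y (c + h n * real i))" "Suc n"]
        unfolding hd by (simp del: sum.lessThan_Suc)
    qed
    finally show ?thesis by simp
  qed
  have ym: "(\<lambda>t. y (max c t)) \<in> borel_measurable borel"
    using cadlag_right_tendsto[OF ycad] c by (intro right_continuous_borel) auto
  have "(\<lambda>n. \<integral>\<^sup>+t. ennreal (y (c + h n * real (cell c (h n) t))) * indicator {c<..d} t \<partial>lborel)
    \<longlonglongrightarrow> (\<integral>\<^sup>+t. ennreal (y (max c t)) * indicator {c<..d} t \<partial>lborel)"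
  proof (rule nn_integral_dominated_convergence[where w="\<lambda>t. ennreal K' * indicator {c<..d} t"])
    have "(\<lambda>t. y (c + h n * real (nat (\<lceil>(t - c) / h n\<rceil> - 1)))) \<in> borel_measurable borel" for n
      by (rule measurable_compose_countable[where f="\<lambda>i t. y (c + h n * real (nat (i - 1)))" and g="\<lambda>t. \<lceil>(t - c) / h n\<rceil>"]) auto
    then show "(\<lambda>t. ennreal (y (c + h n * real (cell c (h n) t))) * indicator {c<..d} t) \<in> borel_measurable lborel" for n
      by (simp add: cell_def)
    show "(\<lambda>t. ennreal (y (max c t)) * indicator {c<..d} t) \<in> borel_measurable lborel" using ym by simp
    show "(\<integral>\<^sup>+t. ennreal K' * indicator {c<..d} t \<partial>lborel) < \<infinity>"
      using c by (simp add: nn_integral_cmult_indicator ennreal_mult_less_top)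
    show "AE t in lborel. ennreal (y (c + h n * real (cell c (h n) t))) * indicator {c<..d} t \<le> ennreal K' * indicator {c<..d} t" for n
    proof (rule AE_I2)
      fix t
      show "ennreal (y (c + h n * real (cell c (h n) t))) * indicator {c<..d} t \<le> ennreal K' * indicator {c<..d} t"
      proof (cases "t \<in> {c<..d}")
        case True
        then have "c + h n * real (cell c (h n) t) \<in> {a..d}"
          using cell_bounds(1)[OF h(1)[of n], of c t] ge[of n] by auto
        then have "y (c + h n * real (cell c (h n) t)) \<le> K'" using bspec[OF K'] by (fastforce dest: abs_le_D1)
        then show ?thesis using True by (auto intro!: ennreal_leI)
      qed simp
    qed
    \<comment> \<open>The Riemann sums of \<open>y\<close> produce its left limits, which differ
      from its values at countably many times only.\<close>
    have "AE t in lborel. t \<notin> {s. a < s \<and> jump y s \<noteq> 0}"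
      using countable_imp_null_set_lborel[OF cadlag_countable_jumps[OF ycad]] by (rule AE_not_in)
    then show "AE t in lborel. (\<lambda>n. ennreal (y (c + h n * real (cell c (h n) t))) * indicator {c<..d} t)
      \<longlonglongrightarrow> ennreal (y (max c t)) * indicator {c<..d} t"
    proof (rule AE_mp, intro AE_I2 impI)
      fix t assume t: "t \<notin> {s. a < s \<and> jump y s \<noteq> 0}"
      show "(\<lambda>n. ennreal (y (c + h n * real (cell c (h n) t))) * indicator {c<..d} t)
        \<longlonglongrightarrow> ennreal (y (max c t)) * indicator {c<..d} t"
      proof (cases "t \<in> {c<..d}")
        case True
        then have "left_lim y t = y t" using t c by (auto simp: jump_def)
        then have "(\<lambda>n. y (c + h n * real (cell c (h n) t))) \<longlonglongrightarrow> y t"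
          using cadlag_cell_left_tendsto[OF ycad h c(1), of t] True by simp
        then show ?thesis using True by (auto intro: tendsto_ennrealI)
      qed simp
    qed
  qed auto
  also have "(\<integral>\<^sup>+t. ennreal (y (max c t)) * indicator {c<..d} t \<partial>lborel)
      = (\<integral>\<^sup>+t. (\<integral>\<^sup>+\<omega>. ennreal (Y t \<omega>) \<partial>M) * indicator {c<..d} t \<partial>lborel)"
    using c by (intro nn_integral_cong) (auto simp: indicator_def y max_def)
  finally have "(\<lambda>n. \<integral>\<^sup>+\<omega>. ?S n \<omega> \<partial>M) \<longlonglongrightarrow> ennreal jump_rate * (\<integral>\<^sup>+t. (\<integral>\<^sup>+\<omega>. ennreal (Y t \<omega>) \<partial>M) * indicator {c<..d} t \<partial>lborel)"
    unfolding S by (intro ennreal_tendsto_cmult) auto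
  with Slim show ?thesis by (rule LIMSEQ_unique)
qed

end

section \<open>Fubini for processes, and compensation without boundedness\<close>

text \<open>Formulated over a sigma-finite space so that both the probability and Lebesgue measure
  can take the place of \<open>M\<close>. Joint measurability is asked of the process frozen before
  \<open>c\<close>, the form in which right continuity delivers it.\<close>

lemma (in sigma_finite_measure) fubini_process:
  fixes Z :: "real \<Rightarrow> 'a \<Rightarrow> real" and g :: "real \<Rightarrow> real"
  assumes J[measurable]: "(\<lambda>(t, \<omega>). Z (max c t) \<omega>) \<in> borel_measurable (borel \<Otimes>\<^sub>M M)"
    and C: "\<And>t. t \<in> {c..d} \<Longrightarrow> (\<integral>\<^sup>+\<omega>. ennreal \<bar>Z t \<omega>\<bar> \<partial>M) \<le> ennreal C"
    and g[measurable]: "g \<in> borel_measurable borel" and B: "\<And>t. \<bar>g t\<bar> \<le> B"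
  shows "integrable M (\<lambda>\<omega>. LINT t:{c..d}|lborel. Z t \<omega> * g t)"
    and "AE \<omega> in M. set_integrable lborel {c..d} (\<lambda>t. Z t \<omega> * g t)"
    and "(\<lambda>t. integral\<^sup>L M (Z t) * g t) integrable_on {c..d}"
    and "integral\<^sup>L M (\<lambda>\<omega>. LINT t:{c..d}|lborel. Z t \<omega> * g t) = integral {c..d} (\<lambda>t. integral\<^sup>L M (Z t) * g t)"
proof -
  interpret P: pair_sigma_finite lborel M ..
  define f where "f t \<omega> = indicator {c..d} t *\<^sub>R (Z (max c t) \<omega> * g t)" for t \<omega>
  have J'[measurable]: "(\<lambda>(t, \<omega>). Z (max c t) \<omega>) \<in> borel_measurable (lborel \<Otimes>\<^sub>M M)" using J by simp
  have [measurable]: "case_prod f \<in> borel_measurable (lborel \<Otimes>\<^sub>M M)"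
  proof -
    have "(\<lambda>p. indicator {c..d} (fst p) *\<^sub>R ((\<lambda>(t, \<omega>). Z (max c t) \<omega>) p * g (fst p))) \<in> borel_measurable (lborel \<Otimes>\<^sub>M M)"
      by measurable
    then show ?thesis by (simp add: f_def case_prod_beta')
  qed
  have f_eq: "f t \<omega> = indicator {c..d} t *\<^sub>R (Z t \<omega> * g t)" for t \<omega>
    by (auto simp: f_def indicator_def max_def)
  have B0: "0 \<le> B" using B[of 0] by simp
  have int: "integrable (lborel \<Otimes>\<^sub>M M) (case_prod f)"
  proof (rule integrableI_bounded)
    have "(\<integral>\<^sup>+p. ennreal (norm (case_prod f p)) \<partial>(lborel \<Otimes>\<^sub>M M)) = (\<integral>\<^sup>+t. \<integral>\<^sup>+\<omega>. ennreal (norm (f t \<omega>)) \<partial>M \<partial>lborel)"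
      by (subst nn_integral_fst[symmetric]) auto
    also have "\<dots> \<le> (\<integral>\<^sup>+t. ennreal C * ennreal B * indicator {c..d} t \<partial>lborel)"
    proof (rule nn_integral_mono)
      fix t
      show "(\<integral>\<^sup>+\<omega>. ennreal (norm (f t \<omega>)) \<partial>M) \<le> ennreal C * ennreal B * indicator {c..d} t"
      proof (cases "t \<in> {c..d}")
        case True
        have [measurable]: "Z t \<in> borel_measurable M"
        proof -
          have "(\<lambda>\<omega>. (\<lambda>(t, \<omega>). Z (max c t) \<omega>) (t, \<omega>)) \<in> borel_measurable M"
            by (rule measurable_compose[OF measurable_Pair1' J]) auto
          then show ?thesis using True by (simp add: max_def split: if_splits)
        qed
        have "(\<integral>\<^sup>+\<omega>. ennreal (norm (f t \<omega>)) \<partial>M) \<le> (\<integral>\<^sup>+\<omega>. ennreal \<bar>Z t \<omega>\<bar> * ennreal B \<partial>M)"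
          using True B by (intro nn_integral_mono) (auto simp: f_eq abs_mult ennreal_mult intro!: mult_left_mono ennreal_leI)
        also have "\<dots> = (\<integral>\<^sup>+\<omega>. ennreal \<bar>Z t \<omega>\<bar> \<partial>M) * ennreal B"
          by (rule nn_integral_multc) measurable
        also have "\<dots> \<le> ennreal C * ennreal B" using C[OF True] by (rule mult_right_mono) simp
        finally show ?thesis using True by simp
      qed (simp add: f_eq)
    qed
    also have "\<dots> < \<infinity>"
      by (simp add: nn_integral_cmult_indicator ennreal_mult_less_top emeasure_lborel_Icc_eq)
    finally show "(\<integral>\<^sup>+p. ennreal (norm (case_prod f p)) \<partial>(lborel \<Otimes>\<^sub>M M)) < \<infinity>" .
  qed simp
  have fst: "(\<integral>\<omega>. f t \<omega> \<partial>M) = indicator {c..d} t *\<^sub>R (integral\<^sup>L M (Z t) * g t)" for t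
    by (simp add: f_eq)
  have e: "(LINT t:{c..d}|lborel. Z t \<omega> * g t) = (\<integral>t. f t \<omega> \<partial>lborel)" for \<omega>
    by (simp add: set_lebesgue_integral_def f_eq)
  show "integrable M (\<lambda>\<omega>. LINT t:{c..d}|lborel. Z t \<omega> * g t)"
    unfolding e by (rule P.integrable_snd[OF int])
  show "AE \<omega> in M. set_integrable lborel {c..d} (\<lambda>t. Z t \<omega> * g t)"
    using P.AE_integrable_snd[OF int] by (simp add: set_integrable_def f_eq)
  have s: "set_integrable lborel {c..d} (\<lambda>t. integral\<^sup>L M (Z t) * g t)"
    using P.integrable_fst[OF int] by (simp add: set_integrable_def fst)
  show "(\<lambda>t. integral\<^sup>L M (Z t) * g t) integrable_on {c..d}"
    by (rule set_borel_integral_eq_integral(1)[OF s])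
  have "integral\<^sup>L M (\<lambda>\<omega>. LINT t:{c..d}|lborel. Z t \<omega> * g t) = (\<integral>t. \<integral>\<omega>. f t \<omega> \<partial>M \<partial>lborel)"
    unfolding e by (rule P.Fubini_integral[OF int])
  also have "\<dots> = (LINT t:{c..d}|lborel. integral\<^sup>L M (Z t) * g t)"
    by (simp add: fst set_lebesgue_integral_def)
  also have "\<dots> = integral {c..d} (\<lambda>t. integral\<^sup>L M (Z t) * g t)"
    by (rule set_borel_integral_eq_integral(2)[OF s])
  finally show "integral\<^sup>L M (\<lambda>\<omega>. LINT t:{c..d}|lborel. Z t \<omega> * g t) = integral {c..d} (\<lambda>t. integral\<^sup>L M (Z t) * g t)" .
qed

lemma SUP_ennreal_clip: "(SUP n. ennreal (max 0 (min (real n) l))) = ennreal l"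
proof (rule antisym)
  show "(SUP n. ennreal (max 0 (min (real n) l))) \<le> ennreal l"
    by (intro SUP_least) (auto simp: ennreal_le_iff2 max_def min_def intro!: ennreal_leI)
  obtain n where n: "l \<le> real n" using real_arch_simple by blast
  then have "ennreal l \<le> ennreal (max 0 (min (real n) l))" by (intro ennreal_leI) auto
  also have "\<dots> \<le> (SUP n. ennreal (max 0 (min (real n) l)))" by (rule SUP_upper) simp
  finally show "ennreal l \<le> (SUP n. ennreal (max 0 (min (real n) l)))" .
qed

lemma adapted_compose:
  fixes g :: "real \<Rightarrow> real"
  assumes X: "adapted_on M I F X" and g: "g \<in> borel_measurable borel"
  shows "adapted_on M I F (\<lambda>t \<omega>. g (X t \<omega>))"
  unfolding adapted_on_def
proof (intro ballI)
  fix t and B :: "real set" assume "t \<in> I" "B \<in> sets borel"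
  moreover from this have "g -` B \<in> sets borel" using measurable_sets[OF g, of B] by simp
  ultimately have "{\<omega>\<in>space M. X t \<omega> \<in> g -` B} \<in> F t" using X unfolding adapted_on_def by blast
  then show "{\<omega>\<in>space M. g (X t \<omega>) \<in> B} \<in> F t" by simp
qed

lemma cadlag_set_integrable:
  assumes x: "cadlag_from a x" and c: "a \<le> c"
  shows "set_integrable lborel {c..d} x"
proof -
  obtain K where K: "\<forall>s\<in>{a..d}. \<bar>x s\<bar> \<le> K" using cadlag_bounded[OF x] by blast
  have [measurable]: "(\<lambda>t. x (max a t)) \<in> borel_measurable borel"
    by (rule right_continuous_borel) (rule cadlag_right_tendsto[OF x])
  have "integrable lborel (\<lambda>t. indicator {c..d} t *\<^sub>R x (max a t))"
  proof (rule integrableI_bounded_set_indicator[where B=K])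
    show "AE t in lborel. t \<in> {c..d} \<longrightarrow> norm (x (max a t)) \<le> K"
      using K c by (intro AE_I2) (auto simp: max_def)
  qed (auto simp: emeasure_lborel_Icc_eq)
  moreover have "(\<lambda>t. indicator {c..d} t *\<^sub>R x (max a t)) = (\<lambda>t. indicator {c..d} t *\<^sub>R x t)"
    using c by (auto simp: fun_eq_iff indicator_def max_def)
  ultimately show ?thesis unfolding set_integrable_def by simp
qed

text \<open>\<open>infsum\<close> is \<open>0\<close> by default on families that are not summable,
  so both signed parts must be finite before the sum can be read as a Bochner integral over counting
  measure and split.\<close>

lemma dS_integral_eq:
  assumes P: "(\<integral>\<^sup>+s. ennreal (left_lim x s) * ennreal ((jump l s)\<^sup>2) * indicator {c<..d} s \<partial>count_space UNIV) < \<infinity>"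
    and N: "(\<integral>\<^sup>+s. ennreal (- left_lim x s) * ennreal ((jump l s)\<^sup>2) * indicator {c<..d} s \<partial>count_space UNIV) < \<infinity>"
  shows "dS_integral x l c d
    = enn2real (\<integral>\<^sup>+s. ennreal (left_lim x s) * ennreal ((jump l s)\<^sup>2) * indicator {c<..d} s \<partial>count_space UNIV)
    - enn2real (\<integral>\<^sup>+s. ennreal (- left_lim x s) * ennreal ((jump l s)\<^sup>2) * indicator {c<..d} s \<partial>count_space UNIV)"
proof -
  let ?f = "\<lambda>s. left_lim x s * (jump l s)\<^sup>2"
  have m: "ennreal (z * w\<^sup>2) = ennreal z * ennreal (w\<^sup>2)" for z w :: real
    by (cases "0 \<le> z") (auto simp: ennreal_mult ennreal_neg mult_nonpos_nonneg)
  have p: "(\<integral>\<^sup>+s. ennreal (?f s) \<partial>count_space {c<..d}) = (\<integral>\<^sup>+s. ennreal (left_lim x s) * ennreal ((jump l s)\<^sup>2) * indicator {c<..d} s \<partial>count_space UNIV)"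
    by (simp add: nn_integral_count_space_indicator m)
  have n: "(\<integral>\<^sup>+s. ennreal (- ?f s) \<partial>count_space {c<..d}) = (\<integral>\<^sup>+s. ennreal (- left_lim x s) * ennreal ((jump l s)\<^sup>2) * indicator {c<..d} s \<partial>count_space UNIV)"
    using m[of "- left_lim x s" "jump l s" for s] by (simp add: nn_integral_count_space_indicator)
  have i: "integrable (count_space {c<..d}) ?f"
    unfolding real_integrable_def p n using P N by auto
  then have "dS_integral x l c d = integral\<^sup>L (count_space {c<..d}) ?f"
    unfolding dS_integral_def using infsetsum_infsum[of ?f "{c<..d}"] by (simp add: abs_summable_on_def infsetsum_def)
  then show ?thesis unfolding real_lebesgue_integral_def[OF i] p n .
qed

context levy_setting begin

text \<open>Clipping to \<open>[0, n]\<close> is continuous, so it keeps adaptedness and cadlag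
  paths and commutes with left limits; monotone convergence then removes the bound. Only the
  positive part of \<open>X\<close> is concerned.\<close>

lemma compensation:
  assumes c: "a \<le> c" "c < d"
    and ad: "adapted_on M {a..} F X"
    and cad: "\<And>\<omega>. \<omega> \<in> space M \<Longrightarrow> cadlag_from a (\<lambda>t. X t \<omega>)"
  shows "(\<integral>\<^sup>+\<omega>. left_jump_sum X c d \<omega> \<partial>M) = ennreal jump_rate * (\<integral>\<^sup>+t. (\<integral>\<^sup>+\<omega>. ennreal (X t \<omega>) \<partial>M) * indicator {c<..d} t \<partial>lborel)"
proof -
  define Y where "Y n t \<omega> = max 0 (min (real n) (X t \<omega>))" for n t \<omega>
  have gc: "continuous_on UNIV (\<lambda>z. max 0 (min (real n) z))" for n by (intro continuous_intros)
  have Yad: "adapted_on M {a..} F (Y n)" for n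
    unfolding Y_def[abs_def] by (rule adapted_compose[OF ad borel_measurable_continuous_onI[OF gc]])
  have Ycad: "cadlag_from a (\<lambda>t. Y n t \<omega>)" if "\<omega> \<in> space M" for n \<omega>
    unfolding Y_def by (rule cadlag_compose(1)[OF cad[OF that] gc])
  have Yl: "left_lim (\<lambda>t. Y n t \<omega>) s = max 0 (min (real n) (left_lim (\<lambda>t. X t \<omega>) s))" if "\<omega> \<in> space M" "a < s" for n s \<omega>
    unfolding Y_def by (rule cadlag_compose(2)[OF cad[OF that(1)] gc that(2)])
  have inc: "ennreal (max 0 (min (real n) z)) \<le> ennreal (max 0 (min (real n') z))" if "n \<le> n'" for n n' z
    using that by (intro ennreal_leI) auto
  have inc': "ennreal (min (real n) z) \<le> ennreal (min (real n') z)" if "n \<le> n'" for n n' z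
    using that by (intro ennreal_leI) auto
  have LSY: "left_jump_sum (Y n) c d \<omega> = (\<integral>\<^sup>+s. ennreal (max 0 (min (real n) (left_lim (\<lambda>t. X t \<omega>) s))) * ennreal ((jump (\<lambda>t. L t \<omega>) s)\<^sup>2) * indicator {c<..d} s \<partial>count_space UNIV)"
    if "\<omega> \<in> space M" for n \<omega>
    unfolding left_jump_sum_def using c Yl[OF that] by (intro nn_integral_cong) (auto simp: indicator_def)
  have LSX: "left_jump_sum X c d \<omega> = (SUP n. left_jump_sum (Y n) c d \<omega>)" if "\<omega> \<in> space M" for \<omega>
  proof -
    have "left_jump_sum X c d \<omega> = (\<integral>\<^sup>+s. (SUP n. ennreal (max 0 (min (real n) (left_lim (\<lambda>t. X t \<omega>) s))) * ennreal ((jump (\<lambda>t. L t \<omega>) s)\<^sup>2) * indicator {c<..d} s) \<partial>count_space UNIV)"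
      unfolding left_jump_sum_def SUP_mult_right_ennreal[symmetric] SUP_ennreal_clip ..
    also have "\<dots> = (SUP n. left_jump_sum (Y n) c d \<omega>)"
      unfolding LSY[OF that]
      by (rule nn_integral_monotone_convergence_SUP) (auto simp: incseq_def le_fun_def intro!: mult_right_mono inc')
    finally show ?thesis .
  qed
  have Ym: "Y n t \<in> borel_measurable M" if "a \<le> t" for n t by (rule adapted_measurable[OF Yad that])
  have [measurable]: "(\<lambda>(t, \<omega>). Y n (max c t) \<omega>) \<in> borel_measurable (borel \<Otimes>\<^sub>M M)" for n
    using c by (intro right_continuous_joint_measurable Ym cadlag_right_tendsto[OF Ycad]) auto
  have b: "(\<integral>\<^sup>+\<omega>. left_jump_sum (Y n) c d \<omega> \<partial>M) = ennreal jump_rate * (\<integral>\<^sup>+t. (\<integral>\<^sup>+\<omega>. ennreal (Y n t \<omega>) \<partial>M) * indicator {c<..d} t \<partial>lborel)" for n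
    by (rule compensation_bounded[OF c Yad Ycad, where K="real n"]) (auto simp: Y_def)
  have "(\<integral>\<^sup>+\<omega>. left_jump_sum X c d \<omega> \<partial>M) = (\<integral>\<^sup>+\<omega>. (SUP n. left_jump_sum (Y n) c d \<omega>) \<partial>M)"
    by (intro nn_integral_cong LSX)
  also have "\<dots> = (SUP n. \<integral>\<^sup>+\<omega>. left_jump_sum (Y n) c d \<omega> \<partial>M)"
  proof (rule nn_integral_monotone_convergence_SUP_AE)
    show "AE \<omega> in M. left_jump_sum (Y n) c d \<omega> \<le> left_jump_sum (Y (Suc n)) c d \<omega>" for n
      by (rule AE_I2) (auto simp: LSY intro!: nn_integral_mono mult_right_mono ennreal_leI)
    show "left_jump_sum (Y n) c d \<in> borel_measurable M" for n by (rule left_jump_sum_measurable[OF c Ym Ycad])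
  qed
  also have "\<dots> = (SUP n. ennreal jump_rate * (\<integral>\<^sup>+t. (\<integral>\<^sup>+\<omega>. ennreal (Y n t \<omega>) \<partial>M) * indicator {c<..d} t \<partial>lborel))"
    unfolding b ..
  also have "\<dots> = ennreal jump_rate * (SUP n. \<integral>\<^sup>+t. (\<integral>\<^sup>+\<omega>. ennreal (Y n t \<omega>) \<partial>M) * indicator {c<..d} t \<partial>lborel)"
    by (rule SUP_mult_left_ennreal[symmetric])
  also have "(SUP n. \<integral>\<^sup>+t. (\<integral>\<^sup>+\<omega>. ennreal (Y n t \<omega>) \<partial>M) * indicator {c<..d} t \<partial>lborel)
    = (SUP n. \<integral>\<^sup>+t. (\<integral>\<^sup>+\<omega>. ennreal (Y n (max c t) \<omega>) \<partial>M) * indicator {c<..d} t \<partial>lborel)"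
    by (intro SUP_cong nn_integral_cong) (auto simp: indicator_def max_def)
  also have "\<dots> = (\<integral>\<^sup>+t. (SUP n. (\<integral>\<^sup>+\<omega>. ennreal (Y n (max c t) \<omega>) \<partial>M) * indicator {c<..d} t) \<partial>lborel)"
  proof (rule nn_integral_monotone_convergence_SUP[symmetric])
    show "incseq (\<lambda>n t. (\<integral>\<^sup>+\<omega>. ennreal (Y n (max c t) \<omega>) \<partial>M) * indicator {c<..d} t)"
      unfolding incseq_def le_fun_def Y_def by (intro allI impI mult_right_mono nn_integral_mono inc) auto
    have m: "(\<lambda>(t, \<omega>). ennreal (Y n (max c t) \<omega>)) \<in> borel_measurable (lborel \<Otimes>\<^sub>M M)" for n by measurable
    show "(\<lambda>t. (\<integral>\<^sup>+\<omega>. ennreal (Y n (max c t) \<omega>) \<partial>M) * indicator {c<..d} t) \<in> borel_measurable lborel" for n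
      using borel_measurable_nn_integral[OF m] by simp
  qed
  also have "\<dots> = (\<integral>\<^sup>+t. (\<integral>\<^sup>+\<omega>. ennreal (X t \<omega>) \<partial>M) * indicator {c<..d} t \<partial>lborel)"
  proof (intro nn_integral_cong)
    fix t
    show "(SUP n. (\<integral>\<^sup>+\<omega>. ennreal (Y n (max c t) \<omega>) \<partial>M) * indicator {c<..d} t) = (\<integral>\<^sup>+\<omega>. ennreal (X t \<omega>) \<partial>M) * indicator {c<..d} t"
    proof (cases "t \<in> {c<..d}")
      case True
      then have t: "max c t = t" "a \<le> t" using c by auto
      have "(\<integral>\<^sup>+\<omega>. ennreal (X t \<omega>) \<partial>M) = (\<integral>\<^sup>+\<omega>. (SUP n. ennreal (Y n t \<omega>)) \<partial>M)"
        unfolding Y_def SUP_ennreal_clip ..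
      also have "\<dots> = (SUP n. \<integral>\<^sup>+\<omega>. ennreal (Y n t \<omega>) \<partial>M)"
        by (rule nn_integral_monotone_convergence_SUP)
          (use adapted_measurable[OF ad t(2)] in \<open>auto simp: incseq_def le_fun_def Y_def intro!: inc'\<close>)
      finally show ?thesis using True t by simp
    qed simp
  qed
  finally show ?thesis .
qed

lemma left_jump_sum_split: "a \<le> c \<Longrightarrow> c \<le> d \<Longrightarrow> left_jump_sum X a d \<omega> = left_jump_sum X a c \<omega> + left_jump_sum X c d \<omega>"
  unfolding left_jump_sum_def by (subst nn_integral_add[symmetric]) (auto simp: indicator_def intro!: nn_integral_cong)

lemma left_jump_sum_right_continuous:
  assumes t: "a \<le> t" "t < T" and fin: "left_jump_sum X a T \<omega> < \<infinity>"
  shows "((\<lambda>u. enn2real (left_jump_sum X a u \<omega>)) \<longlongrightarrow> enn2real (left_jump_sum X a t \<omega>)) (at_right t)"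
proof (rule tendsto_at_right_sequentially[of _ T])
  fix S assume S: "\<And>n. t < S n" "\<And>n. S n < T" "S \<longlonglongrightarrow> t"
  let ?w = "\<lambda>s. ennreal (left_lim (\<lambda>t. X t \<omega>) s) * ennreal ((jump (\<lambda>t. L t \<omega>) s)\<^sup>2)"
  have "(\<lambda>n. left_jump_sum X a (S n) \<omega>) \<longlonglongrightarrow> left_jump_sum X a t \<omega>"
    unfolding left_jump_sum_def
  proof (rule nn_integral_dominated_convergence[where w="\<lambda>s. ?w s * indicator {a<..T} s"])
    show "AE s in count_space UNIV. ?w s * indicator {a<..S n} s \<le> ?w s * indicator {a<..T} s" for n
      using S(2)[of n] by (intro AE_I2) (auto simp: indicator_def)
    show "(\<integral>\<^sup>+s. ?w s * indicator {a<..T} s \<partial>count_space UNIV) < \<infinity>" using fin by (simp add: left_jump_sum_def)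
    show "AE s in count_space UNIV. (\<lambda>n. ?w s * indicator {a<..S n} s) \<longlonglongrightarrow> ?w s * indicator {a<..t} s"
    proof (rule AE_I2)
      fix s
      have "\<forall>\<^sub>F n in sequentially. indicator {a<..S n} s = (indicator {a<..t} s :: ennreal)"
      proof (cases "s \<le> t")
        case True then show ?thesis using S(1) by (auto simp: indicator_def less_imp_le intro!: always_eventually elim: order_trans)
      next
        case False
        then have "\<forall>\<^sub>F n in sequentially. S n < s" using order_tendstoD(2)[OF S(3)] by auto
        then show ?thesis by eventually_elim (use False in \<open>auto simp: indicator_def\<close>)
      qed
      then show "(\<lambda>n. ?w s * indicator {a<..S n} s) \<longlonglongrightarrow> ?w s * indicator {a<..t} s"
        by (intro tendsto_eventually) (auto elim: eventually_mono)
    qed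
  qed auto
  moreover have "left_jump_sum X a t \<omega> < \<infinity>" using left_jump_sum_split[of t T X \<omega>] fin t by (simp add: less_top[symmetric])
  ultimately show "(\<lambda>n. enn2real (left_jump_sum X a (S n) \<omega>)) \<longlonglongrightarrow> enn2real (left_jump_sum X a t \<omega>)"
    by (intro tendsto_enn2real) auto
qed (use t in auto)

end

section \<open>Expectations of the delay integrals\<close>

context levy_setting begin

text \<open>All jump integrals over windows inside \<open>[a, T]\<close> are increments of one
  process \<open>D\<close>, the running integral from \<open>a\<close>. This frees the exceptional
  set from the window and leaves a right-continuous process bounded in mean, as Fubini over the
  delay requires.\<close>

lemma jump_integral_process:
  assumes ad: "adapted_on M {a..} F X"
    and cad: "\<And>\<omega>. \<omega> \<in> space M \<Longrightarrow> cadlag_from a (\<lambda>t. X t \<omega>)"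
    and T: "a < T" and C: "\<And>t. t \<in> {a..T} \<Longrightarrow> (\<integral>\<^sup>+\<omega>. ennreal \<bar>X t \<omega>\<bar> \<partial>M) \<le> ennreal C"
  obtains D C' where
    "\<And>t. a \<le> t \<Longrightarrow> D t \<in> borel_measurable M"
    "\<And>\<omega> t. \<omega> \<in> space M \<Longrightarrow> a \<le> t \<Longrightarrow> ((\<lambda>u. D u \<omega>) \<longlongrightarrow> D t \<omega>) (at_right t)"
    "\<And>t. a \<le> t \<Longrightarrow> (\<integral>\<^sup>+\<omega>. ennreal \<bar>D t \<omega>\<bar> \<partial>M) \<le> ennreal C'"
    "\<And>t. t \<in> {a..T} \<Longrightarrow> expectation (D t) = jump_rate * integral {a..t} (\<lambda>s. expectation (X s))"
    "AE \<omega> in M. \<forall>c d. a \<le> c \<longrightarrow> c \<le> d \<longrightarrow> d \<le> T \<longrightarrow>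
      dS_integral (\<lambda>s. X s \<omega>) (\<lambda>s. L s \<omega>) c d = D d \<omega> - D c \<omega>"
proof -
  define Xn where "Xn t \<omega> = - X t \<omega>" for t \<omega>
  have Xm[measurable]: "X t \<in> borel_measurable M" if "a \<le> t" for t by (rule adapted_measurable[OF ad that])
  have un: "continuous_on UNIV (uminus :: real \<Rightarrow> real)" by (intro continuous_intros)
  have adn: "adapted_on M {a..} F Xn"
    unfolding Xn_def[abs_def] by (rule adapted_compose[OF ad borel_measurable_continuous_onI[OF un]])
  have cadn: "cadlag_from a (\<lambda>t. Xn t \<omega>)" and lln: "\<And>s. a < s \<Longrightarrow> left_lim (\<lambda>t. Xn t \<omega>) s = - left_lim (\<lambda>t. X t \<omega>) s"
    if "\<omega> \<in> space M" for \<omega>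
    unfolding Xn_def using cadlag_compose[OF cad[OF that] un] by auto
  \<comment> \<open>Used for \<open>X\<close> and for its negative \<open>Xn\<close>, which
    \<open>ennreal\<close> clips to the positive and the negative part.\<close>
  have key: "left_jump_sum Y a t \<in> borel_measurable M \<and> (\<integral>\<^sup>+\<omega>. left_jump_sum Y a t \<omega> \<partial>M) < \<infinity> \<and>
      set_integrable lborel {a..t} (\<lambda>s. enn2real (\<integral>\<^sup>+\<omega>. ennreal (Y s \<omega>) \<partial>M)) \<and>
      enn2real (\<integral>\<^sup>+\<omega>. left_jump_sum Y a t \<omega> \<partial>M) = jump_rate * (LINT s:{a..t}|lborel. enn2real (\<integral>\<^sup>+\<omega>. ennreal (Y s \<omega>) \<partial>M))"
    if t: "t \<in> {a..T}" and adY: "adapted_on M {a..} F Y" and cadY: "\<And>\<omega>. \<omega> \<in> space M \<Longrightarrow> cadlag_from a (\<lambda>t. Y t \<omega>)"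
      and CY: "\<And>t. t \<in> {a..T} \<Longrightarrow> (\<integral>\<^sup>+\<omega>. ennreal (Y t \<omega>) \<partial>M) \<le> ennreal C" for t Y
  proof -
    have Ym: "Y t \<in> borel_measurable M" if "a \<le> t" for t by (rule adapted_measurable[OF adY that])
    have [measurable]: "(\<lambda>(t, \<omega>). Y (max a t) \<omega>) \<in> borel_measurable (borel \<Otimes>\<^sub>M M)"
      by (intro right_continuous_joint_measurable Ym cadlag_right_tendsto[OF cadY]) auto
    define p where "p s = (\<integral>\<^sup>+\<omega>. ennreal (Y s \<omega>) \<partial>M)" for s
    have m: "(\<lambda>(t, \<omega>). ennreal (Y (max a t) \<omega>)) \<in> borel_measurable (lborel \<Otimes>\<^sub>M M)" by measurable
    have pm[measurable]: "(\<lambda>s. p (max a s)) \<in> borel_measurable borel"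
      unfolding p_def using borel_measurable_nn_integral[OF m] by simp
    have pC: "p s \<le> ennreal C" if "s \<in> {a..T}" for s unfolding p_def by (rule CY[OF that])
    have pfin: "p s < \<infinity>" if "s \<in> {a..T}" for s using pC[OF that] by (rule le_less_trans) simp
    have e: "ennreal (enn2real (p (max a s)) * indicator {a..t} s) = p s * indicator {a..t} s" for s
      using pfin[of s] t by (auto simp: indicator_def max_def)
    have eq: "(\<integral>\<^sup>+s. ennreal (enn2real (p (max a s)) * indicator {a..t} s) \<partial>lborel) = (\<integral>\<^sup>+s. p s * indicator {a<..t} s \<partial>lborel)"
      unfolding e using AE_lborel_singleton[of a]
      by (intro nn_integral_cong_AE) (auto elim!: eventually_mono simp: indicator_def)
    have "(\<integral>\<^sup>+s. p s * indicator {a<..t} s \<partial>lborel) \<le> (\<integral>\<^sup>+s. ennreal C * indicator {a<..t} s \<partial>lborel)"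
      using pC t by (intro nn_integral_mono) (auto simp: indicator_def)
    also have "\<dots> < \<infinity>" using t by (simp add: nn_integral_cmult_indicator ennreal_mult_less_top)
    finally have fin: "(\<integral>\<^sup>+s. p s * indicator {a<..t} s \<partial>lborel) < \<infinity>" .
    have int: "integrable lborel (\<lambda>s. enn2real (p (max a s)) * indicator {a..t} s)"
      using fin by (intro integrableI_nonneg) (auto simp: eq)
    have ind: "(\<lambda>s. enn2real (p (max a s)) * indicator {a..t} s) = (\<lambda>s. indicator {a..t} s *\<^sub>R enn2real (p s))"
      by (auto simp: fun_eq_iff indicator_def max_def)
    have LI: "(LINT s:{a..t}|lborel. enn2real (p s)) = enn2real (\<integral>\<^sup>+s. p s * indicator {a<..t} s \<partial>lborel)"
      unfolding set_lebesgue_integral_def ind[symmetric] eq[symmetric] by (rule integral_eq_nn_integral) auto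
    have SI: "set_integrable lborel {a..t} (\<lambda>s. enn2real (p s))"
      using int unfolding set_integrable_def ind .
    have "left_jump_sum Y a t \<in> borel_measurable M \<and> (\<integral>\<^sup>+\<omega>. left_jump_sum Y a t \<omega> \<partial>M) = ennreal jump_rate * (\<integral>\<^sup>+s. p s * indicator {a<..t} s \<partial>lborel)"
    proof (cases "a < t")
      case True
      then show ?thesis using left_jump_sum_measurable[OF order_refl True Ym cadY] compensation[OF order_refl True adY cadY]
        by (simp add: p_def)
    next
      case False
      then have "t = a" using t by simp
      then have "left_jump_sum Y a t = (\<lambda>_. 0)" by (simp add: left_jump_sum_def fun_eq_iff)
      then show ?thesis using \<open>t = a\<close> by simp
    qed
    then show ?thesis using fin SI unfolding p_def[symmetric] LI
      by (auto simp: ennreal_mult_less_top enn2real_mult jump_rate_nonneg)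
  qed
  have CX: "(\<integral>\<^sup>+\<omega>. ennreal (X t \<omega>) \<partial>M) \<le> ennreal C" "(\<integral>\<^sup>+\<omega>. ennreal (Xn t \<omega>) \<partial>M) \<le> ennreal C" if "t \<in> {a..T}" for t
    using C[OF that] by (auto intro!: order_trans[OF nn_integral_mono C[OF that]] ennreal_leI simp: Xn_def)
  note kX = key[OF _ ad cad CX(1)] and kN = key[OF _ adn cadn CX(2)]
  have TT: "T \<in> {a..T}" using T by simp
  note [measurable] = kX[OF TT, THEN conjunct1] kN[OF TT, THEN conjunct1]
  \<comment> \<open>Finiteness up to \<open>T\<close> bounds all earlier sums, so one event of full
    probability serves every window at once.\<close>
  define Good where "Good = {\<omega>\<in>space M. left_jump_sum X a T \<omega> < \<infinity> \<and> left_jump_sum Xn a T \<omega> < \<infinity>}"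
  have [measurable]: "Good \<in> sets M" unfolding Good_def by measurable
  have AEG: "AE \<omega> in M. \<omega> \<in> Good"
  proof -
    have "AE \<omega> in M. left_jump_sum X a T \<omega> \<noteq> \<infinity>"
      by (rule nn_integral_PInf_AE) (use kX[OF TT] in auto)
    moreover have "AE \<omega> in M. left_jump_sum Xn a T \<omega> \<noteq> \<infinity>"
      by (rule nn_integral_PInf_AE) (use kN[OF TT] in auto)
    ultimately show ?thesis using AE_space by eventually_elim (auto simp: Good_def less_top)
  qed
  \<comment> \<open>Stopping at \<open>T\<close> and the value \<open>0\<close> off
    \<open>Good\<close> make \<open>D\<close> right-continuous on every path and keep its mean
    bounded at all later times.\<close>
  define D where "D t \<omega> = (if \<omega> \<in> Good then enn2real (left_jump_sum X a (min t T) \<omega>) - enn2real (left_jump_sum Xn a (min t T) \<omega>) else 0)" for t \<omega>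
  have le: "left_jump_sum X a t \<omega> \<le> left_jump_sum X a T \<omega>" "left_jump_sum Xn a t \<omega> \<le> left_jump_sum Xn a T \<omega>" if "t \<in> {a..T}" for t \<omega>
    using left_jump_sum_split[of t T X \<omega>] left_jump_sum_split[of t T Xn \<omega>] that by auto
  have Gfin: "left_jump_sum X a t \<omega> < \<infinity>" "left_jump_sum Xn a t \<omega> < \<infinity>" if "t \<in> {a..T}" "\<omega> \<in> Good" for t \<omega>
    using le[OF that(1), of \<omega>] that(2) by (auto simp: Good_def intro: le_less_trans)
  show thesis
  proof (rule that[of D "enn2real ((\<integral>\<^sup>+\<omega>. left_jump_sum X a T \<omega> \<partial>M) + (\<integral>\<^sup>+\<omega>. left_jump_sum Xn a T \<omega> \<partial>M))"])
    fix t assume t: "a \<le> t"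
    then have mt: "min t T \<in> {a..T}" using T by auto
    note [measurable] = kX[OF mt, THEN conjunct1] kN[OF mt, THEN conjunct1]
    show "D t \<in> borel_measurable M" unfolding D_def[abs_def] by measurable
    have "(\<integral>\<^sup>+\<omega>. ennreal \<bar>D t \<omega>\<bar> \<partial>M) \<le> (\<integral>\<^sup>+\<omega>. left_jump_sum X a T \<omega> + left_jump_sum Xn a T \<omega> \<partial>M)"
    proof (rule nn_integral_mono)
      fix \<omega>
      show "ennreal \<bar>D t \<omega>\<bar> \<le> left_jump_sum X a T \<omega> + left_jump_sum Xn a T \<omega>"
      proof (cases "\<omega> \<in> Good")
        case True
        then have "ennreal \<bar>D t \<omega>\<bar> \<le> ennreal (enn2real (left_jump_sum X a (min t T) \<omega>) + enn2real (left_jump_sum Xn a (min t T) \<omega>))"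
          by (intro ennreal_leI) (auto simp: D_def abs_le_iff add_increasing add_increasing2)
        also have "\<dots> = left_jump_sum X a (min t T) \<omega> + left_jump_sum Xn a (min t T) \<omega>"
          using Gfin[OF mt True] by (simp add: ennreal_plus)
        also have "\<dots> \<le> left_jump_sum X a T \<omega> + left_jump_sum Xn a T \<omega>" by (intro add_mono le mt)
        finally show ?thesis .
      qed (simp add: D_def)
    qed
    also have "\<dots> = (\<integral>\<^sup>+\<omega>. left_jump_sum X a T \<omega> \<partial>M) + (\<integral>\<^sup>+\<omega>. left_jump_sum Xn a T \<omega> \<partial>M)" by (rule nn_integral_add) measurable
    also have "\<dots> = ennreal (enn2real ((\<integral>\<^sup>+\<omega>. left_jump_sum X a T \<omega> \<partial>M) + (\<integral>\<^sup>+\<omega>. left_jump_sum Xn a T \<omega> \<partial>M)))"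
      using kX[OF TT] kN[OF TT] by simp
    finally show "(\<integral>\<^sup>+\<omega>. ennreal \<bar>D t \<omega>\<bar> \<partial>M) \<le> ennreal (enn2real ((\<integral>\<^sup>+\<omega>. left_jump_sum X a T \<omega> \<partial>M) + (\<integral>\<^sup>+\<omega>. left_jump_sum Xn a T \<omega> \<partial>M)))" .
  next
    fix \<omega> t assume \<omega>: "\<omega> \<in> space M" and t: "a \<le> t"
    show "((\<lambda>u. D u \<omega>) \<longlongrightarrow> D t \<omega>) (at_right t)"
    proof (cases "\<omega> \<in> Good")
      case False then show ?thesis by (simp add: D_def)
    next
      case G: True
      show ?thesis
      proof (cases "t < T")
        case True
        have "((\<lambda>u. enn2real (left_jump_sum X a u \<omega>) - enn2real (left_jump_sum Xn a u \<omega>)) \<longlongrightarrow> enn2real (left_jump_sum X a t \<omega>) - enn2real (left_jump_sum Xn a t \<omega>)) (at_right t)"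
          using G by (intro tendsto_diff left_jump_sum_right_continuous[OF t True]) (auto simp: Good_def)
        moreover have "\<forall>\<^sub>F u in at_right t. enn2real (left_jump_sum X a u \<omega>) - enn2real (left_jump_sum Xn a u \<omega>) = D u \<omega>"
          using True G by (auto simp: eventually_at_right_field D_def intro!: exI[of _ T])
        ultimately show ?thesis using True G by (auto simp: D_def min_def elim: Lim_transform_eventually)
      next
        case False
        have "\<forall>\<^sub>F u in at_right t. D u \<omega> = D t \<omega>"
          using False by (auto simp: eventually_at_right_field D_def min_def intro!: exI[of _ "t+1"])
        then show ?thesis by (rule tendsto_eventually)
      qed
    qed
  next
    fix t assume t: "t \<in> {a..T}"
    note [measurable] = kX[OF t, THEN conjunct1] kN[OF t, THEN conjunct1]
    have i: "integrable M (\<lambda>\<omega>. enn2real (left_jump_sum Y a t \<omega>)) \<and> expectation (\<lambda>\<omega>. enn2real (left_jump_sum Y a t \<omega>)) = enn2real (\<integral>\<^sup>+\<omega>. left_jump_sum Y a t \<omega> \<partial>M)"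
      if [measurable]: "left_jump_sum Y a t \<in> borel_measurable M" and fin: "(\<integral>\<^sup>+\<omega>. left_jump_sum Y a t \<omega> \<partial>M) < \<infinity>" for Y
    proof -
      have "AE \<omega> in M. left_jump_sum Y a t \<omega> \<noteq> \<infinity>" using fin by (intro nn_integral_PInf_AE) auto
      then have e: "(\<integral>\<^sup>+\<omega>. ennreal (enn2real (left_jump_sum Y a t \<omega>)) \<partial>M) = (\<integral>\<^sup>+\<omega>. left_jump_sum Y a t \<omega> \<partial>M)"
        by (intro nn_integral_cong_AE) (auto elim!: eventually_mono simp: less_top)
      show ?thesis
      proof
        show "integrable M (\<lambda>\<omega>. enn2real (left_jump_sum Y a t \<omega>))" using fin e by (intro integrableI_nonneg) auto
        show "expectation (\<lambda>\<omega>. enn2real (left_jump_sum Y a t \<omega>)) = enn2real (\<integral>\<^sup>+\<omega>. left_jump_sum Y a t \<omega> \<partial>M)"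
          by (subst integral_eq_nn_integral) (auto simp: e)
      qed
    qed
    have "expectation (D t) = expectation (\<lambda>\<omega>. enn2real (left_jump_sum X a t \<omega>) - enn2real (left_jump_sum Xn a t \<omega>))"
    proof (rule integral_cong_AE)
      have mt: "min t T = t" using t by simp
      show "D t \<in> borel_measurable M" unfolding D_def[abs_def] mt by measurable
      show "AE \<omega> in M. D t \<omega> = enn2real (left_jump_sum X a t \<omega>) - enn2real (left_jump_sum Xn a t \<omega>)"
        using AEG by eventually_elim (use t in \<open>auto simp: D_def min_def\<close>)
    qed measurable
    also have "\<dots> = enn2real (\<integral>\<^sup>+\<omega>. left_jump_sum X a t \<omega> \<partial>M) - enn2real (\<integral>\<^sup>+\<omega>. left_jump_sum Xn a t \<omega> \<partial>M)"
      using i[of X] i[of Xn] kX[OF t] kN[OF t] by simp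
    also have "\<dots> = jump_rate * ((LINT s:{a..t}|lborel. enn2real (\<integral>\<^sup>+\<omega>. ennreal (X s \<omega>) \<partial>M)) - (LINT s:{a..t}|lborel. enn2real (\<integral>\<^sup>+\<omega>. ennreal (Xn s \<omega>) \<partial>M)))"
      using kX[OF t] kN[OF t] by (simp add: right_diff_distrib)
    also have "(LINT s:{a..t}|lborel. enn2real (\<integral>\<^sup>+\<omega>. ennreal (X s \<omega>) \<partial>M)) - (LINT s:{a..t}|lborel. enn2real (\<integral>\<^sup>+\<omega>. ennreal (Xn s \<omega>) \<partial>M))
      = (LINT s:{a..t}|lborel. enn2real (\<integral>\<^sup>+\<omega>. ennreal (X s \<omega>) \<partial>M) - enn2real (\<integral>\<^sup>+\<omega>. ennreal (Xn s \<omega>) \<partial>M))"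
      using kX[OF t] kN[OF t] by (intro set_integral_diff(2)[symmetric]) auto
    also have "\<dots> = integral {a..t} (\<lambda>s. enn2real (\<integral>\<^sup>+\<omega>. ennreal (X s \<omega>) \<partial>M) - enn2real (\<integral>\<^sup>+\<omega>. ennreal (Xn s \<omega>) \<partial>M))"
      using kX[OF t] kN[OF t] by (intro set_borel_integral_eq_integral(2) set_integral_diff(1)) auto
    also have "\<dots> = integral {a..t} (\<lambda>s. expectation (X s))"
    proof (rule integral_cong)
      fix s assume s: "s \<in> {a..t}"
      then have "(\<integral>\<^sup>+\<omega>. ennreal \<bar>X s \<omega>\<bar> \<partial>M) < \<infinity>" using C[of s] t by (auto intro: le_less_trans)
      then have "integrable M (X s)" using s Xm by (intro integrableI_bounded) auto
      from real_lebesgue_integral_def[OF this]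
      show "enn2real (\<integral>\<^sup>+\<omega>. ennreal (X s \<omega>) \<partial>M) - enn2real (\<integral>\<^sup>+\<omega>. ennreal (Xn s \<omega>) \<partial>M) = expectation (X s)"
        by (simp add: Xn_def)
    qed
    finally show "expectation (D t) = jump_rate * integral {a..t} (\<lambda>s. expectation (X s))" .
  next
    show "AE \<omega> in M. \<forall>c d. a \<le> c \<longrightarrow> c \<le> d \<longrightarrow> d \<le> T \<longrightarrow>
      dS_integral (\<lambda>s. X s \<omega>) (\<lambda>s. L s \<omega>) c d = D d \<omega> - D c \<omega>"
      using AEG
    proof (rule AE_mp, intro AE_I2 impI allI)
      fix \<omega> c d assume \<omega>: "\<omega> \<in> space M" "\<omega> \<in> Good" and cd: "a \<le> c" "c \<le> d" "d \<le> T"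
      have sp: "left_jump_sum X a d \<omega> = left_jump_sum X a c \<omega> + left_jump_sum X c d \<omega>" "left_jump_sum Xn a d \<omega> = left_jump_sum Xn a c \<omega> + left_jump_sum Xn c d \<omega>"
        using cd by (auto intro!: left_jump_sum_split)
      have d: "d \<in> {a..T}" using cd by auto
      have fin: "left_jump_sum X a c \<omega> < \<infinity>" "left_jump_sum X c d \<omega> < \<infinity>" "left_jump_sum Xn a c \<omega> < \<infinity>" "left_jump_sum Xn c d \<omega> < \<infinity>"
        using Gfin[OF d \<omega>(2)] unfolding sp by auto
      have N: "(\<integral>\<^sup>+s. ennreal (- left_lim (\<lambda>t. X t \<omega>) s) * ennreal ((jump (\<lambda>t. L t \<omega>) s)\<^sup>2) * indicator {c<..d} s \<partial>count_space UNIV) = left_jump_sum Xn c d \<omega>"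
        unfolding left_jump_sum_def using lln[OF \<omega>(1)] cd by (intro nn_integral_cong) (auto simp: indicator_def)
      have "dS_integral (\<lambda>s. X s \<omega>) (\<lambda>s. L s \<omega>) c d = enn2real (left_jump_sum X c d \<omega>) - enn2real (left_jump_sum Xn c d \<omega>)"
        using dS_integral_eq[of "\<lambda>s. X s \<omega>" "\<lambda>s. L s \<omega>" c d] fin unfolding N left_jump_sum_def[of X c d \<omega>, symmetric] by blast
      also have "\<dots> = D d \<omega> - D c \<omega>"
        using cd \<omega>(2) fin by (simp add: D_def min_def sp enn2real_plus)
      finally show "dS_integral (\<lambda>s. X s \<omega>) (\<lambda>s. L s \<omega>) c d = D d \<omega> - D c \<omega>" .
    qed
  qed
qed

end

text \<open>The counterpart of \<open>jump_integral_process\<close> for integration in time, with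
  the same interface, so that both delay terms pass through one Fubini lemma. Cadlag paths are
  integrable on compacts, so the increment identity holds on every path.\<close>

lemma (in prob_space) time_integral_process:
  fixes X :: "real \<Rightarrow> 'a \<Rightarrow> real"
  assumes Xm: "\<And>t. a \<le> t \<Longrightarrow> X t \<in> borel_measurable M"
    and cad: "\<And>\<omega>. \<omega> \<in> space M \<Longrightarrow> cadlag_from a (\<lambda>t. X t \<omega>)"
    and T: "a < T" and C: "\<And>t. t \<in> {a..T} \<Longrightarrow> (\<integral>\<^sup>+\<omega>. ennreal \<bar>X t \<omega>\<bar> \<partial>M) \<le> ennreal C"
  obtains D C' where
    "\<And>t. a \<le> t \<Longrightarrow> D t \<in> borel_measurable M"
    "\<And>\<omega> t. \<omega> \<in> space M \<Longrightarrow> a \<le> t \<Longrightarrow> ((\<lambda>u. D u \<omega>) \<longlongrightarrow> D t \<omega>) (at_right t)"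
    "\<And>t. a \<le> t \<Longrightarrow> (\<integral>\<^sup>+\<omega>. ennreal \<bar>D t \<omega>\<bar> \<partial>M) \<le> ennreal C'"
    "\<And>t. t \<in> {a..T} \<Longrightarrow> expectation (D t) = integral {a..t} (\<lambda>s. expectation (X s))"
    "\<And>\<omega> c d. \<omega> \<in> space M \<Longrightarrow> a \<le> c \<Longrightarrow> c \<le> d \<Longrightarrow> d \<le> T \<Longrightarrow>
      integral {c..d} (\<lambda>s. X s \<omega>) = D d \<omega> - D c \<omega>"
proof -
  have J[measurable]: "(\<lambda>(t, \<omega>). X (max a t) \<omega>) \<in> borel_measurable (borel \<Otimes>\<^sub>M M)"
    by (intro right_continuous_joint_measurable Xm cadlag_right_tendsto[OF cad]) auto
  have JA: "(\<lambda>(t, \<omega>). \<bar>X (max a t) \<omega>\<bar>) \<in> borel_measurable (borel \<Otimes>\<^sub>M M)" by measurable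
  have sint: "set_integrable lborel {c..d} (\<lambda>s. X s \<omega>)" if "\<omega> \<in> space M" "a \<le> c" for \<omega> c d
    by (rule cadlag_set_integrable[OF cad[OF that(1)] that(2)])
  have HK: "(\<lambda>s. X s \<omega>) integrable_on {c..d}" "integral {c..d} (\<lambda>s. X s \<omega>) = (LINT s:{c..d}|lborel. X s \<omega>)"
    if "\<omega> \<in> space M" "a \<le> c" for \<omega> c d
    using set_borel_integral_eq_integral[OF sint[OF that]] by auto
  define D where "D t \<omega> = integral {a..min t T} (\<lambda>s. X s \<omega>)" for t \<omega>
  have F: "integrable M (\<lambda>\<omega>. LINT s:{a..t}|lborel. X s \<omega> * 1) \<and>
    expectation (\<lambda>\<omega>. LINT s:{a..t}|lborel. X s \<omega> * 1) = integral {a..t} (\<lambda>s. expectation (X s) * 1)"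
    if "t \<in> {a..T}" for t
    using fubini_process(1,4)[OF J, of t C "\<lambda>_. 1" 1] C that by auto
  have Fabs: "integrable M (\<lambda>\<omega>. LINT s:{a..T}|lborel. \<bar>X s \<omega>\<bar> * 1)"
    using fubini_process(1)[of "\<lambda>t \<omega>. \<bar>X t \<omega>\<bar>" a T C "\<lambda>_. 1" 1] JA C by auto
  have Dint: "integrable M (D t)" if "a \<le> t" for t
  proof -
    have "min t T \<in> {a..T}" using that T by auto
    from F[OF this] show ?thesis
      unfolding D_def[abs_def] by (subst Bochner_Integration.integrable_cong[OF refl]) (auto simp: HK)
  qed
  show thesis
  proof (rule that[of D "expectation (\<lambda>\<omega>. LINT s:{a..T}|lborel. \<bar>X s \<omega>\<bar> * 1)"])
    fix t assume t: "a \<le> t"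
    then have mt: "min t T \<in> {a..T}" using T by auto
    show "D t \<in> borel_measurable M" using Dint[OF t] by auto
    have "(\<integral>\<^sup>+\<omega>. ennreal \<bar>D t \<omega>\<bar> \<partial>M) \<le> (\<integral>\<^sup>+\<omega>. ennreal (LINT s:{a..T}|lborel. \<bar>X s \<omega>\<bar> * 1) \<partial>M)"
    proof (intro nn_integral_mono ennreal_leI)
      fix \<omega> assume \<omega>: "\<omega> \<in> space M"
      have i: "set_integrable lborel {a..T} (\<lambda>s. \<bar>X s \<omega>\<bar>)" using sint[OF \<omega> order_refl] by (rule set_integrable_abs)
      have "\<bar>D t \<omega>\<bar> \<le> (\<integral>s. \<bar>indicator {a..min t T} s *\<^sub>R X s \<omega>\<bar> \<partial>lborel)"
        unfolding D_def HK[OF \<omega> order_refl] set_lebesgue_integral_def using integral_norm_bound[of lborel "\<lambda>s. indicator {a..min t T} s *\<^sub>R X s \<omega>"] by simp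
      also have "\<dots> \<le> (\<integral>s. indicator {a..T} s *\<^sub>R \<bar>X s \<omega>\<bar> \<partial>lborel)"
        using i sint[OF \<omega> order_refl, of "min t T"] mt unfolding set_integrable_def
        by (intro integral_mono integrable_abs) (auto simp: indicator_def)
      finally show "\<bar>D t \<omega>\<bar> \<le> (LINT s:{a..T}|lborel. \<bar>X s \<omega>\<bar> * 1)" by (simp add: set_lebesgue_integral_def)
    qed
    also have "\<dots> = ennreal (expectation (\<lambda>\<omega>. LINT s:{a..T}|lborel. \<bar>X s \<omega>\<bar> * 1))"
      by (intro nn_integral_eq_integral[OF Fabs] AE_I2) (auto simp: set_lebesgue_integral_def intro!: integral_nonneg_AE)
    finally show "(\<integral>\<^sup>+\<omega>. ennreal \<bar>D t \<omega>\<bar> \<partial>M) \<le> ennreal (expectation (\<lambda>\<omega>. LINT s:{a..T}|lborel. \<bar>X s \<omega>\<bar> * 1))" .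
  next
    fix \<omega> t assume \<omega>: "\<omega> \<in> space M" and t: "a \<le> t"
    show "((\<lambda>u. D u \<omega>) \<longlongrightarrow> D t \<omega>) (at_right t)"
    proof (cases "t < T")
      case True
      have "continuous_on {a..T} (\<lambda>u. integral {a..u} (\<lambda>s. X s \<omega>))"
        by (rule indefinite_integral_continuous_1[OF HK(1)[OF \<omega> order_refl]])
      then have "continuous_on {t..T} (\<lambda>u. integral {a..u} (\<lambda>s. X s \<omega>))" using t by (auto elim: continuous_on_subset)
      then have "((\<lambda>u. integral {a..u} (\<lambda>s. X s \<omega>)) \<longlongrightarrow> integral {a..t} (\<lambda>s. X s \<omega>)) (at t within {t..T})"
        using True by (auto simp: continuous_on_def)
      then have "((\<lambda>u. integral {a..u} (\<lambda>s. X s \<omega>)) \<longlongrightarrow> D t \<omega>) (at_right t)"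
        using True by (simp add: at_within_Icc_at_right D_def min_def)
      moreover have "\<forall>\<^sub>F u in at_right t. integral {a..u} (\<lambda>s. X s \<omega>) = D u \<omega>"
        using True by (auto simp: eventually_at_right_field D_def intro!: exI[of _ T])
      ultimately show ?thesis by (rule Lim_transform_eventually)
    next
      case False
      have "\<forall>\<^sub>F u in at_right t. D u \<omega> = D t \<omega>"
        using False by (auto simp: eventually_at_right_field D_def min_def intro!: exI[of _ "t+1"])
      then show ?thesis by (rule tendsto_eventually)
    qed
  next
    fix t assume t: "t \<in> {a..T}"
    then have "expectation (D t) = expectation (\<lambda>\<omega>. LINT s:{a..t}|lborel. X s \<omega> * 1)"
      by (intro Bochner_Integration.integral_cong) (auto simp: D_def HK min_def)
    then show "expectation (D t) = integral {a..t} (\<lambda>s. expectation (X s))" using F[OF t] by simp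
  next
    fix \<omega> c d assume "\<omega> \<in> space M" "a \<le> c" "c \<le> d" "d \<le> T"
    then show "integral {c..d} (\<lambda>s. X s \<omega>) = D d \<omega> - D c \<omega>"
      using Henstock_Kurzweil_Integration.integral_combine[OF _ _ HK(1)[of \<omega> a d], of c] by (simp add: D_def min_def)
  qed
qed

text \<open>With the inner integrals written as increments of \<open>D\<close>, the delay term
  integrates a jointly measurable process against a bounded kernel, so Fubini applies. The
  Henstock-Kurzweil form used in the equation agrees with it off a null set.\<close>

lemma (in prob_space) expectation_delay_integral:
  fixes D :: "real \<Rightarrow> 'a \<Rightarrow> real" and g :: "real \<Rightarrow> real"
  assumes Dm: "\<And>t. a \<le> t \<Longrightarrow> D t \<in> borel_measurable M"
    and rc: "\<And>\<omega> t. \<omega> \<in> space M \<Longrightarrow> a \<le> t \<Longrightarrow> ((\<lambda>u. D u \<omega>) \<longlongrightarrow> D t \<omega>) (at_right t)"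
    and C: "\<And>t. a \<le> t \<Longrightarrow> (\<integral>\<^sup>+\<omega>. ennreal \<bar>D t \<omega>\<bar> \<partial>M) \<le> ennreal C"
    and g: "g \<in> borel_measurable borel" "\<And>t. \<bar>g t\<bar> \<le> B"
    and c: "a \<le> c" and t: "0 \<le> t"
  shows "integrable M (\<lambda>\<omega>. LINT u:{c..0}|lborel. (D (t + u) \<omega> - D u \<omega>) * g u)"
    and "AE \<omega> in M. integral {c..0} (\<lambda>u. (D (t + u) \<omega> - D u \<omega>) * g u) = (LINT u:{c..0}|lborel. (D (t + u) \<omega> - D u \<omega>) * g u)"
    and "expectation (\<lambda>\<omega>. LINT u:{c..0}|lborel. (D (t + u) \<omega> - D u \<omega>) * g u)
      = integral {c..0} (\<lambda>u. (expectation (D (t + u)) - expectation (D u)) * g u)"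
proof -
  have int: "integrable M (D s)" if "a \<le> s" for s
    using C[OF that] Dm[OF that] by (intro integrableI_bounded) (auto intro: le_less_trans)
  have J: "(\<lambda>(u, \<omega>). D (t + max c u) \<omega> - D (max c u) \<omega>) \<in> borel_measurable (borel \<Otimes>\<^sub>M M)"
  proof (rule right_continuous_joint_measurable[of c "\<lambda>u \<omega>. D (t + u) \<omega> - D u \<omega>"])
    fix u assume "c \<le> u"
    then show "(\<lambda>\<omega>. D (t + u) \<omega> - D u \<omega>) \<in> borel_measurable M" using c t by (intro borel_measurable_diff Dm) auto
  next
    fix \<omega> u assume \<omega>: "\<omega> \<in> space M" and u: "c \<le> u"
    have "filterlim (\<lambda>v. t + v) (at_right (t + u)) (at_right u)"
      by (auto simp: filterlim_at intro!: tendsto_intros eventually_mono[OF eventually_at_right_less[of u]])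
    then have "((\<lambda>v. D (t + v) \<omega>) \<longlongrightarrow> D (t + u) \<omega>) (at_right u)"
      using c t u by (intro filterlim_compose[OF rc[OF \<omega>]]) auto
    then show "((\<lambda>v. D (t + v) \<omega> - D v \<omega>) \<longlongrightarrow> D (t + u) \<omega> - D u \<omega>) (at_right u)"
      using c u by (intro tendsto_diff rc[OF \<omega>]) auto
  qed
  \<comment> \<open>\<open>C\<close> may be negative, and then \<open>ennreal C\<close> is
    \<open>0\<close>; \<open>max 0 C\<close> allows the two bounds to be added as reals.\<close>
  have C2: "(\<integral>\<^sup>+\<omega>. ennreal \<bar>D (t + u) \<omega> - D u \<omega>\<bar> \<partial>M) \<le> ennreal (max 0 C + max 0 C)" if u: "u \<in> {c..0}" for u
  proof -
    have a: "a \<le> t + u" "a \<le> u" using u c t by auto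
    note [measurable] = Dm[OF a(1)] Dm[OF a(2)]
    have "(\<integral>\<^sup>+\<omega>. ennreal \<bar>D (t + u) \<omega> - D u \<omega>\<bar> \<partial>M) \<le> (\<integral>\<^sup>+\<omega>. ennreal \<bar>D (t + u) \<omega>\<bar> + ennreal \<bar>D u \<omega>\<bar> \<partial>M)"
      by (intro nn_integral_mono) (auto simp: ennreal_plus[symmetric] simp del: ennreal_plus intro!: ennreal_leI)
    also have "\<dots> = (\<integral>\<^sup>+\<omega>. ennreal \<bar>D (t + u) \<omega>\<bar> \<partial>M) + (\<integral>\<^sup>+\<omega>. ennreal \<bar>D u \<omega>\<bar> \<partial>M)"
      by (rule nn_integral_add) measurable
    also have "\<dots> \<le> ennreal C + ennreal C" by (intro add_mono C a)
    also have "\<dots> = ennreal (max 0 C + max 0 C)" by (subst ennreal_plus) simp_all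
    finally show ?thesis .
  qed
  note F = fubini_process[where d=0 and Z="\<lambda>u \<omega>. D (t + u) \<omega> - D u \<omega>", OF J C2 g]
  have F2: "AE \<omega> in M. set_integrable lborel {c..0} (\<lambda>u. (D (t + u) \<omega> - D u \<omega>) * g u)" by (rule F(2))
  show "integrable M (\<lambda>\<omega>. LINT u:{c..0}|lborel. (D (t + u) \<omega> - D u \<omega>) * g u)" by (rule F(1))
  show "AE \<omega> in M. integral {c..0} (\<lambda>u. (D (t + u) \<omega> - D u \<omega>) * g u) = (LINT u:{c..0}|lborel. (D (t + u) \<omega> - D u \<omega>) * g u)"
    using F2 by eventually_elim (rule set_borel_integral_eq_integral(2)[symmetric])
  have "expectation (\<lambda>\<omega>. LINT u:{c..0}|lborel. (D (t + u) \<omega> - D u \<omega>) * g u)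
    = integral {c..0} (\<lambda>u. expectation (\<lambda>\<omega>. D (t + u) \<omega> - D u \<omega>) * g u)" by (rule F(4))
  also have "\<dots> = integral {c..0} (\<lambda>u. (expectation (D (t + u)) - expectation (D u)) * g u)"
    using c t int by (intro integral_cong) auto
  finally show "expectation (\<lambda>\<omega>. LINT u:{c..0}|lborel. (D (t + u) \<omega> - D u \<omega>) * g u)
      = integral {c..0} (\<lambda>u. (expectation (D (t + u)) - expectation (D u)) * g u)" .
qed

section \<open>The deterministic delay equation\<close>

text \<open>What is known before the equation is exploited: \<open>m\<close> is measurable and
  bounded on compacts, while \<open>f\<close> is bounded and continuous off a finite set.\<close>

locale delay_kernel =
  fixes m f :: "real \<Rightarrow> real" and r B :: real and E :: "real set"
  assumes r: "0 < r"
    and m_meas: "(\<lambda>t. m (max (- r) t)) \<in> borel_measurable borel"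
    and m_bdd: "\<And>T. \<exists>K. \<forall>s\<in>{- r..T}. \<bar>m s\<bar> \<le> K"
    and f_meas: "f \<in> borel_measurable borel"
    and f_bdd: "\<And>u. \<bar>f u\<bar> \<le> B"
    and f_supp: "\<And>u. u \<notin> {- r..0} \<Longrightarrow> f u = 0"
    and E: "finite E" and f_cont: "\<And>u. u \<notin> E \<Longrightarrow> isCont f u"
begin

definition H :: "real \<Rightarrow> real" where "H t = integral {- r..0} (\<lambda>u. m (t + u) * f u)"

text \<open>The contribution of the density \<open>f\<close> to \<open>zeta\<close>: for positive
  \<open>x\<close> the two differ by the constant \<open>- c0\<close>.\<close>

definition Zf :: "real \<Rightarrow> real" where "Zf x = integral {0..min x r} (\<lambda>u. f (- u))"

text \<open>Truncated to \<open>[- r, T]\<close>, \<open>m\<close> is bounded and measurable on the whole line.\<close>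
definition mt :: "real \<Rightarrow> real \<Rightarrow> real" where "mt T v = m (max (- r) (min v T))"

lemma mt_eq: "v \<in> {- r..T} \<Longrightarrow> mt T v = m v"
  by (auto simp: mt_def max_def min_def)

lemma mt_measurable[measurable]: "mt T \<in> borel_measurable borel"
proof -
  have "(\<lambda>v. (\<lambda>t. m (max (- r) t)) (min v T)) \<in> borel_measurable borel"
    by (rule measurable_compose[OF _ m_meas]) measurable
  then show ?thesis by (simp add: mt_def[abs_def])
qed

lemma mt_bdd: "0 \<le> T \<Longrightarrow> \<exists>K. \<forall>v. \<bar>mt T v\<bar> \<le> K"
proof -
  assume T: "0 \<le> T"
  obtain K where "\<forall>s\<in>{- r..T}. \<bar>m s\<bar> \<le> K" using m_bdd by blast
  then have "\<forall>v. \<bar>mt T v\<bar> \<le> K" using T r by (auto simp: mt_def)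
  then show ?thesis by blast
qed

lemma m_set_integrable:
  assumes "- r \<le> c" shows "set_integrable lborel {c..d} m"
proof -
  obtain K where K: "\<forall>s\<in>{- r..d}. \<bar>m s\<bar> \<le> K" using m_bdd by blast
  have "integrable lborel (\<lambda>s. indicator {c..d} s *\<^sub>R mt d s)"
  proof (rule integrableI_bounded_set_indicator[where B=K])
    show "AE s in lborel. s \<in> {c..d} \<longrightarrow> norm (mt d s) \<le> K"
      using K assms by (intro AE_I2) (auto simp: mt_eq)
  qed (auto simp: emeasure_lborel_Icc_eq)
  moreover have "(\<lambda>s. indicator {c..d} s *\<^sub>R mt d s) = (\<lambda>s. indicator {c..d} s *\<^sub>R m s)"
    using assms by (auto simp: fun_eq_iff indicator_def mt_eq)
  ultimately show ?thesis by (simp add: set_integrable_def)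
qed

lemma m_integrable_on: "- r \<le> c \<Longrightarrow> m integrable_on {c..d}"
  and m_LINT: "- r \<le> c \<Longrightarrow> integral {c..d} m = (LINT s:{c..d}|lborel. m s)"
  using set_borel_integral_eq_integral[OF m_set_integrable[of c d]] by auto

text \<open>In the variable \<open>v = u + s\<close> the window can be enlarged to
  \<open>[- r, T]\<close>, because \<open>f\<close> vanishes off its own window. The new domain no
  longer depends on \<open>s\<close>.\<close>

lemma kernel_eq:
  assumes s: "s \<in> {0..T}"
  shows "indicator {- r..T} (u + s) *\<^sub>R (mt T (u + s) * f u) = indicator {- r..0} u *\<^sub>R (m (s + u) * f u)"
proof (cases "u \<in> {- r..0}")
  case True
  then have "u + s \<in> {- r..T}" using s by auto
  with True show ?thesis by (simp add: mt_eq add.commute)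
qed (simp add: f_supp)

lemma kernel_integrable:
  assumes "0 \<le> T" shows "integrable lborel (\<lambda>v. indicator {- r..T} v *\<^sub>R (mt T v * f (v - s)))"
proof -
  note [measurable] = f_meas
  obtain K where K: "\<forall>v. \<bar>mt T v\<bar> \<le> K" using mt_bdd[OF assms] by blast
  show ?thesis
  proof (rule integrableI_bounded_set_indicator[where B="K * B"])
    show "AE v in lborel. v \<in> {- r..T} \<longrightarrow> norm (mt T v * f (v - s)) \<le> K * B"
      using K f_bdd by (intro AE_I2) (auto simp: abs_mult intro!: mult_mono order_trans[OF abs_ge_zero])
  qed (auto simp: emeasure_lborel_Icc_eq)
qed

lemma H_set_integrable:
  assumes "0 \<le> t" shows "set_integrable lborel {- r..0} (\<lambda>u. m (t + u) * f u)"
proof -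
  have "integrable lborel (\<lambda>u. indicator {- r..t} (u + t) *\<^sub>R (mt t (u + t) * f (u + t - t)))"
    using lborel_integrable_real_affine[OF kernel_integrable[OF assms, of t], of 1 t] by (simp add: add.commute)
  moreover have "(\<lambda>u. indicator {- r..t} (u + t) *\<^sub>R (mt t (u + t) * f (u + t - t))) = (\<lambda>u. indicator {- r..0} u *\<^sub>R (m (t + u) * f u))"
    using assms by (intro ext) (subst kernel_eq[of t t, symmetric], simp_all)
  ultimately show ?thesis by (simp only: set_integrable_def)
qed

lemma H_integrable_on: "0 \<le> t \<Longrightarrow> (\<lambda>u. m (t + u) * f u) integrable_on {- r..0}"
  and H_LINT: "0 \<le> t \<Longrightarrow> H t = (LINT u:{- r..0}|lborel. m (t + u) * f u)"
  unfolding H_def using set_borel_integral_eq_integral[OF H_set_integrable[of t]] by auto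

text \<open>The time variable moves from \<open>m\<close>, which is merely measurable, to the kernel
  \<open>f\<close>, whose translates converge almost everywhere.\<close>

lemma H_kernel:
  assumes s: "s \<in> {0..T}"
  shows "H s = (LINT v:{- r..T}|lborel. mt T v * f (v - s))"
proof -
  have "(LINT v:{- r..T}|lborel. mt T v * f (v - s)) = (\<integral>u. indicator {- r..T} (s + 1 * u) *\<^sub>R (mt T (s + 1 * u) * f (s + 1 * u - s)) \<partial>lborel)"
    unfolding set_lebesgue_integral_def by (subst lborel_integral_real_affine[where c=1 and t=s]) auto
  also have "\<dots> = (\<integral>u. indicator {- r..0} u *\<^sub>R (m (s + u) * f u) \<partial>lborel)"
  proof (rule Bochner_Integration.integral_cong[OF refl])
    fix u
    show "indicator {- r..T} (s + 1 * u) *\<^sub>R (mt T (s + 1 * u) * f (s + 1 * u - s)) = indicator {- r..0} u *\<^sub>R (m (s + u) * f u)"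
      using kernel_eq[OF s, of u] by (simp only: add.commute[of s u] mult_1 add_diff_cancel_right')
  qed
  finally show ?thesis using s by (simp add: H_LINT set_lebesgue_integral_def)
qed

text \<open>Dominated convergence in the kernel form: for fixed \<open>s\<close>,
  \<open>v - s\<close> avoids the finite set \<open>E\<close> for almost every
  \<open>v\<close>.\<close>

lemma H_continuous: "continuous_on {0..T} H"
  unfolding continuous_on_sequentially
proof (intro allI ballI impI)
  note [measurable] = f_meas
  fix S s assume s: "s \<in> {0..T}" and S: "(\<forall>n. S n \<in> {0..T}) \<and> S \<longlonglongrightarrow> s"
  have T: "0 \<le> T" using s by auto
  obtain K where K: "\<forall>v. \<bar>mt T v\<bar> \<le> K" using mt_bdd[OF T] by blast
  have "(\<lambda>n. \<integral>v. indicator {- r..T} v *\<^sub>R (mt T v * f (v - S n)) \<partial>lborel) \<longlonglongrightarrow> (\<integral>v. indicator {- r..T} v *\<^sub>R (mt T v * f (v - s)) \<partial>lborel)"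
  proof (rule integral_dominated_convergence[where w="\<lambda>v. indicator {- r..T} v * (K * B)"])
    show "integrable lborel (\<lambda>v. indicator {- r..T} v * (K * B))"
      by (auto simp: emeasure_lborel_Icc_eq)
    show "AE v in lborel. norm (indicator {- r..T} v *\<^sub>R (mt T v * f (v - S n))) \<le> indicator {- r..T} v * (K * B)" for n
      using K f_bdd by (intro AE_I2) (auto simp: abs_mult indicator_def intro!: mult_mono order_trans[OF abs_ge_zero])
    have "AE v in lborel. v \<notin> (\<lambda>e. e + s) ` E"
      using countable_imp_null_set_lborel[of "(\<lambda>e. e + s) ` E"] E by (intro AE_not_in) (simp add: countable_finite)
    then show "AE v in lborel. (\<lambda>n. indicator {- r..T} v *\<^sub>R (mt T v * f (v - S n))) \<longlonglongrightarrow> indicator {- r..T} v *\<^sub>R (mt T v * f (v - s))"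
    proof (rule AE_mp, intro AE_I2 impI)
      fix v assume v: "v \<notin> (\<lambda>e. e + s) ` E"
      then have "v - s \<notin> E" by (auto simp: image_iff algebra_simps)
      then have "(\<lambda>n. f (v - S n)) \<longlonglongrightarrow> f (v - s)"
        using S by (intro isCont_tendsto_compose[OF f_cont] tendsto_intros) auto
      then show "(\<lambda>n. indicator {- r..T} v *\<^sub>R (mt T v * f (v - S n))) \<longlonglongrightarrow> indicator {- r..T} v *\<^sub>R (mt T v * f (v - s))"
        by (intro tendsto_intros)
    qed
  qed measurable
  then show "(H \<circ> S) \<longlonglongrightarrow> H s"
    using S s H_kernel[of _ T] by (simp add: comp_def set_lebesgue_integral_def)
qed

lemma integral_H_LINT: "integral {0..t} H = (\<integral>s. indicator {0..t} s * H s \<partial>lborel)"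
proof -
  have "set_integrable lborel {0..t} H"
    by (intro borel_integrable_atLeastAtMost' H_continuous)
  from set_borel_integral_eq_integral(2)[OF this] show ?thesis by (simp add: set_lebesgue_integral_def)
qed

text \<open>Fubini links the delay term, as it leaves the variance equation, to \<open>H\<close>:
  the integral of \<open>m\<close> over \<open>[u, t + u]\<close> is that of
  \<open>m (s + u)\<close> over \<open>s\<close> in \<open>[0, t]\<close>.\<close>

lemma integral_delay:
  assumes t: "0 \<le> t"
  shows "integral {- r..0} (\<lambda>u. (integral {- r..t + u} m - integral {- r..u} m) * f u) = integral {0..t} H"
proof -
  note [measurable] = f_meas
  obtain K where K: "\<forall>v. \<bar>mt t v\<bar> \<le> K" using mt_bdd[OF t] by blast
  define Z where "Z u s = indicator {0..t} s * mt t (s + u)" for u s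
  have J: "(\<lambda>(u, s). Z (max (- r) u) s) \<in> borel_measurable (borel \<Otimes>\<^sub>M lborel)"
    unfolding Z_def by measurable
  have C: "(\<integral>\<^sup>+s. ennreal \<bar>Z u s\<bar> \<partial>lborel) \<le> ennreal (K * t)" for u
  proof -
    have "(\<integral>\<^sup>+s. ennreal \<bar>Z u s\<bar> \<partial>lborel) \<le> (\<integral>\<^sup>+s. ennreal K * indicator {0..t} s \<partial>lborel)"
      using K by (intro nn_integral_mono) (auto simp: Z_def indicator_def intro!: ennreal_leI)
    also have "\<dots> = ennreal (K * t)"
      using t order_trans[OF abs_ge_zero K[rule_format, of 0]] by (simp add: nn_integral_cmult_indicator ennreal_mult)
    finally show ?thesis .
  qed
  have "(\<integral>s. (LINT u:{- r..0}|lborel. Z u s * f u) \<partial>lborel) = integral {- r..0} (\<lambda>u. integral\<^sup>L lborel (Z u) * f u)"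
    by (rule lborel.fubini_process(4)[OF J C f_meas f_bdd])
  moreover have "(LINT u:{- r..0}|lborel. Z u s * f u) = indicator {0..t} s * H s" for s
  proof (cases "s \<in> {0..t}")
    case True
    then have "indicator {- r..0} u *\<^sub>R (Z u s * f u) = indicator {- r..0} u *\<^sub>R (m (s + u) * f u)" for u
      by (auto simp: Z_def indicator_def mt_eq)
    then have "(LINT u:{- r..0}|lborel. Z u s * f u) = (LINT u:{- r..0}|lborel. m (s + u) * f u)"
      by (simp only: set_lebesgue_integral_def)
    then show ?thesis using True by (simp add: H_LINT)
  qed (simp add: Z_def)
  moreover have "integral\<^sup>L lborel (Z u) = integral {- r..t + u} m - integral {- r..u} m" if u: "u \<in> {- r..0}" for u
  proof -
    have "integral {- r..t + u} m - integral {- r..u} m = integral {u..t + u} m"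
      using Henstock_Kurzweil_Integration.integral_combine[OF _ _ m_integrable_on[of "- r" "t + u"], of u] u t by auto
    also have "\<dots> = (\<integral>v. indicator {u..t + u} v *\<^sub>R m v \<partial>lborel)"
      using u by (simp add: m_LINT set_lebesgue_integral_def)
    also have "\<dots> = (\<integral>s. indicator {u..t + u} (u + 1 * s) *\<^sub>R m (u + 1 * s) \<partial>lborel)"
      by (subst lborel_integral_real_affine[where c=1 and t=u]) auto
    also have "\<dots> = integral\<^sup>L lborel (Z u)"
      using u by (intro Bochner_Integration.integral_cong) (auto simp: Z_def indicator_def mt_eq add.commute)
    finally show ?thesis by simp
  qed
  then have "integral {- r..0} (\<lambda>u. (integral {- r..t + u} m - integral {- r..u} m) * f u) = integral {- r..0} (\<lambda>u. integral\<^sup>L lborel (Z u) * f u)"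
    by (intro integral_cong) simp
  ultimately show ?thesis unfolding integral_H_LINT by simp
qed

lemma f_reflected_supp: "w \<notin> {0..r} \<Longrightarrow> f (- w) = 0"
  using f_supp[of "- w"] by auto

lemma reflected_integrable: "integrable lborel (\<lambda>w. f (- w) * indicator {..x} w)"
proof -
  note [measurable] = f_meas
  have "integrable lborel (\<lambda>w. indicator {0..r} w *\<^sub>R (f (- w) * indicator {..x} w))"
  proof (rule integrableI_bounded_set_indicator[where B=B])
    show "AE w in lborel. w \<in> {0..r} \<longrightarrow> norm (f (- w) * indicator {..x} w) \<le> B"
      using f_bdd order_trans[OF abs_ge_zero f_bdd[of 0]] by (intro AE_I2) (auto simp: indicator_def)
  qed (auto simp: emeasure_lborel_Icc_eq)
  moreover have "(\<lambda>w. indicator {0..r} w *\<^sub>R (f (- w) * indicator {..x} w)) = (\<lambda>w. f (- w) * indicator {..x} w)"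
  proof
    fix w show "indicator {0..r} w *\<^sub>R (f (- w) * indicator {..x} w) = f (- w) * indicator {..x} w"
      by (cases "w \<in> {0..r}") (simp_all add: f_reflected_supp)
  qed
  ultimately show ?thesis by simp
qed

text \<open>With the cut-off written as a half-line, valid because \<open>f (- w)\<close> vanishes
  off \<open>[0, r]\<close>, differences of \<open>Zf\<close> become interval integrals without case
  distinctions.\<close>

lemma Zf_alt: "Zf x = (\<integral>w. f (- w) * indicator {..x} w \<partial>lborel)"
  and Zf_integrable_on: "(\<lambda>u. f (- u)) integrable_on {0..min x r}"
proof -
  have e: "(\<lambda>w. indicator {0..min x r} w *\<^sub>R f (- w)) = (\<lambda>w. f (- w) * indicator {..x} w)"
  proof
    fix w show "indicator {0..min x r} w *\<^sub>R f (- w) = f (- w) * indicator {..x} w"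
      by (cases "w \<in> {0..r}") (auto simp add: f_reflected_supp indicator_def)
  qed
  have s: "set_integrable lborel {0..min x r} (\<lambda>u. f (- u))"
    unfolding set_integrable_def e by (rule reflected_integrable)
  show "(\<lambda>u. f (- u)) integrable_on {0..min x r}" "Zf x = (\<integral>w. f (- w) * indicator {..x} w \<partial>lborel)"
    using set_borel_integral_eq_integral[OF s] unfolding Zf_def set_lebesgue_integral_def e by auto
qed

lemma Zf_nonpos: "x \<le> 0 \<Longrightarrow> Zf x = 0"
  unfolding Zf_def by (cases "x = 0") (auto simp: min_def)

lemma Zf_const: "r \<le> x \<Longrightarrow> Zf x = Zf r"
  by (simp add: Zf_def min_def)

lemma Zf_continuous: "continuous_on {0..} Zf"
proof -
  have "continuous_on {0..r} (\<lambda>y. integral {0..y} (\<lambda>u. f (- u)))"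
    using Zf_integrable_on[of r] by (intro indefinite_integral_continuous_1) simp
  then have "continuous_on {0..} (\<lambda>x. integral {0..min x r} (\<lambda>u. f (- u)))"
    by (rule continuous_on_compose2) (use r in \<open>auto intro!: continuous_intros\<close>)
  then show ?thesis by (simp add: Zf_def[abs_def])
qed

text \<open>Fubini in the other order: for fixed \<open>v\<close>, integrating
  \<open>f (v - s)\<close> over \<open>s\<close> in \<open>[0, t]\<close> and substituting
  \<open>w = s - v\<close> leaves the mass of \<open>f (- w)\<close> on \<open>[- v, t - v]\<close>.
  Positive \<open>v\<close> will give the convolution, negative \<open>v\<close> the memory of the
  initial segment.\<close>

lemma integral_H_renewal:
  assumes t: "0 \<le> t"
  shows "(\<lambda>v. (Zf (t - v) - Zf (- v)) * m v) integrable_on {- r..t}"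
    and "integral {0..t} H = integral {- r..t} (\<lambda>v. (Zf (t - v) - Zf (- v)) * m v)"
proof -
  note [measurable] = f_meas
  obtain K where K: "\<And>v. \<bar>mt t v\<bar> \<le> K" using mt_bdd[OF t] by blast
  define Z where "Z v s = indicator {0..t} s * f (v - s)" for v s
  have J: "(\<lambda>(v, s). Z (max (- r) v) s) \<in> borel_measurable (borel \<Otimes>\<^sub>M lborel)"
    unfolding Z_def by measurable
  have C: "(\<integral>\<^sup>+s. ennreal \<bar>Z v s\<bar> \<partial>lborel) \<le> ennreal (B * t)" for v
  proof -
    have "(\<integral>\<^sup>+s. ennreal \<bar>Z v s\<bar> \<partial>lborel) \<le> (\<integral>\<^sup>+s. ennreal B * indicator {0..t} s \<partial>lborel)"
      using f_bdd by (intro nn_integral_mono) (auto simp: Z_def indicator_def intro!: ennreal_leI)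
    also have "\<dots> = ennreal (B * t)"
      using t order_trans[OF abs_ge_zero f_bdd[of 0]] by (simp add: nn_integral_cmult_indicator ennreal_mult)
    finally show ?thesis .
  qed
  have ZZ: "integral\<^sup>L lborel (Z v) = Zf (t - v) - Zf (- v)" for v
  proof -
    have "integral\<^sup>L lborel (Z v) = (\<integral>w. Z v (v + 1 * w) \<partial>lborel)"
      by (subst lborel_integral_real_affine[where c=1 and t=v]) auto
    also have "\<dots> = (\<integral>w. f (- w) * indicator {..t - v} w - f (- w) * indicator {..- v} w \<partial>lborel)"
    proof (rule integral_cong_AE)
      \<comment> \<open>The difference of half-line indicators misses the closed interval only at
        \<open>w = - v\<close>.\<close>
      show "AE w in lborel. Z v (v + 1 * w) = f (- w) * indicator {..t - v} w - f (- w) * indicator {..- v} w"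
        using AE_lborel_singleton[of "- v"] by eventually_elim (use t in \<open>auto simp: Z_def indicator_def\<close>)
      show "(\<lambda>w. Z v (v + 1 * w)) \<in> borel_measurable lborel" unfolding Z_def by measurable
    qed measurable
    also have "\<dots> = Zf (t - v) - Zf (- v)"
      unfolding Zf_alt by (intro Bochner_Integration.integral_diff reflected_integrable)
    finally show ?thesis .
  qed
  have c: "integral\<^sup>L lborel (Z v) * mt t v = (Zf (t - v) - Zf (- v)) * m v" if "v \<in> {- r..t}" for v
    using that by (simp add: ZZ mt_eq)
  have "(\<lambda>v. integral\<^sup>L lborel (Z v) * mt t v) integrable_on {- r..t}"
    by (rule lborel.fubini_process(3)[OF J C mt_measurable K])
  then show "(\<lambda>v. (Zf (t - v) - Zf (- v)) * m v) integrable_on {- r..t}"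
    using c by (rule integrable_eq)
  have "(\<integral>s. (LINT v:{- r..t}|lborel. Z v s * mt t v) \<partial>lborel) = integral {- r..t} (\<lambda>v. integral\<^sup>L lborel (Z v) * mt t v)"
    by (rule lborel.fubini_process(4)[OF J C mt_measurable K])
  also have "\<dots> = integral {- r..t} (\<lambda>v. (Zf (t - v) - Zf (- v)) * m v)"
    by (rule integral_cong[OF c])
  also have "(\<integral>s. (LINT v:{- r..t}|lborel. Z v s * mt t v) \<partial>lborel) = integral {0..t} H"
    unfolding integral_H_LINT
  proof (rule Bochner_Integration.integral_cong[OF refl])
    fix s
    show "(LINT v:{- r..t}|lborel. Z v s * mt t v) = indicator {0..t} s * H s"
      by (cases "s \<in> {0..t}") (simp_all add: Z_def H_kernel[of s t] mult.commute)
  qed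
  finally show "integral {0..t} H = integral {- r..t} (\<lambda>v. (Zf (t - v) - Zf (- v)) * m v)" .
qed

section \<open>From the integral equation to the differential and renewal equations\<close>

text \<open>A bootstrap: the right-hand side of the integral equation is continuous in
  \<open>t\<close>, hence so is \<open>m\<close>, and with \<open>H\<close> continuous the
  fundamental theorem of calculus applies to both integrals.\<close>

lemma delay_differential:
  assumes eq: "\<And>t. 0 \<le> t \<Longrightarrow> m t = m 0 + \<eta> * t - c0 * integral {0..t} m + integral {0..t} H" and t: "0 < t"
  shows "(m has_real_derivative \<eta> - c0 * m t + H t) (at t)"
    and "continuous_on {0<..} (\<lambda>t. \<eta> - c0 * m t + H t)"
proof -
  have mc: "continuous_on {0..T} m" for T
  proof -
    have "continuous_on {0..T} (\<lambda>t. integral {0..t} m)"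
      using r by (intro indefinite_integral_continuous_1 m_integrable_on) simp
    moreover have "continuous_on {0..T} (\<lambda>t. integral {0..t} H)"
      by (intro indefinite_integral_continuous_1 integrable_continuous_real H_continuous)
    ultimately have "continuous_on {0..T} (\<lambda>t. m 0 + \<eta> * t - c0 * integral {0..t} m + integral {0..t} H)"
      by (intro continuous_intros)
    then show ?thesis by (rule continuous_on_eq) (simp add: eq[symmetric])
  qed
  have at: "at t within {0..t + 1} = at t" using t by (intro at_within_Icc_at) auto
  have "((\<lambda>t. integral {0..t} m) has_real_derivative m t) (at t)"
    using integral_has_real_derivative[OF mc, of t "t + 1"] t unfolding at by simp
  moreover have "((\<lambda>t. integral {0..t} H) has_real_derivative H t) (at t)"
    using integral_has_real_derivative[OF H_continuous, of t "t + 1"] t unfolding at by simp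
  ultimately have "((\<lambda>t. m 0 + \<eta> * t - c0 * integral {0..t} m + integral {0..t} H) has_real_derivative \<eta> - c0 * m t + H t) (at t)"
    by (auto intro!: derivative_eq_intros)
  then show "(m has_real_derivative \<eta> - c0 * m t + H t) (at t)"
  proof (rule has_field_derivative_transform_within_open[where S="{0<..}"])
    fix x :: real assume "x \<in> {0<..}"
    then show "m 0 + \<eta> * x - c0 * integral {0..x} m + integral {0..x} H = m x" by (simp add: eq[symmetric])
  qed (use t in auto)
  have "isCont (\<lambda>t. \<eta> - c0 * m t + H t) s" if "0 < s" for s
  proof -
    have "continuous_on {0..s + 1} (\<lambda>t. \<eta> - c0 * m t + H t)"
      by (intro continuous_intros mc H_continuous)
    moreover have "s \<in> interior {0..s + 1}" using that by simp
    ultimately show ?thesis by (rule continuous_on_interior)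
  qed
  then show "continuous_on {0<..} (\<lambda>t. \<eta> - c0 * m t + H t)"
    by (intro continuous_at_imp_continuous_on) auto
qed

text \<open>Since \<open>zeta\<close> is constant from \<open>r\<close> on, its integral over
  \<open>[0, t]\<close> plus that of \<open>zeta (t + u) - zeta u\<close> over \<open>u\<close> in
  \<open>[0, r]\<close> is \<open>t\<close> times its value at \<open>r\<close>. This explains the
  factor \<open>\<eta> / zeta c0 f r r\<close> in \<open>renewal_h\<close>: the two terms carrying
  it combine to \<open>\<eta> * t\<close>.\<close>

lemma renewal_equation:
  assumes eq: "\<And>t. 0 \<le> t \<Longrightarrow> m t = m 0 + \<eta> * t - c0 * integral {0..t} m + integral {0..t} H"
    and t: "0 < t" and nz: "zeta c0 f r r \<noteq> 0"
  shows "(\<lambda>u. zeta c0 f r (t - u) * m u) integrable_on {0..t}"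
    and "m t = integral {0..t} (\<lambda>u. zeta c0 f r (t - u) * m u) + renewal_h \<eta> c0 f r m t"
proof -
  \<comment> \<open>A continuous version of \<open>zeta\<close> on the half-line; the two differ
    only at \<open>0\<close>, where the indicator in \<open>zeta\<close> is off. Integrals do not
    see this point, hence the spike arguments.\<close>
  define \<zeta> where "\<zeta> x = - c0 + Zf x" for x
  have \<zeta>: "zeta c0 f r x = \<zeta> x" if "0 < x" for x
    using that by (simp add: zeta_def \<zeta>_def Zf_def)
  have \<zeta>r: "zeta c0 f r r = \<zeta> r" using r by (rule \<zeta>)
  have \<zeta>c: "continuous_on {0..} \<zeta>" unfolding \<zeta>_def by (intro continuous_intros Zf_continuous)
  have \<zeta>i: "\<zeta> integrable_on {c..d}" if "0 \<le> c" for c d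
    using that by (intro integrable_continuous_real continuous_on_subset[OF \<zeta>c]) auto
  define k where "k = \<eta> / \<zeta> r"
  have k: "k * \<zeta> r = \<eta>" using nz by (simp add: k_def \<zeta>r)
  let ?W = "\<lambda>v. (Zf (t - v) - Zf (- v)) * m v"
  have Wi: "?W integrable_on {- r..t}" using integral_H_renewal(1) t by simp
  have Wi0: "?W integrable_on {- r..0}" "?W integrable_on {0..t}"
    using r t by (auto intro: integrable_subinterval_real[OF Wi])
  have W: "integral {- r..t} ?W = integral {- r..0} ?W + integral {0..t} ?W"
    using Henstock_Kurzweil_Integration.integral_combine[OF _ _ Wi, of 0] r t by simp
  have W2: "integral {0..t} ?W = integral {0..t} (\<lambda>u. Zf (t - u) * m u)"
    by (intro integral_cong) (auto simp: Zf_nonpos)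
  have W2i: "(\<lambda>u. Zf (t - u) * m u) integrable_on {0..t}"
    by (rule integrable_eq[OF Wi0(2)]) (auto simp: Zf_nonpos)
  have mi: "m integrable_on {0..t}" using r by (intro m_integrable_on) simp
  have A: "((\<lambda>u. \<zeta> (t - u) * m u) has_integral - c0 * integral {0..t} m + integral {0..t} (\<lambda>u. Zf (t - u) * m u)) {0..t}"
    unfolding \<zeta>_def distrib_right
    by (intro has_integral_add has_integral_mult_right integrable_integral mi W2i)
  have A': "((\<lambda>u. zeta c0 f r (t - u) * m u) has_integral - c0 * integral {0..t} m + integral {0..t} (\<lambda>u. Zf (t - u) * m u)) {0..t}"
    by (rule has_integral_spike[OF negligible_sing[of t] _ A]) (auto simp: \<zeta>)
  then show "(\<lambda>u. zeta c0 f r (t - u) * m u) integrable_on {0..t}" by blast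
  \<comment> \<open>Reflection \<open>u = - v\<close> of the part over the initial segment; the
    constant \<open>- c0\<close> cancels in the difference.\<close>
  have R: "((\<lambda>u. (\<zeta> (t + u) - \<zeta> u) * m (- u)) has_integral integral {- r..0} ?W) {0..r}"
  proof -
    have "((\<lambda>u. ?W (- u)) has_integral integral {- r..0} ?W) {- 0..- (- r)}"
      using has_integral_reflect_real[of ?W "integral {- r..0} ?W" 0 "- r"] integrable_integral[OF Wi0(1)] by simp
    then show ?thesis by (simp add: \<zeta>_def)
  qed
  have sh: "((\<lambda>u. \<zeta> (t + u)) has_integral integral {t..t + r} \<zeta>) {0..r}"
  proof -
    have "(\<zeta> has_integral integral {t..t + r} \<zeta>) (cbox t (t + r))"
      using integrable_integral[OF \<zeta>i[of t "t + r"]] t by simp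
    from has_integral_affinity[OF this, of 1 t]
    have "((\<lambda>u. \<zeta> (u + t)) has_integral integral {t..t + r} \<zeta>) ((\<lambda>x. x - t) ` {t..t + r})" by simp
    then show ?thesis using r by (simp add: image_diff_atLeastAtMost[of t] add.commute)
  qed
  have dif: "((\<lambda>u. \<zeta> (t + u) - \<zeta> u) has_integral integral {t..t + r} \<zeta> - integral {0..r} \<zeta>) {0..r}"
    by (intro has_integral_diff sh integrable_integral \<zeta>i) simp
  have "((\<lambda>u. (\<zeta> (t + u) - \<zeta> u) * m (- u) + k * (\<zeta> (t + u) - \<zeta> u)) has_integral
      integral {- r..0} ?W + k * (integral {t..t + r} \<zeta> - integral {0..r} \<zeta>)) {0..r}"
    by (intro has_integral_add R has_integral_mult_right dif)
  then have "((\<lambda>u. (\<zeta> (t + u) - \<zeta> u) * (m (- u) + k)) has_integral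
      integral {- r..0} ?W + k * (integral {t..t + r} \<zeta> - integral {0..r} \<zeta>)) {0..r}"
    by (simp add: algebra_simps)
  then have "((\<lambda>u. (zeta c0 f r (t + u) - zeta c0 f r u) * (m (- u) + k)) has_integral
      integral {- r..0} ?W + k * (integral {t..t + r} \<zeta> - integral {0..r} \<zeta>)) {0..r}"
    by (rule has_integral_spike[OF negligible_sing[of 0], rotated]) (use t in \<open>auto simp: \<zeta>\<close>)
  then have R': "integral {0..r} (\<lambda>u. (zeta c0 f r (t + u) - zeta c0 f r u) * (m (- u) + k))
    = integral {- r..0} ?W + k * (integral {t..t + r} \<zeta> - integral {0..r} \<zeta>)" by (rule integral_unique)
  have z0: "integral {0..t} (zeta c0 f r) = integral {0..t} \<zeta>"
    by (rule integral_spike[OF negligible_sing[of 0]]) (auto simp: \<zeta>)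
  \<comment> \<open>Cutting \<open>[0, t + r]\<close> at \<open>t\<close> and at \<open>r\<close>
    gives the telescoping identity; on \<open>[r, t + r]\<close> the integrand is constant.\<close>
  have "integral {0..t} \<zeta> + integral {t..t + r} \<zeta> = integral {0..t + r} \<zeta>"
    using r t by (intro Henstock_Kurzweil_Integration.integral_combine \<zeta>i) auto
  also have "\<dots> = integral {0..r} \<zeta> + integral {r..t + r} \<zeta>"
    using r t by (intro Henstock_Kurzweil_Integration.integral_combine[symmetric] \<zeta>i) auto
  also have "integral {r..t + r} \<zeta> = integral {r..t + r} (\<lambda>_. \<zeta> r)"
    unfolding \<zeta>_def by (intro integral_cong arg_cong2[where f="(+)"] Zf_const refl) auto
  also have "\<dots> = t * \<zeta> r" using t by simp
  finally have "k * (integral {0..t} \<zeta> + (integral {t..t + r} \<zeta> - integral {0..r} \<zeta>)) = \<eta> * t"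
    using k by (simp add: algebra_simps)
  then have kt: "k * integral {0..t} \<zeta> + k * (integral {t..t + r} \<zeta> - integral {0..r} \<zeta>) = \<eta> * t"
    by (simp add: distrib_left)
  have "renewal_h \<eta> c0 f r m t = m 0 + k * integral {0..t} \<zeta> + (integral {- r..0} ?W + k * (integral {t..t + r} \<zeta> - integral {0..r} \<zeta>))"
    unfolding renewal_h_def \<zeta>r k_def[symmetric] z0 R' ..
  also have "\<dots> = m 0 + \<eta> * t + integral {- r..0} ?W" using kt by simp
  finally show "m t = integral {0..t} (\<lambda>u. zeta c0 f r (t - u) * m u) + renewal_h \<eta> c0 f r m t"
    using eq[of t] t integral_H_renewal(2)[of t] W W2 integral_unique[OF A'] by simp
qed

end

section \<open>The moment equation\<close>

text \<open>The zero extension can jump only at the two endpoints. A degenerate interval, as for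
  \<open>p = 0\<close> or \<open>q = 0\<close>, is covered.\<close>

lemma continuous_supported_on_Icc:
  fixes g :: "real \<Rightarrow> real"
  assumes g: "continuous_on {c..d} g" and z: "\<And>u. u \<notin> {c..d} \<Longrightarrow> g u = 0"
  shows "g \<in> borel_measurable borel" and "\<exists>B. \<forall>u. \<bar>g u\<bar> \<le> B" and "u \<notin> {c, d} \<Longrightarrow> isCont g u"
proof -
  have "(\<lambda>u. indicator {c..d} u *\<^sub>R g u) \<in> borel_measurable borel"
    by (rule borel_measurable_continuous_on_indicator[OF _ g]) simp
  moreover have "(\<lambda>u. indicator {c..d} u *\<^sub>R g u) = g" using z by (auto simp: indicator_def fun_eq_iff)
  ultimately show "g \<in> borel_measurable borel" by simp
  have "bounded (g ` {c..d})" by (intro compact_imp_bounded compact_continuous_image g) simp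
  then obtain B where "\<forall>y\<in>g ` {c..d}. norm y \<le> B" unfolding bounded_iff by blast
  then have B: "\<bar>g u\<bar> \<le> B" if "u \<in> {c..d}" for u using that by auto
  have "\<bar>g u\<bar> \<le> max 0 B" for u using B[of u] z[of u] by (cases "u \<in> {c..d}") auto
  then show "\<exists>B. \<forall>u. \<bar>g u\<bar> \<le> B" by blast
  assume u: "u \<notin> {c, d}"
  show "isCont g u"
  proof (cases "u \<in> {c..d}")
    case True
    with u have "u \<in> interior {c..d}" by auto
    then show ?thesis by (rule continuous_on_interior[OF g])
  next
    case False
    have "\<forall>\<^sub>F x in at u. x \<in> - {c..d}"
      using False by (intro eventually_at_in_open') auto
    then have "\<forall>\<^sub>F x in at u. g x = g u" by eventually_elim (use z False in auto)
    then show ?thesis unfolding isCont_def by (rule tendsto_eventually)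
  qed
qed

lemma natural_filtration_subset:
  assumes "\<And>t. a \<le> t \<Longrightarrow> L t \<in> borel_measurable M"
  shows "natural_filtration M a L t \<subseteq> sets M"
  unfolding natural_filtration_def
proof (rule sets.sigma_sets_subset, safe)
  fix u :: real and B :: "real set" assume "u \<in> {a..t}" "B \<in> sets borel"
  then have [measurable]: "L u \<in> borel_measurable M" "B \<in> sets borel" using assms[of u] by auto
  show "{\<omega> \<in> space M. L u \<omega> \<in> B} \<in> sets M" by measurable
qed

theorem theorem5p2:
  fixes M :: "'a measure" and F :: "real \<Rightarrow> 'a set set"
    and p q r \<eta> c\<mu> c\<nu> :: real and f\<mu> f\<nu> :: "real \<Rightarrow> real"
    and L \<Phi> X :: "real \<Rightarrow> 'a \<Rightarrow> real"
    and m \<phi> :: "real \<Rightarrow> real" and \<kappa>2 c0 :: real and f :: "real \<Rightarrow> real"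
  assumes P: "prob_space M"
    and pq: "p \<ge> 0" "q \<ge> 0" and r_def: "r = max p q" and r_pos: "r > 0"
    and filt: "filtration_usual M (- r) F"
    and levy: "levy_process M (- r) F L"
    and params: "\<eta> > 0" "c\<mu> > 0" "c\<nu> > 0"
    and f\<mu>: "continuous_on {-p..0} f\<mu>" "\<forall>u. f\<mu> u \<ge> 0" "\<forall>u. u \<notin> {-p..0} \<longrightarrow> f\<mu> u = 0"
    and f\<nu>: "continuous_on {-q..0} f\<nu>" "\<forall>u. f\<nu> u \<ge> 0" "\<forall>u. u \<notin> {-q..0} \<longrightarrow> f\<nu> u = 0"
    and \<Phi>_adapted: "adapted_on M {-r..0} (natural_filtration M (- r) L) \<Phi>"
    and \<Phi>_sq: "(\<integral>\<^sup>+\<omega>. (SUP s\<in>{-r..0}. ennreal ((\<Phi> s \<omega>)^2)) \<partial>M) < \<infinity>"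
    and L4: "integrable M (\<lambda>\<omega>. (L 1 \<omega>)^4)"
    and sol: "cdgarch_strong_solution M F p q \<eta> c\<mu> c\<nu> f\<mu> f\<nu> L \<Phi> X"
    and m_def: "m = (\<lambda>t. \<integral>\<omega>. X t \<omega> \<partial>M)"
    and \<phi>_def: "\<phi> = (\<lambda>u. \<integral>\<omega>. \<Phi> u \<omega> \<partial>M)"
    and \<phi>_pos: "\<forall>u\<in>{-r..0}. \<phi> u > 0"
    and \<kappa>2_def: "\<kappa>2 = (\<integral>z. z^2 \<partial>levy_measure M (- r) L)"
    and c0_def: "c0 = c\<mu> - \<kappa>2 * c\<nu>"
    and f_def: "f = (\<lambda>u. f\<mu> u + \<kappa>2 * f\<nu> u)"
  shows
    "(\<forall>t\<ge>-r. integrable M (X t))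
     \<and> (\<forall>t>0. m differentiable (at t)) \<and> continuous_on {0<..} (deriv m)
     \<and> (\<forall>t>0. (\<lambda>u. m (t + u) * f u) integrable_on {-r..0}
              \<and> deriv m t = \<eta> - c0 * m t + integral {-r..0} (\<lambda>u. m (t + u) * f u))
     \<and> (\<forall>u\<in>{-r..0}. m u = \<phi> u)
     \<and> (zeta c0 f r r \<noteq> 0 \<longrightarrow>
          (\<forall>t>0. (\<lambda>u. zeta c0 f r (t - u) * m u) integrable_on {0..t}
                 \<and> m t = integral {0..t} (\<lambda>u. zeta c0 f r (t - u) * m u) + renewal_h \<eta> c0 f r m t)
          \<and> m 0 = \<phi> 0)"
proof -
  interpret levy_setting M "- r" F L
    using P filt levy by (intro levy_setting.intro levy_setting_axioms.intro)
  have ad: "adapted_on M {- r..} F X"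
    and cad: "\<And>\<omega>. \<omega> \<in> space M \<Longrightarrow> cadlag_from (- r) (\<lambda>t. X t \<omega>)"
    and sq: "\<And>t. 0 \<le> t \<Longrightarrow> (\<integral>\<^sup>+\<omega>. (SUP s\<in>{- r..t}. ennreal ((X s \<omega>)\<^sup>2)) \<partial>M) < \<infinity>"
    and init: "AE \<omega> in M. \<forall>u\<in>{- r..0}. X u \<omega> = \<Phi> u \<omega>"
    and eqn: "\<And>t. 0 \<le> t \<Longrightarrow> AE \<omega> in M. X t \<omega> = cdgarch_rhs p q \<eta> c\<mu> c\<nu> f\<mu> f\<nu> L \<Phi> X t \<omega>"
    using sol unfolding cdgarch_strong_solution_def r_def[symmetric] by blast+
  have jump_rate: "jump_rate = \<kappa>2" unfolding jump_rate_eq \<kappa>2_def ..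
  have Xm: "X t \<in> borel_measurable M" if "- r \<le> t" for t by (rule adapted_measurable[OF ad that])
  \<comment> \<open>From \<open>\<bar>z\<bar> \<le> 1 + z\<^sup>2\<close> and the mean of the
    squared running supremum, uniformly in \<open>t\<close> up to \<open>T\<close>.\<close>
  have bound: "\<exists>C. \<forall>t\<in>{- r..T}. (\<integral>\<^sup>+\<omega>. ennreal \<bar>X t \<omega>\<bar> \<partial>M) \<le> ennreal C" if T: "0 \<le> T" for T
  proof (intro exI ballI)
    fix t assume t: "t \<in> {- r..T}"
    have [measurable]: "X t \<in> borel_measurable M" using t by (intro Xm) auto
    have "\<bar>z\<bar> \<le> 1 + z\<^sup>2" for z :: real
      using zero_le_power2[of "\<bar>z\<bar> - 1"] by (simp add: power2_diff)
    then have "(\<integral>\<^sup>+\<omega>. ennreal \<bar>X t \<omega>\<bar> \<partial>M) \<le> (\<integral>\<^sup>+\<omega>. 1 + ennreal ((X t \<omega>)\<^sup>2) \<partial>M)"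
      by (intro nn_integral_mono) (simp add: ennreal_plus[symmetric] ennreal_1[symmetric] del: ennreal_plus ennreal_1 add: ennreal_leI)
    also have "\<dots> = 1 + (\<integral>\<^sup>+\<omega>. ennreal ((X t \<omega>)\<^sup>2) \<partial>M)"
      by (subst nn_integral_add) (auto simp: emeasure_space_1)
    also have "\<dots> \<le> 1 + (\<integral>\<^sup>+\<omega>. (SUP s\<in>{- r..T}. ennreal ((X s \<omega>)\<^sup>2)) \<partial>M)"
      using t by (intro add_left_mono nn_integral_mono SUP_upper)
    also have "\<dots> = ennreal (enn2real (1 + (\<integral>\<^sup>+\<omega>. (SUP s\<in>{- r..T}. ennreal ((X s \<omega>)\<^sup>2)) \<partial>M)))"
      using sq[OF T] by simp
    finally show "(\<integral>\<^sup>+\<omega>. ennreal \<bar>X t \<omega>\<bar> \<partial>M) \<le> ennreal (enn2real (1 + (\<integral>\<^sup>+\<omega>. (SUP s\<in>{- r..T}. ennreal ((X s \<omega>)\<^sup>2)) \<partial>M)))" .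
  qed
  have Xint: "integrable M (X t)" if t: "- r \<le> t" for t
  proof -
    obtain C where "\<forall>s\<in>{- r..max 0 t}. (\<integral>\<^sup>+\<omega>. ennreal \<bar>X s \<omega>\<bar> \<partial>M) \<le> ennreal C" using bound[of "max 0 t"] by auto
    then have "(\<integral>\<^sup>+\<omega>. ennreal \<bar>X t \<omega>\<bar> \<partial>M) \<le> ennreal C" using t by auto
    then show ?thesis using Xm[OF t] by (intro integrableI_bounded) (auto intro: le_less_trans)
  qed
  have \<Phi>m: "\<Phi> u \<in> borel_measurable M" if "u \<in> {- r..0}" for u
    using \<Phi>_adapted that natural_filtration_subset[of "- r" L M u] L_measurable
    unfolding adapted_on_def measurable_def by (auto simp: vimage_def Int_def conj_commute)
  have m_init: "m u = \<phi> u" if u: "u \<in> {- r..0}" for u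
    unfolding m_def \<phi>_def
  proof (rule integral_cong_AE)
    show "AE \<omega> in M. X u \<omega> = \<Phi> u \<omega>" using init by eventually_elim (use u in auto)
  qed (use u Xm \<Phi>m in auto)
  have \<kappa>2: "0 \<le> \<kappa>2" using jump_rate_nonneg jump_rate by simp
  have f\<mu>z: "f\<mu> u = 0" if "u \<notin> {- p..0}" for u using f\<mu>(3) that by blast
  have f\<nu>z: "f\<nu> u = 0" if "u \<notin> {- q..0}" for u using f\<nu>(3) that by blast
  note F\<mu> = continuous_supported_on_Icc[OF f\<mu>(1) f\<mu>z] and F\<nu> = continuous_supported_on_Icc[OF f\<nu>(1) f\<nu>z]
  obtain B\<mu> where B\<mu>: "\<And>u. \<bar>f\<mu> u\<bar> \<le> B\<mu>" using F\<mu>(2) by blast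
  obtain B\<nu> where B\<nu>: "\<And>u. \<bar>f\<nu> u\<bar> \<le> B\<nu>" using F\<nu>(2) by blast
  have J: "(\<lambda>(t, \<omega>). X (max (- r) t) \<omega>) \<in> borel_measurable (borel \<Otimes>\<^sub>M M)"
    by (intro right_continuous_joint_measurable Xm cadlag_right_tendsto[OF cad]) auto
  \<comment> \<open>The exceptional points are the endpoints of the two supports, which share
    \<open>0\<close>.\<close>
  interpret delay_kernel m f r "B\<mu> + \<kappa>2 * B\<nu>" "{- p, - q, 0}"
  proof
    show "0 < r" by (rule r_pos)
    show "(\<lambda>t. m (max (- r) t)) \<in> borel_measurable borel"
      unfolding m_def by (rule borel_measurable_lebesgue_integral[OF J])
    show "\<exists>K. \<forall>s\<in>{- r..T}. \<bar>m s\<bar> \<le> K" for T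
    proof -
      obtain C where C: "\<forall>t\<in>{- r..max 0 T}. (\<integral>\<^sup>+\<omega>. ennreal \<bar>X t \<omega>\<bar> \<partial>M) \<le> ennreal C" using bound[of "max 0 T"] by auto
      have "\<bar>m s\<bar> \<le> max 0 C" if s: "s \<in> {- r..T}" for s
      proof -
        have "ennreal \<bar>m s\<bar> \<le> (\<integral>\<^sup>+\<omega>. ennreal \<bar>X s \<omega>\<bar> \<partial>M)"
          using integral_norm_bound_ennreal[OF Xint[of s]] s by (simp add: m_def)
        also have "\<dots> \<le> ennreal C" using C s by auto
        also have "\<dots> = ennreal (max 0 C)" by simp
        finally show ?thesis by (simp only: ennreal_le_iff[OF max.cobounded1])
      qed
      then show ?thesis by blast
    qed
    show "f \<in> borel_measurable borel" unfolding f_def using F\<mu>(1) F\<nu>(1) by simp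
    show "\<bar>f u\<bar> \<le> B\<mu> + \<kappa>2 * B\<nu>" for u
    proof -
      have "\<bar>f u\<bar> \<le> \<bar>f\<mu> u\<bar> + \<bar>\<kappa>2 * f\<nu> u\<bar>" unfolding f_def by (rule abs_triangle_ineq)
      also have "\<dots> \<le> B\<mu> + \<kappa>2 * B\<nu>" using B\<mu>[of u] mult_left_mono[OF B\<nu>[of u] \<kappa>2] \<kappa>2 by (simp add: abs_mult)
      finally show ?thesis .
    qed
    show "f u = 0" if "u \<notin> {- r..0}" for u
    proof -
      have "u \<notin> {- p..0}" "u \<notin> {- q..0}" using that by (auto simp: r_def)
      then show ?thesis by (simp add: f_def f\<mu>z f\<nu>z)
    qed
    show "isCont f u" if "u \<notin> {- p, - q, 0}" for u
      unfolding f_def using F\<mu>(3)[of u] F\<nu>(3)[of u] that by (intro continuous_intros) auto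
  qed simp
  \<comment> \<open>Proved for one \<open>t\<close> at a time: the variance equation holds almost
    surely at each fixed \<open>t\<close>, which is all that taking expectations needs.\<close>
  have main: "m t = m 0 + \<eta> * t - c0 * integral {0..t} m + integral {0..t} H" if t0: "0 \<le> t" for t
  proof (cases "t = 0")
    case False
    then have t: "0 < t" using t0 by simp
    have T: "- r < t" using t r_pos by simp
    obtain C where "\<forall>s\<in>{- r..t}. (\<integral>\<^sup>+\<omega>. ennreal \<bar>X s \<omega>\<bar> \<partial>M) \<le> ennreal C" using bound[OF t0] by blast
    then have C: "(\<integral>\<^sup>+\<omega>. ennreal \<bar>X s \<omega>\<bar> \<partial>M) \<le> ennreal C" if "s \<in> {- r..t}" for s using that by blast
    \<comment> \<open>\<open>U\<close> and \<open>V\<close> are the running integrals of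
      \<open>X\<close> against \<open>ds\<close> and \<open>dS\<close> from \<open>- r\<close>. The
      horizon \<open>t\<close> suffices, since every window \<open>{u..t + u}\<close> has
      \<open>u \<le> 0\<close>.\<close>
    obtain U CU where U: "\<And>s. - r \<le> s \<Longrightarrow> U s \<in> borel_measurable M"
      "\<And>\<omega> s. \<omega> \<in> space M \<Longrightarrow> - r \<le> s \<Longrightarrow> ((\<lambda>u. U u \<omega>) \<longlongrightarrow> U s \<omega>) (at_right s)"
      "\<And>s. - r \<le> s \<Longrightarrow> (\<integral>\<^sup>+\<omega>. ennreal \<bar>U s \<omega>\<bar> \<partial>M) \<le> ennreal CU"
      "\<And>s. s \<in> {- r..t} \<Longrightarrow> expectation (U s) = integral {- r..s} (\<lambda>s. expectation (X s))"
      "\<And>\<omega> c d. \<omega> \<in> space M \<Longrightarrow> - r \<le> c \<Longrightarrow> c \<le> d \<Longrightarrow> d \<le> t \<Longrightarrow>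
        integral {c..d} (\<lambda>s. X s \<omega>) = U d \<omega> - U c \<omega>"
      by (rule time_integral_process[OF Xm cad T C]; (assumption | (rule that; assumption)))
    obtain V CV where V: "\<And>s. - r \<le> s \<Longrightarrow> V s \<in> borel_measurable M"
      "\<And>\<omega> s. \<omega> \<in> space M \<Longrightarrow> - r \<le> s \<Longrightarrow> ((\<lambda>u. V u \<omega>) \<longlongrightarrow> V s \<omega>) (at_right s)"
      "\<And>s. - r \<le> s \<Longrightarrow> (\<integral>\<^sup>+\<omega>. ennreal \<bar>V s \<omega>\<bar> \<partial>M) \<le> ennreal CV"
      "\<And>s. s \<in> {- r..t} \<Longrightarrow> expectation (V s) = jump_rate * integral {- r..s} (\<lambda>s. expectation (X s))"
      "AE \<omega> in M. \<forall>c d. - r \<le> c \<longrightarrow> c \<le> d \<longrightarrow> d \<le> t \<longrightarrow>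
        dS_integral (\<lambda>s. X s \<omega>) (\<lambda>s. L s \<omega>) c d = V d \<omega> - V c \<omega>"
      by (rule jump_integral_process[OF ad cad T C]; (assumption | (rule that; assumption)))
    have U4: "expectation (U s) = integral {- r..s} m" and V4: "expectation (V s) = \<kappa>2 * integral {- r..s} m" if "s \<in> {- r..t}" for s
      using U(4)[OF that] V(4)[OF that] by (simp_all add: m_def jump_rate)
    have Uint: "integrable M (U s)" and Vint: "integrable M (V s)" if "- r \<le> s" for s
      using U(1,3)[OF that] V(1,3)[OF that] by (auto intro!: integrableI_bounded intro: le_less_trans)
    have rp: "- r \<le> - p" "- r \<le> - q" by (auto simp: r_def)
    note DU' = expectation_delay_integral[OF U(1-3) F\<mu>(1) B\<mu> rp(1) t0]
      and DV' = expectation_delay_integral[OF V(1-3) F\<nu>(1) B\<nu> rp(2) t0]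
    let ?IU = "\<lambda>\<omega>. LINT u:{- p..0}|lborel. (U (t + u) \<omega> - U u \<omega>) * f\<mu> u"
    let ?IV = "\<lambda>\<omega>. LINT u:{- q..0}|lborel. (V (t + u) \<omega> - V u \<omega>) * f\<nu> u"
    have DU: "integrable M ?IU" "AE \<omega> in M. integral {- p..0} (\<lambda>u. (U (t + u) \<omega> - U u \<omega>) * f\<mu> u) = ?IU \<omega>"
      "expectation ?IU = integral {- p..0} (\<lambda>u. (expectation (U (t + u)) - expectation (U u)) * f\<mu> u)"
      by (intro DU'; assumption)+
    have DV: "integrable M ?IV" "AE \<omega> in M. integral {- q..0} (\<lambda>u. (V (t + u) \<omega> - V u \<omega>) * f\<nu> u) = ?IV \<omega>"
      "expectation ?IV = integral {- q..0} (\<lambda>u. (expectation (V (t + u)) - expectation (V u)) * f\<nu> u)"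
      by (intro DV'; assumption)+
    \<comment> \<open>The variance equation on a path, with inner integrals replaced by increments
      of \<open>U\<close> and \<open>V\<close>, and the initial value by \<open>X 0\<close>.\<close>
    let ?R = "\<lambda>\<omega>. X 0 \<omega> + \<eta> * t + (?IU \<omega> - c\<mu> * (U t \<omega> - U 0 \<omega>)) + (?IV \<omega> + c\<nu> * (V t \<omega> - V 0 \<omega>))"
    have r0: "- r \<le> 0" "- r \<le> t" using t r_pos by auto
    note ints = Xint[OF r0(1)] Uint[OF r0(1)] Uint[OF r0(2)] Vint[OF r0(1)] Vint[OF r0(2)] DU(1) DV(1)
    have "AE \<omega> in M. X t \<omega> = ?R \<omega>"
      using eqn[OF t0] init V(5) DU(2) DV(2) AE_space
    proof eventually_elim
      case (elim \<omega>)
      have "integral {- p..0} (\<lambda>u. integral {u..t + u} (\<lambda>s. X s \<omega>) * f\<mu> u) = integral {- p..0} (\<lambda>u. (U (t + u) \<omega> - U u \<omega>) * f\<mu> u)"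
        using U(5)[OF elim(6)] rp t0 by (intro integral_cong) auto
      moreover have "integral {- q..0} (\<lambda>u. dS_integral (\<lambda>s. X s \<omega>) (\<lambda>s. L s \<omega>) u (t + u) * f\<nu> u) = integral {- q..0} (\<lambda>u. (V (t + u) \<omega> - V u \<omega>) * f\<nu> u)"
        using elim(3) rp t0 by (intro integral_cong) auto
      moreover have "integral {0..t} (\<lambda>s. X s \<omega>) = U t \<omega> - U 0 \<omega>" using U(5)[OF elim(6), of 0 t] r0 t0 by auto
      moreover have "dS_integral (\<lambda>s. X s \<omega>) (\<lambda>s. L s \<omega>) 0 t = V t \<omega> - V 0 \<omega>" using elim(3) r0 t0 by auto
      moreover have "theta \<eta> \<Phi> t \<omega> = X 0 \<omega> + \<eta> * t" using elim(2) t r0 by (simp add: theta_def ext_init_def)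
      ultimately show ?case using elim(1) unfolding cdgarch_rhs_def elim(4) elim(5) by simp
    qed
    then have "m t = expectation ?R"
      unfolding m_def using ints Xm[OF r0(2)]
      by (intro integral_cong_AE) (auto intro!: borel_measurable_add borel_measurable_diff borel_measurable_times dest!: borel_measurable_integrable)
    also have "\<dots> = m 0 + \<eta> * t + (expectation ?IU - c\<mu> * (expectation (U t) - expectation (U 0)))
        + (expectation ?IV + c\<nu> * (expectation (V t) - expectation (V 0)))"
      using ints by (simp add: m_def prob_space)
    finally have mt: "m t = m 0 + \<eta> * t + (expectation ?IU - c\<mu> * (expectation (U t) - expectation (U 0)))
        + (expectation ?IV + c\<nu> * (expectation (V t) - expectation (V 0)))" .
    let ?M = "\<lambda>u. integral {- r..t + u} m - integral {- r..u} m"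
    \<comment> \<open>Continuity in \<open>u\<close> makes the products with \<open>f\<mu>\<close>
      and \<open>f\<nu>\<close> integrable on their windows.\<close>
    have Mc: "continuous_on {- r..0} ?M"
    proof -
      have c: "continuous_on {- r..t} (\<lambda>x. integral {- r..x} m)"
        by (rule indefinite_integral_continuous_1[OF m_integrable_on]) simp
      have "continuous_on {- r..0} (\<lambda>u. t + u)" by (intro continuous_intros)
      then have "continuous_on {- r..0} (\<lambda>u. integral {- r..t + u} m)"
        by (rule continuous_on_compose2[OF c]) (use t in auto)
      moreover have "continuous_on {- r..0} (\<lambda>u. integral {- r..u} m)"
        by (rule continuous_on_subset[OF c]) (use t in auto)
      ultimately show ?thesis by (rule continuous_on_diff)
    qed
    have IU: "expectation ?IU = integral {- p..0} (\<lambda>u. ?M u * f\<mu> u)"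
      unfolding DU(3) using rp t by (intro integral_cong) (auto simp: U4)
    have IV: "expectation ?IV = \<kappa>2 * integral {- q..0} (\<lambda>u. ?M u * f\<nu> u)"
    proof -
      have "expectation ?IV = integral {- q..0} (\<lambda>u. \<kappa>2 * (?M u * f\<nu> u))"
        unfolding DV(3) using rp t by (intro integral_cong) (auto simp: V4 algebra_simps)
      then show ?thesis by simp
    qed
    \<comment> \<open>Both windows are enlarged to \<open>[- r, 0]\<close> by zero, so that the two
      delay terms merge into one with kernel \<open>f\<close>.\<close>
    have hU: "((\<lambda>u. ?M u * f\<mu> u) has_integral integral {- p..0} (\<lambda>u. ?M u * f\<mu> u)) {- r..0}"
    proof (rule has_integral_on_superset)
      show "((\<lambda>u. ?M u * f\<mu> u) has_integral integral {- p..0} (\<lambda>u. ?M u * f\<mu> u)) {- p..0}"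
        using rp by (intro integrable_integral integrable_continuous_real continuous_on_mult continuous_on_subset[OF Mc] f\<mu>(1)) auto
    qed (use f\<mu>z rp in auto)
    have hV: "((\<lambda>u. ?M u * f\<nu> u) has_integral integral {- q..0} (\<lambda>u. ?M u * f\<nu> u)) {- r..0}"
    proof (rule has_integral_on_superset)
      show "((\<lambda>u. ?M u * f\<nu> u) has_integral integral {- q..0} (\<lambda>u. ?M u * f\<nu> u)) {- q..0}"
        using rp by (intro integrable_integral integrable_continuous_real continuous_on_mult continuous_on_subset[OF Mc] f\<nu>(1)) auto
    qed (use f\<nu>z rp in auto)
    have "((\<lambda>u. ?M u * f u) has_integral expectation ?IU + expectation ?IV) {- r..0}"
      using has_integral_add[OF hU has_integral_mult_right[OF hV, of \<kappa>2]] unfolding IU IV by (simp add: f_def algebra_simps)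
    then have "expectation ?IU + expectation ?IV = integral {0..t} H"
      using integral_delay[OF t0] by (simp add: integral_unique)
    moreover have "integral {- r..t} m - integral {- r..0} m = integral {0..t} m"
      using Henstock_Kurzweil_Integration.integral_combine[OF _ _ m_integrable_on[of "- r" t], of 0] r0 t by simp
    moreover have "expectation (U t) = integral {- r..t} m" "expectation (U 0) = integral {- r..0} m"
      "expectation (V t) = \<kappa>2 * integral {- r..t} m" "expectation (V 0) = \<kappa>2 * integral {- r..0} m"
      using U4 V4 r0 t by auto
    \<comment> \<open>The atoms at \<open>0\<close> contribute \<open>- c\<mu>\<close> and
      \<open>\<kappa>2 * c\<nu>\<close> times the same integral of \<open>m\<close> over
      \<open>[0, t]\<close>, which is where \<open>- c0\<close> arises.\<close>
    ultimately show ?thesis using mt unfolding c0_def by (simp add: algebra_simps)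
  qed simp
  have deriv: "(m has_real_derivative \<eta> - c0 * m t + H t) (at t)" if "0 < t" for t
    by (rule delay_differential(1)[OF main that])
  have deriv_eq: "deriv m t = \<eta> - c0 * m t + H t" if "0 < t" for t
    by (rule DERIV_imp_deriv[OF deriv[OF that]])
  have "continuous_on {0<..} (\<lambda>t. \<eta> - c0 * m t + H t)"
    by (rule delay_differential(2)[OF main zero_less_one])
  then have "continuous_on {0<..} (deriv m)"
    by (rule continuous_on_eq) (simp add: deriv_eq)
  moreover have "m differentiable (at t)" if "0 < t" for t
    using deriv[OF that] real_differentiable_def by blast
  ultimately show ?thesis
    using Xint m_init H_integrable_on deriv_eq renewal_equation[OF main] r_pos by (auto simp: H_def)
qed

end
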